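(* Let $k$ be a field, let $G$ be a $C_5$-free vertex decomposable graph with vertex set $\{x_1,\dots,x_n\}$, and let $R=k[x_1,\dots,x_n]$. Then $$\mathrm{reg}(R/I(G))=c_G,$$ where $c_G$ is the maximum cardinality of a pairwise $3$-disjoint set of edges of $G$.
   Context: All graphs are finite and simple. For a graph $G$ with $V(G)=\{x_1,\dots,x_n\}$, the edge ideal is $I(G)=\langle x_ix_j \mid \{x_i,x_j\}\in E(G)\rangle\subseteq R=k[x_1,\dots,x_n]$. For a vertex $v$, $N_G(v)$ is the set of neighbors of $v$ and $N_G[v]=N_G(v)\cup\{v\}$ (also written $N[v]$). For $S\subseteq V(G)$, $G\setminus S$ is the induced subgraph on $V(G)\setminus S$. An independent set of $G$ is a subset of $V(G)$ containing no edge of $G$. $G$ is $C_5$-free if it contains no cycle of length $5$ as a (not necessarily induced) subgraph. A graph $G$ is (recursively) vertex decomposable if $G$ has no edges, or if (i) there is a vertex $x$ of $G$ such that $G\setminus\{x\}$ and $G\setminus N[x]$ are both vertex decomposable, and (ii) no independent set in $G\setminus N[x]$ is a maximal independent set in $G\setminus\{x\}$. The Castelnuovo-Mumford regularity of a graded $R$-module $M$ is $\mathrm{reg}(M)=\max\{j-i\mid \beta_{i,j}(M)\neq 0\}$, where $\beta_{i,j}(M)$ are the graded Betti numbers over $R$. Two edges $\{x,y\}$ and $\{w,z\}$ of $G$ are $3$-disjoint if the induced subgraph of $G$ on $\{x,y,w,z\}$ consists of exactly two disjoint edges. A set $A\subseteq E(G)$ is pairwise $3$-disjoint if every two distinct edges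 in $A$ are $3$-disjoint in $G$; the empty set is allowed, so $c_G=0$ if $G$ has no edges. *)

theory Defs
  imports "HOL-Library.Poly_Mapping" "HOL-Algebra.QuotRing" "HOL-Algebra.Module"
    "Jordan_Normal_Form.Matrix"
begin

section \<open>Graphs\<close>

definition simple_graph :: "'v set \<Rightarrow> 'v set set \<Rightarrow> bool" where
  "simple_graph V E \<longleftrightarrow> finite V \<and> (\<forall>e\<in>E. e \<subseteq> V \<and> card e = 2)"

definition neighbors :: "'v set set \<Rightarrow> 'v \<Rightarrow> 'v set" where
  "neighbors E x = {y. {x, y} \<in> E}"

definition closed_neighbors :: "'v set set \<Rightarrow> 'v \<Rightarrow> 'v set" where
  "closed_neighbors E x = insert x (neighbors E x)"

text \<open>The edges of the induced subgraph on \<open>W\<close>; deleting a vertex set \<open>S\<close> from the graph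
  \<open>(V, E)\<close> thus gives the graph \<open>(V - S, induced_edges E (V - S))\<close>.\<close>

definition induced_edges :: "'v set set \<Rightarrow> 'v set \<Rightarrow> 'v set set" where
  "induced_edges E W = {e \<in> E. e \<subseteq> W}"

definition independent_set :: "'v set \<Rightarrow> 'v set set \<Rightarrow> 'v set \<Rightarrow> bool" where
  "independent_set V E S \<longleftrightarrow> S \<subseteq> V \<and> (\<forall>e\<in>E. \<not> e \<subseteq> S)"

definition maximal_independent_set :: "'v set \<Rightarrow> 'v set set \<Rightarrow> 'v set \<Rightarrow> bool" where
  "maximal_independent_set V E S \<longleftrightarrow>
     independent_set V E S \<and> (\<forall>T. independent_set V E T \<and> S \<subseteq> T \<longrightarrow> T = S)"

inductive vertex_decomposable :: "'v set \<Rightarrow> 'v set set \<Rightarrow> bool" where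
  no_edges: "vertex_decomposable V {}"
| shedding: "\<lbrakk>x \<in> V;
     V1 = V - {x}; E1 = induced_edges E V1;
     V2 = V - closed_neighbors E x; E2 = induced_edges E V2;
     vertex_decomposable V1 E1; vertex_decomposable V2 E2;
     \<forall>S. independent_set V2 E2 S \<longrightarrow> \<not> maximal_independent_set V1 E1 S\<rbrakk>
   \<Longrightarrow> vertex_decomposable V E"

text \<open>The list enumerates the vertices of a 5-cycle in cyclic order; the cycle need not be
  induced.\<close>

definition C5_free :: "'v set \<Rightarrow> 'v set set \<Rightarrow> bool" where
  "C5_free V E \<longleftrightarrow>
     \<not> (\<exists>xs. length xs = 5 \<and> distinct xs \<and> set xs \<subseteq> V \<and>
           (\<forall>i<5. {xs ! i, xs ! ((i + 1) mod 5)} \<in> E))"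

definition three_disjoint :: "'v set set \<Rightarrow> 'v set \<Rightarrow> 'v set \<Rightarrow> bool" where
  "three_disjoint E e f \<longleftrightarrow> e \<inter> f = {} \<and> induced_edges E (e \<union> f) = {e, f}"

definition pairwise_three_disjoint :: "'v set set \<Rightarrow> 'v set set \<Rightarrow> bool" where
  "pairwise_three_disjoint E A \<longleftrightarrow>
     A \<subseteq> E \<and> (\<forall>e\<in>A. \<forall>f\<in>A. e \<noteq> f \<longrightarrow> three_disjoint E e f)"

definition three_disjoint_number :: "'v set set \<Rightarrow> nat" where
  "three_disjoint_number E = Max {card A | A. pairwise_three_disjoint E A}"


section \<open>The polynomial ring on a set of variables\<close>

text \<open>A monomial is its finitely supported exponent function, a polynomial the finitely supported
  function of its coefficients. The variables are the elements of \<open>'v\<close>, and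
  \<open>polynomial_ring V\<close> is the ring of those polynomials in which only variables from \<open>V\<close> occur.\<close>

type_synonym ('v, 'k) mpoly = "('v \<Rightarrow>\<^sub>0 nat) \<Rightarrow>\<^sub>0 'k"

definition polynomial_ring :: "'v set \<Rightarrow> ('v, 'k::field) mpoly ring" where
  "polynomial_ring V =
     \<lparr>carrier = {p. \<forall>m\<in>Poly_Mapping.keys p. Poly_Mapping.keys m \<subseteq> V},
      monoid.mult = (*), one = 1, zero = 0, add = (+)\<rparr>"

definition var :: "'v \<Rightarrow> ('v, 'k::field) mpoly" where
  "var x = Poly_Mapping.single (Poly_Mapping.single x 1) 1"

definition monomial_degree :: "('v \<Rightarrow>\<^sub>0 nat) \<Rightarrow> nat" where
  "monomial_degree m = (\<Sum>x\<in>Poly_Mapping.keys m. Poly_Mapping.lookup m x)"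

text \<open>The graded piece of degree \<open>j\<close>; it is zero for negative \<open>j\<close>.\<close>

definition homogeneous_part :: "'v set \<Rightarrow> int \<Rightarrow> ('v, 'k::field) mpoly set" where
  "homogeneous_part V j =
     {p \<in> carrier (polynomial_ring V). \<forall>m\<in>Poly_Mapping.keys p. int (monomial_degree m) = j}"

definition edge_ideal :: "'v set \<Rightarrow> 'v set set \<Rightarrow> ('v, 'k::field) mpoly set" where
  "edge_ideal V E = Idl\<^bsub>polynomial_ring V\<^esub> {var x * var y | x y. {x, y} \<in> E}"

text \<open>The quotient ring \<open>R Quot I\<close>, made an \<open>R\<close>-module through the canonical map.\<close>

definition quotient_module :: "('a, 'b) ring_scheme \<Rightarrow> 'a set \<Rightarrow> ('a, 'a set) module" where
  "quotient_module R I =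
     \<lparr>carrier = carrier (R Quot I), monoid.mult = monoid.mult (R Quot I), one = one (R Quot I),
      zero = zero (R Quot I), add = add (R Quot I),
      smult = (\<lambda>r X. (I +>\<^bsub>R\<^esub> r) \<otimes>\<^bsub>R Quot I\<^esub> X)\<rparr>"

definition quotient_grading ::
  "'v set \<Rightarrow> ('v, 'k::field) mpoly set \<Rightarrow> int \<Rightarrow> ('v, 'k) mpoly set set" where
  "quotient_grading V I j = (\<lambda>p. I +>\<^bsub>polynomial_ring V\<^esub> p) ` homogeneous_part V j"


section \<open>Minimal graded free resolutions, Betti numbers, regularity\<close>

text \<open>A graded module over \<open>R = polynomial_ring V\<close> is given by a module \<open>M\<close> together with its
  family \<open>gr\<close> of homogeneous components. A graded free resolution
  \<open>\<dots> \<rightarrow> F\<^sub>2 \<rightarrow> F\<^sub>1 \<rightarrow> F\<^sub>0 \<rightarrow> M \<rightarrow> 0\<close> by finitely generated modules is recorded in coordinates: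
  \<open>F\<^sub>i\<close> is the direct sum of the \<open>R(- shift i t)\<close> for \<open>t < rnk i\<close>, \<open>diff i\<close> is the matrix of
  \<open>F\<^sub>i\<^sub>+\<^sub>1 \<rightarrow> F\<^sub>i\<close>, and \<open>aug t\<close> is the image in \<open>M\<close> of the \<open>t\<close>-th basis element of \<open>F\<^sub>0\<close>. The
  \<open>t\<close>-th basis element of \<open>F\<^sub>i\<close> has degree \<open>shift i t\<close>, and all maps are homogeneous of
  degree 0.\<close>

record ('r, 'm) free_resolution =
  rnk :: "nat \<Rightarrow> nat"
  shift :: "nat \<Rightarrow> nat \<Rightarrow> int"
  diff :: "nat \<Rightarrow> 'r mat"
  aug :: "nat \<Rightarrow> 'm"

definition free_vecs :: "'v set \<Rightarrow> nat \<Rightarrow> ('v, 'k::field) mpoly vec set" where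
  "free_vecs V n = {u \<in> carrier_vec n. \<forall>t<n. u $ t \<in> carrier (polynomial_ring V)}"

definition aug_map ::
  "(('v, 'k::field) mpoly, 'm) module \<Rightarrow> (('v, 'k) mpoly, 'm) free_resolution \<Rightarrow> ('v, 'k) mpoly vec \<Rightarrow> 'm"
  where
  "aug_map M F u = (\<Oplus>\<^bsub>M\<^esub>t\<in>{..<rnk F 0}. (u $ t) \<odot>\<^bsub>M\<^esub> aug F t)"

definition graded_free_resolution ::
  "'v set \<Rightarrow> (('v, 'k::field) mpoly, 'm) module \<Rightarrow> (int \<Rightarrow> 'm set) \<Rightarrow>
   (('v, 'k) mpoly, 'm) free_resolution \<Rightarrow> bool" where
  "graded_free_resolution V M gr F \<longleftrightarrow>
     (\<forall>t<rnk F 0. aug F t \<in> gr (shift F 0 t)) \<and>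
     (\<forall>i. diff F i \<in> carrier_mat (rnk F i) (rnk F (Suc i))) \<and>
     (\<forall>i. \<forall>s<rnk F i. \<forall>t<rnk F (Suc i).
        diff F i $$ (s, t) \<in> homogeneous_part V (shift F (Suc i) t - shift F i s)) \<and>
     aug_map M F ` free_vecs V (rnk F 0) = carrier M \<and>
     {u \<in> free_vecs V (rnk F 0). aug_map M F u = \<zero>\<^bsub>M\<^esub>} =
       (\<lambda>w. diff F 0 *\<^sub>v w) ` free_vecs V (rnk F 1) \<and>
     (\<forall>i. {u \<in> free_vecs V (rnk F (Suc i)). diff F i *\<^sub>v u = 0\<^sub>v (rnk F i)} =
       (\<lambda>w. diff F (Suc i) *\<^sub>v w) ` free_vecs V (rnk F (Suc (Suc i))))"

text \<open>Minimality: the image of \<open>F\<^sub>i\<^sub>+\<^sub>1\<close> lies in \<open>\<mm>F\<^sub>i\<close>, where \<open>\<mm>\<close> is the ideal generated by the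
  variables, that is, the polynomials without constant term.\<close>

definition minimal_graded_free_resolution ::
  "'v set \<Rightarrow> (('v, 'k::field) mpoly, 'm) module \<Rightarrow> (int \<Rightarrow> 'm set) \<Rightarrow>
   (('v, 'k) mpoly, 'm) free_resolution \<Rightarrow> bool" where
  "minimal_graded_free_resolution V M gr F \<longleftrightarrow>
     graded_free_resolution V M gr F \<and>
     (\<forall>i. \<forall>s<rnk F i. \<forall>t<rnk F (Suc i). Poly_Mapping.lookup (diff F i $$ (s, t)) 0 = 0)"

text \<open>The number of summands \<open>R(-j)\<close> in step \<open>i\<close> of a minimal graded free resolution of \<open>M\<close>. For
  \<open>V\<close> finite and \<open>M\<close> finitely generated such a resolution exists and is unique up to isomorphism,
  so that the number does not depend on the choice.\<close>

definition graded_betti ::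
  "'v set \<Rightarrow> (('v, 'k::field) mpoly, 'm) module \<Rightarrow> (int \<Rightarrow> 'm set) \<Rightarrow> nat \<Rightarrow> int \<Rightarrow> nat" where
  "graded_betti V M gr i j =
     (let F = (SOME F. minimal_graded_free_resolution V M gr F)
      in card {t. t < rnk F i \<and> shift F i t = j})"

definition regularity ::
  "'v set \<Rightarrow> (('v, 'k::field) mpoly, 'm) module \<Rightarrow> (int \<Rightarrow> 'm set) \<Rightarrow> int" where
  "regularity V M gr = Max {j - int i | i j. graded_betti V M gr i j \<noteq> 0}"

end

theory Submission
  imports Defs "HOL-Library.Nat_Bijection"
begin

text \<open>All resolutions are built over the Boolean lattice of vertex sets instead of the polynomial
  ring. A squarefree multigraded complex of free modules is a finite set of basis elements, each
  with a homological degree and a label in the power set of \<open>V\<close>, together with a matrix of scalars;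
  its strand over \<open>U \<subseteq> V\<close> consists of the basis elements with label inside \<open>U\<close>. It resolves \<open>R/I(G)\<close>
  iff every strand is a resolution of \<open>k\<close> (\<open>U\<close> independent) or of \<open>0\<close> (\<open>U\<close> dependent). Mapping cones
  glue a resolution for \<open>G\<close> from those for \<open>G - x\<close> and \<open>G - N[x]\<close>, Gaussian elimination makes it
  minimal, and discarding labels outside \<open>W\<close> gives a resolution for the induced subgraph on \<open>W\<close>.

  In a \<open>C\<^sub>5\<close>-free graph a shedding vertex \<open>x\<close> has a neighbour \<open>y\<close> with \<open>N[y] \<subseteq> N[x]\<close>, so that adding
  \<open>{x, y}\<close> to a pairwise 3-disjoint set of \<open>G - N[x]\<close> keeps it pairwise 3-disjoint; this matches the
  cost of the cone and yields \<open>reg \<le> c\<^sub>G\<close>. Conversely, restricting to the vertices of a maximum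
  pairwise 3-disjoint set leaves the complete intersection of \<open>c\<^sub>G\<close> quadrics. Both bounds transfer to
  every minimal graded free resolution because the shifts of a minimal resolution occur in any
  other resolution.\<close>

section \<open>Squarefree resolutions\<close>

text \<open>Working over the Boolean lattice is possible because a complex with squarefree labels
  looks in multidegree \<open>m\<close> like its strand over the support of \<open>m\<close>;
  exactness becomes a linear condition over the field for each vertex set.

  The quantity followed through the induction is label size minus degree. In the cone for a vertex
  \<open>x\<close> the shifted copy of the resolution of \<open>G - x\<close> gains one in both,
  while the copy coming from the link gains one in the label only. So the link must come with a
  bound smaller by one. The cone need not be minimal, which is harmless here: cancellation deletes
  basis elements and leaves the others in their degrees and labels.

  The main obstacle is that \<open>graded_betti\<close> reads an arbitrarily chosen minimal
  resolution. What can be compared easily is which shifts occur, not how often, and a maximum over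
  nonzero Betti numbers needs no more. For the lower bound it is the minimality of the Koszul
  complex of the matching that counts: its top shift has to occur in any resolution over
  \<open>W\<close>, hence among the labels of the given one.\<close>

definition supported_on :: "'b set \<Rightarrow> ('b \<Rightarrow> 'v set) \<Rightarrow> 'v set \<Rightarrow> ('b \<Rightarrow> 'k::zero) \<Rightarrow> bool" where
  "supported_on B lab U u \<longleftrightarrow> (\<forall>t. u t \<noteq> 0 \<longrightarrow> t \<in> B \<and> lab t \<subseteq> U)"

lemma supported_onD: "supported_on B lab U u \<Longrightarrow> u t \<noteq> 0 \<Longrightarrow> t \<in> B \<and> lab t \<subseteq> U"
  by (simp add: supported_on_def)

text \<open>\<open>P\<close> stands for the simplicial complex of independent sets. Chains need not
  be homogeneous in \<open>deg\<close>, so the single condition \<open>exact\<close> covers all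
  homological degrees. Its augmentation clause is guarded by \<open>P U\<close>: over a non-face the
  strand has to resolve 0, and there every chain of degree 0 is a cycle.\<close>

locale squarefree_resolution =
  fixes V :: "'v set" and P :: "'v set \<Rightarrow> bool"
    and B :: "'b set" and deg :: "'b \<Rightarrow> nat" and lab :: "'b \<Rightarrow> 'v set"
    and d :: "'b \<Rightarrow> 'b \<Rightarrow> 'k::field" and a :: "'b \<Rightarrow> 'k"
  assumes mono: "U \<subseteq> U' \<Longrightarrow> U' \<subseteq> V \<Longrightarrow> P U' \<Longrightarrow> P U"
    and finite_B: "finite B"
    and lab_subset: "b \<in> B \<Longrightarrow> lab b \<subseteq> V"
    and d_nonzero: "d s t \<noteq> 0 \<Longrightarrow> s \<in> B \<and> t \<in> B \<and> deg t = Suc (deg s) \<and> lab s \<subseteq> lab t"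
    and a_nonzero: "a s \<noteq> 0 \<Longrightarrow> s \<in> B \<and> deg s = 0"
    and d_d: "(\<Sum>t\<in>B. d s t * d t r) = 0"
    and a_d: "P (lab t) \<Longrightarrow> (\<Sum>s\<in>B. a s * d s t) = 0"
    and a_surj: "U \<subseteq> V \<Longrightarrow> P U \<Longrightarrow> \<exists>s\<in>B. a s \<noteq> 0 \<and> lab s \<subseteq> U"
    and exact: "U \<subseteq> V \<Longrightarrow> supported_on B lab U u \<Longrightarrow> (\<And>s. (\<Sum>t\<in>B. d s t * u t) = 0) \<Longrightarrow>
      (P U \<Longrightarrow> (\<Sum>t\<in>B. a t * u t) = 0) \<Longrightarrow>
      \<exists>w. supported_on B lab U w \<and> (\<forall>s. u s = (\<Sum>t\<in>B. d s t * w t))"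
begin

lemma d_d_apply: "(\<Sum>t\<in>B. d s t * (\<Sum>r\<in>B. d t r * w r)) = 0"
proof -
  have "(\<Sum>t\<in>B. d s t * (\<Sum>r\<in>B. d t r * w r)) = (\<Sum>t\<in>B. \<Sum>r\<in>B. d s t * d t r * w r)"
    by (simp add: sum_distrib_left mult.assoc)
  also have "\<dots> = (\<Sum>r\<in>B. (\<Sum>t\<in>B. d s t * d t r) * w r)"
    by (subst sum.swap) (simp add: sum_distrib_right)
  finally show ?thesis by (simp add: d_d)
qed

lemma a_d_apply:
  assumes "U \<subseteq> V" "P U" "supported_on B lab U w"
  shows "(\<Sum>t\<in>B. a t * (\<Sum>r\<in>B. d t r * w r)) = 0"
proof -
  have "(\<Sum>t\<in>B. a t * (\<Sum>r\<in>B. d t r * w r)) = (\<Sum>t\<in>B. \<Sum>r\<in>B. a t * d t r * w r)"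
    by (simp add: sum_distrib_left mult.assoc)
  also have "\<dots> = (\<Sum>r\<in>B. (\<Sum>t\<in>B. a t * d t r) * w r)"
    by (subst sum.swap) (simp add: sum_distrib_right)
  \<comment> \<open>Only labels inside the face \<open>U\<close> occur in \<open>w\<close>; they are
    faces themselves, so \<open>a_d\<close> applies to them.\<close>
  also have "\<dots> = (\<Sum>r\<in>B. 0)"
  proof (rule sum.cong[OF refl])
    fix r assume "r \<in> B"
    show "(\<Sum>t\<in>B. a t * d t r) * w r = 0"
    proof (cases "w r = 0")
      case False
      then have "P (lab r)"
        using assms mono supported_onD by metis
      then show ?thesis by (simp add: a_d)
    qed simp
  qed
  finally show ?thesis by simp
qed

lemma cong_predicate:
  assumes "\<And>U. U \<subseteq> V \<Longrightarrow> P U \<longleftrightarrow> P' U"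
  shows "squarefree_resolution V P' B deg lab d a"
proof unfold_locales
  fix U U' assume "U \<subseteq> U'" "U' \<subseteq> V" "P' U'"
  then show "P' U" using mono assms by (metis order_trans)
next
  fix t assume "P' (lab t)"
  show "(\<Sum>s\<in>B. a s * d s t) = 0"
  \<comment> \<open>Outside \<open>B\<close> the label may leave \<open>V\<close>, where
    \<open>P\<close> and \<open>P'\<close> are unrelated; there the column of \<open>d\<close>
    vanishes.\<close>
  proof (cases "t \<in> B")
    case True
    then show ?thesis using \<open>P' (lab t)\<close> assms lab_subset a_d by blast
  next
    case False
    then have "d s t = 0" for s using d_nonzero by blast
    then show ?thesis by simp
  qed
next
  fix U u
  assume "U \<subseteq> V" "supported_on B lab U u" "\<And>s. (\<Sum>t\<in>B. d s t * u t) = 0"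
    "P' U \<Longrightarrow> (\<Sum>t\<in>B. a t * u t) = 0"
  then show "\<exists>w. supported_on B lab U w \<and> (\<forall>s. u s = (\<Sum>t\<in>B. d s t * w t))"
    using exact assms by blast
qed (use finite_B lab_subset d_nonzero a_nonzero d_d a_surj assms in blast)+

text \<open>Cones live on sum types. Transport along a bijection brings them back to a fixed index
  type, so that cones can be iterated inside an induction.\<close>

lemma reindex:
  assumes "bij g"
  shows "squarefree_resolution V P (g -` B) (deg \<circ> g) (lab \<circ> g) (\<lambda>s t. d (g s) (g t)) (a \<circ> g)"
proof -
  have bij: "bij_betw g (g -` B) B"
    using assms by (metis bij_betw_imageI bij_def inj_on_subset subset_UNIV surj_image_vimage_eq)
  have sum_g: "(\<Sum>t\<in>g -` B. f (g t)) = (\<Sum>t\<in>B. f t)" for f :: "_ \<Rightarrow> 'k"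
    using sum.reindex_bij_betw[OF bij] by simp
  have g_inv: "g (inv_into UNIV g t) = t" for t
    using assms by (simp add: bij_is_surj surj_f_inv_f)
  have inv_g: "inv_into UNIV g (g t) = t" for t
    using assms by (simp add: bij_is_inj)
  show ?thesis
  proof unfold_locales
    fix U u
    assume U: "U \<subseteq> V" and u: "supported_on (g -` B) (lab \<circ> g) U u"
      and du: "\<And>s. (\<Sum>t\<in>g -` B. d (g s) (g t) * u t) = 0"
      and au: "P U \<Longrightarrow> (\<Sum>t\<in>g -` B. (a \<circ> g) t * u t) = 0"
    have "(\<Sum>t\<in>B. d s t * u (inv_into UNIV g t)) = 0" for s
      using sum_g[of "\<lambda>t. d s t * u (inv_into UNIV g t)"] du[of "inv_into UNIV g s"]
      by (simp add: inv_g g_inv)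
    moreover have "P U \<Longrightarrow> (\<Sum>t\<in>B. a t * u (inv_into UNIV g t)) = 0"
      using sum_g[of "\<lambda>t. a t * u (inv_into UNIV g t)"] au by (simp add: inv_g)
    moreover have "supported_on B lab U (\<lambda>t. u (inv_into UNIV g t))"
      unfolding supported_on_def
    proof (intro allI impI)
      fix t assume "u (inv_into UNIV g t) \<noteq> 0"
      from supported_onD[OF u this] show "t \<in> B \<and> lab t \<subseteq> U" by (simp add: g_inv)
    qed
    ultimately have "\<exists>w. supported_on B lab U w \<and>
        (\<forall>s. u (inv_into UNIV g s) = (\<Sum>t\<in>B. d s t * w t))"
      using U by (intro exact)
    then obtain w where w: "supported_on B lab U w" "\<And>s. u (inv_into UNIV g s) = (\<Sum>t\<in>B. d s t * w t)"
      by blast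
    then have "u s = (\<Sum>t\<in>g -` B. d (g s) (g t) * (w \<circ> g) t)" for s
      using sum_g[of "\<lambda>t. d (g s) t * w t"] w(2)[of "g s"] by (simp add: inv_g)
    moreover have "supported_on (g -` B) (lab \<circ> g) U (w \<circ> g)"
      using w(1) by (auto simp: supported_on_def)
    ultimately show "\<exists>w. supported_on (g -` B) (lab \<circ> g) U w \<and>
        (\<forall>s. u s = (\<Sum>t\<in>g -` B. d (g s) (g t) * w t))"
      by blast
  next
    fix U assume "U \<subseteq> V" "P U"
    then obtain s where "s \<in> B" "a s \<noteq> 0" "lab s \<subseteq> U"
      using a_surj by blast
    then show "\<exists>s\<in>g -` B. (a \<circ> g) s \<noteq> 0 \<and> (lab \<circ> g) s \<subseteq> U"
      by (intro bexI[of _ "inv_into UNIV g s"]) (auto simp: g_inv)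
  next
    show "finite (g -` B)"
      using bij finite_B bij_betw_finite by blast
  next
    fix s r show "(\<Sum>t\<in>g -` B. d (g s) (g t) * d (g t) (g r)) = 0"
      using sum_g[of "\<lambda>t. d (g s) t * d t (g r)"] by (simp add: d_d)
  next
    fix t assume "P ((lab \<circ> g) t)"
    then show "(\<Sum>s\<in>g -` B. (a \<circ> g) s * d (g s) (g t)) = 0"
      using sum_g[of "\<lambda>s. a s * d s (g t)"] by (simp add: a_d)
  qed (use mono lab_subset in \<open>auto dest: d_nonzero a_nonzero\<close>)
qed

text \<open>The differential only shrinks labels, so the basis elements with label inside
  \<open>W\<close> span a subcomplex, and its strands over subsets of \<open>W\<close> are the old
  ones.\<close>

lemma restrict:
  assumes W: "W \<subseteq> V"
  shows "squarefree_resolution W P {b \<in> B. lab b \<subseteq> W} deg lab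
    (\<lambda>s t. if lab t \<subseteq> W then d s t else 0) (\<lambda>s. if lab s \<subseteq> W then a s else 0)"
proof -
  let ?B = "{b \<in> B. lab b \<subseteq> W}"
  let ?d = "\<lambda>s t. if lab t \<subseteq> W then d s t else 0"
  let ?a = "\<lambda>s. if lab s \<subseteq> W then a s else 0"
  have d_lab: "lab s \<subseteq> W" if "lab t \<subseteq> W" "d s t \<noteq> 0" for s t
    using that d_nonzero by blast
  have d_u: "(\<Sum>t\<in>?B. ?d s t * u t) = (\<Sum>t\<in>B. d s t * u t)"
    and a_u: "(\<Sum>t\<in>?B. ?a t * u t) = (\<Sum>t\<in>B. a t * u t)"
    if "supported_on B lab W u" for u s
    using that finite_B by (auto simp: supported_on_def intro!: sum.mono_neutral_cong_left)
  show ?thesis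
  proof unfold_locales
    fix s r
    show "(\<Sum>t\<in>?B. ?d s t * ?d t r) = 0"
    proof (cases "lab r \<subseteq> W")
      case True
      then have "(\<Sum>t\<in>?B. ?d s t * ?d t r) = (\<Sum>t\<in>B. d s t * d t r)"
        using finite_B d_lab by (intro sum.mono_neutral_cong_left) auto
      then show ?thesis by (simp add: d_d)
    qed auto
  next
    fix t assume "P (lab t)"
    show "(\<Sum>s\<in>?B. ?a s * ?d s t) = 0"
    proof (cases "lab t \<subseteq> W")
      case True
      then have "(\<Sum>s\<in>?B. ?a s * ?d s t) = (\<Sum>s\<in>B. a s * d s t)"
        using finite_B d_lab by (intro sum.mono_neutral_cong_left) auto
      then show ?thesis using a_d \<open>P (lab t)\<close> by simp
    qed auto
  next
    fix U assume "U \<subseteq> W" "P U"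
    moreover from this obtain s where "s \<in> B" "a s \<noteq> 0" "lab s \<subseteq> U"
      using a_surj W by (meson order_trans)
    ultimately show "\<exists>s\<in>?B. ?a s \<noteq> 0 \<and> lab s \<subseteq> U" by auto
  next
    fix U u
    assume U: "U \<subseteq> W" and u: "supported_on ?B lab U u"
      and du: "\<And>s. (\<Sum>t\<in>?B. ?d s t * u t) = 0" and au: "P U \<Longrightarrow> (\<Sum>t\<in>?B. ?a t * u t) = 0"
    have u': "supported_on B lab U u" "supported_on B lab W u"
      using u by (auto simp: supported_on_def)
    have "\<exists>w. supported_on B lab U w \<and> (\<forall>s. u s = (\<Sum>t\<in>B. d s t * w t))"
      using U W u'(1) du au unfolding d_u[OF u'(2)] a_u[OF u'(2)] by (intro exact) auto
    then obtain w where w: "supported_on B lab U w" "\<forall>s. u s = (\<Sum>t\<in>B. d s t * w t)"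
      by blast
    then have w': "supported_on B lab W w" "supported_on ?B lab U w"
      using U by (auto simp: supported_on_def)
    have "\<forall>s. u s = (\<Sum>t\<in>?B. ?d s t * w t)"
      unfolding d_u[OF w'(1)] by (fact w(2))
    with w'(2) show "\<exists>w. supported_on ?B lab U w \<and> (\<forall>s. u s = (\<Sum>t\<in>?B. ?d s t * w t))"
      by blast
  next
    fix U U' assume "U \<subseteq> U'" "U' \<subseteq> W" "P U'"
    then show "P U" using mono W by (meson order_trans)
  next
    fix s t assume "?d s t \<noteq> 0"
    then show "s \<in> ?B \<and> t \<in> ?B \<and> deg t = Suc (deg s) \<and> lab s \<subseteq> lab t"
      using d_nonzero[of s t] by (auto split: if_splits)
  qed (use finite_B in \<open>auto split: if_splits dest: a_nonzero\<close>)
qed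

end

section \<open>Base complexes, comparison maps and mapping cones\<close>

lemma squarefree_resolution_void:
  "squarefree_resolution V (\<lambda>U. False) {} deg lab (\<lambda>s t. 0) (\<lambda>s. 0)"
  by unfold_locales (auto simp: supported_on_def)

lemma squarefree_resolution_full:
  "squarefree_resolution V (\<lambda>U. True) {b} (\<lambda>s. 0) (\<lambda>s. {}) (\<lambda>s t. 0) (\<lambda>s. if s = b then 1 else 0)"
  by unfold_locales (auto simp: supported_on_def split: if_splits)

text \<open>The comparison theorem. \<open>P'\<close> is the smaller complex, so the quotient ring
  of \<open>P\<close> surjects onto that of \<open>P'\<close>, and the surjection lifts to the
  resolutions. Over faces of \<open>P\<close> that are not faces of \<open>P'\<close> the target is
  0, hence the guard on the augmentation.\<close>

lemma squarefree_lift: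
  fixes d :: "'b \<Rightarrow> 'b \<Rightarrow> 'k::field" and d' :: "'c \<Rightarrow> 'c \<Rightarrow> 'k"
  assumes F: "squarefree_resolution V P B deg lab d a"
    and G: "squarefree_resolution V P' B' deg' lab' d' a'"
    and P'_P: "\<And>U. U \<subseteq> V \<Longrightarrow> P' U \<Longrightarrow> P U"
  shows "\<exists>\<phi>. (\<forall>s t. \<phi> s t \<noteq> 0 \<longrightarrow> s \<in> B' \<and> t \<in> B \<and> deg' s = deg t \<and> lab' s \<subseteq> lab t) \<and>
    (\<forall>s t. (\<Sum>r\<in>B'. d' s r * \<phi> r t) = (\<Sum>r\<in>B. \<phi> s r * d r t)) \<and>
    (\<forall>t\<in>B. P' (lab t) \<longrightarrow> (\<Sum>s\<in>B'. a' s * \<phi> s t) = a t)"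
proof -
  interpret F: squarefree_resolution V P B deg lab d a by (fact F)
  interpret G: squarefree_resolution V P' B' deg' lab' d' a' by (fact G)
  \<comment> \<open>Apart from column \<open>t\<close> itself the condition mentions only columns of
    smaller degree, so the columns can be filled in by increasing degree.\<close>
  define good where "good \<phi> t \<longleftrightarrow>
      (\<forall>s. \<phi> s t \<noteq> 0 \<longrightarrow> s \<in> B' \<and> deg' s = deg t \<and> lab' s \<subseteq> lab t) \<and>
      (\<forall>s. (\<Sum>r\<in>B'. d' s r * \<phi> r t) = (\<Sum>r\<in>B. \<phi> s r * d r t)) \<and>
      (P' (lab t) \<longrightarrow> (\<Sum>s\<in>B'. a' s * \<phi> s t) = a t)" for \<phi> :: "'c \<Rightarrow> 'b \<Rightarrow> 'k" and t
  have "\<exists>\<phi>. (\<forall>s t. \<phi> s t \<noteq> 0 \<longrightarrow> t \<in> B) \<and> (\<forall>t\<in>B. deg t < n \<longrightarrow> good \<phi> t)" for n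
  proof (induction n)
    case 0
    show ?case by (intro exI[of _ "\<lambda>_ _. 0"]) simp
  next
    case (Suc n)
    then obtain \<phi> where \<phi>_B: "\<And>s t. \<phi> s t \<noteq> 0 \<Longrightarrow> t \<in> B"
      and \<phi>: "\<And>t. t \<in> B \<Longrightarrow> deg t < n \<Longrightarrow> good \<phi> t"
      by blast
    have "\<exists>w. (\<forall>s. w s \<noteq> 0 \<longrightarrow> s \<in> B' \<and> deg' s = n \<and> lab' s \<subseteq> lab t) \<and>
        (\<forall>s. (\<Sum>r\<in>B'. d' s r * w r) = (\<Sum>r\<in>B. \<phi> s r * d r t)) \<and>
        (P' (lab t) \<longrightarrow> (\<Sum>s\<in>B'. a' s * w s) = a t)" if t: "t \<in> B" "deg t = n" for t
    proof (cases n)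
      case 0
      then have d0: "d r t = 0" for r using t F.d_nonzero[of r t] by auto
      show ?thesis
      proof (cases "P' (lab t)")
        case False
        then show ?thesis using d0 by (intro exI[of _ "\<lambda>_. 0"]) simp
      next
        case True
        \<comment> \<open>One basis element with \<open>a' s\<close> nonzero suffices: its multiple
          by \<open>a t / a' s\<close> has the prescribed augmentation.\<close>
        then obtain s where s: "s \<in> B'" "a' s \<noteq> 0" "lab' s \<subseteq> lab t"
          using G.a_surj F.lab_subset t by blast
        have "d' r s = 0" for r
          using G.d_nonzero[of r s] G.a_nonzero[of s] s by fastforce
        then have "(\<Sum>r'\<in>B'. d' r r' * (if r' = s then a t / a' s else 0)) = 0" for r
          by (intro sum.neutral) auto
        moreover have "(\<Sum>r\<in>B'. a' r * (if r = s then a t / a' s else 0)) = a t"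
          using s G.finite_B by (simp add: if_distrib cong: if_cong)
        ultimately show ?thesis
          using s 0 d0 G.a_nonzero[of s] by (intro exI[of _ "\<lambda>r. if r = s then a t / a' s else 0"]) auto
      qed
    next
      case (Suc k)
      \<comment> \<open>The chain map applied to the boundary of \<open>t\<close>. It is a cycle,
        and a preimage under \<open>d'\<close> will serve as column \<open>t\<close>.\<close>
      define u where "u s = (\<Sum>r\<in>B. \<phi> s r * d r t)" for s
      have good: "good \<phi> r" if "d r t \<noteq> 0" for r
        using \<phi>[of r] F.d_nonzero[OF that] t Suc by auto
      have u_supp: "s \<in> B' \<and> deg' s = k \<and> lab' s \<subseteq> lab t" if u: "u s \<noteq> 0" for s
      proof -
        obtain r where r: "\<phi> s r * d r t \<noteq> 0"
          using u unfolding u_def by (meson sum.neutral)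
        then have "good \<phi> r" using good by auto
        then have "s \<in> B' \<and> deg' s = deg r \<and> lab' s \<subseteq> lab r"
          using r unfolding good_def by auto
        moreover have "lab r \<subseteq> lab t" "deg t = Suc (deg r)" using F.d_nonzero[of r t] r by auto
        ultimately show ?thesis using t Suc by auto
      qed
      have "(\<Sum>r\<in>B'. d' s r * u r) = 0" for s
      proof -
        have "(\<Sum>r\<in>B'. d' s r * u r) = (\<Sum>q\<in>B. (\<Sum>r\<in>B'. d' s r * \<phi> r q) * d q t)"
          unfolding u_def sum_distrib_left sum_distrib_right
          by (subst sum.swap) (simp add: mult.assoc)
        also have "\<dots> = (\<Sum>q\<in>B. (\<Sum>r\<in>B. \<phi> s r * d r q) * d q t)"
        proof (rule sum.cong[OF refl])
          fix q
          show "(\<Sum>r\<in>B'. d' s r * \<phi> r q) * d q t = (\<Sum>r\<in>B. \<phi> s r * d r q) * d q t"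
            using good[of q] unfolding good_def by (cases "d q t = 0") auto
        qed
        also have "\<dots> = (\<Sum>r\<in>B. \<phi> s r * (\<Sum>q\<in>B. d r q * d q t))"
          unfolding sum_distrib_left sum_distrib_right
          by (subst sum.swap) (simp add: mult.assoc)
        finally show ?thesis by (simp add: F.d_d)
      qed
      moreover have "(\<Sum>r\<in>B'. a' r * u r) = 0" if P': "P' (lab t)"
      proof -
        have "(\<Sum>r\<in>B'. a' r * u r) = (\<Sum>q\<in>B. (\<Sum>r\<in>B'. a' r * \<phi> r q) * d q t)"
          unfolding u_def sum_distrib_left sum_distrib_right
          by (subst sum.swap) (simp add: mult.assoc)
        also have "\<dots> = (\<Sum>q\<in>B. a q * d q t)"
        proof (rule sum.cong[OF refl])
          fix q
          show "(\<Sum>r\<in>B'. a' r * \<phi> r q) * d q t = a q * d q t"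
          proof (cases "d q t = 0")
            case False
            then have "lab q \<subseteq> lab t" using F.d_nonzero by blast
            then have "P' (lab q)"
              using G.mono F.lab_subset[OF t(1)] P' by blast
            then show ?thesis using good[OF False] unfolding good_def by auto
          qed auto
        qed
        also have "\<dots> = 0"
          using P' P'_P F.lab_subset t by (intro F.a_d) blast
        finally show ?thesis .
      qed
      moreover have "supported_on B' lab' (lab t) u"
        using u_supp by (auto simp: supported_on_def)
      ultimately have "\<exists>w. supported_on B' lab' (lab t) w \<and> (\<forall>s. u s = (\<Sum>r\<in>B'. d' s r * w r))"
        using F.lab_subset t by (intro G.exact)
      then obtain w where w: "supported_on B' lab' (lab t) w" "\<And>s. u s = (\<Sum>r\<in>B'. d' s r * w r)"
        by blast
      \<comment> \<open>The preimage supplied by \<open>exact\<close> may have parts in other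
        degrees; they are discarded.\<close>
      define w' where "w' s = (if deg' s = n then w s else 0)" for s
      have "(\<Sum>r\<in>B'. d' s r * w' r) = u s" for s
      proof (cases "deg' s = k")
        case True
        have "d' s r * w' r = d' s r * w r" for r
          using G.d_nonzero[of s r] True Suc by (cases "d' s r = 0") (auto simp: w'_def)
        then have "(\<Sum>r\<in>B'. d' s r * w' r) = (\<Sum>r\<in>B'. d' s r * w r)" by (rule sum.cong[OF refl])
        then show ?thesis using w(2) by simp
      next
        case False
        have "d' s r * w' r = 0" for r
          using G.d_nonzero[of s r] False Suc by (cases "d' s r = 0") (auto simp: w'_def)
        then have "(\<Sum>r\<in>B'. d' s r * w' r) = 0" by (rule sum.neutral[OF ballI])
        then show ?thesis using u_supp[of s] False by auto
      qed
      moreover have "(\<Sum>r\<in>B'. a' r * w' r) = 0"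
      proof (rule sum.neutral[OF ballI])
        fix r show "a' r * w' r = 0"
          using G.a_nonzero[of r] Suc by (cases "a' r = 0") (auto simp: w'_def)
      qed
      moreover have "a t = 0" using F.a_nonzero[of t] t Suc by auto
      ultimately show ?thesis
        using w(1) by (intro exI[of _ w']) (auto simp: w'_def u_def supported_on_def)
    qed
    then obtain W where W:
      "\<And>t. t \<in> B \<Longrightarrow> deg t = n \<Longrightarrow> (\<forall>s. W t s \<noteq> 0 \<longrightarrow> s \<in> B' \<and> deg' s = n \<and> lab' s \<subseteq> lab t) \<and>
        (\<forall>s. (\<Sum>r\<in>B'. d' s r * W t r) = (\<Sum>r\<in>B. \<phi> s r * d r t)) \<and>
        (P' (lab t) \<longrightarrow> (\<Sum>s\<in>B'. a' s * W t s) = a t)"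
      by metis
    define \<phi>' where "\<phi>' s t = (if t \<in> B \<and> deg t = n then W t s else \<phi> s t)" for s t
    have \<phi>'_d: "(\<Sum>r\<in>B. \<phi>' s r * d r t) = (\<Sum>r\<in>B. \<phi> s r * d r t)" if "deg t \<le> n" for s t
    proof -
      have "\<phi>' s r * d r t = \<phi> s r * d r t" for r
        using F.d_nonzero[of r t] that by (cases "d r t = 0") (auto simp: \<phi>'_def)
      then show ?thesis by (rule sum.cong[OF refl])
    qed
    have "good \<phi>' t" if "t \<in> B" "deg t < Suc n" for t
    proof (cases "deg t = n")
      case True
      with that have "\<phi>' s t = W t s" for s by (simp add: \<phi>'_def)
      then show ?thesis using W[OF that(1) True] \<phi>'_d[of t] True by (simp add: good_def)
    next
      case False
      then have "\<phi>' s t = \<phi> s t" for s by (simp add: \<phi>'_def)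
      then show ?thesis using \<phi>[of t] \<phi>'_d[of t] that False by (simp add: good_def)
    qed
    moreover have "t \<in> B" if "\<phi>' s t \<noteq> 0" for s t
      using that \<phi>_B by (auto simp: \<phi>'_def split: if_splits)
    ultimately show ?case by blast
  qed
  from this[of "Suc (Max (deg ` B))"] obtain \<phi> where
    \<phi>_B: "\<And>s t. \<phi> s t \<noteq> 0 \<Longrightarrow> t \<in> B" and \<phi>: "\<And>t. t \<in> B \<Longrightarrow> good \<phi> t"
    using F.finite_B by (auto simp: less_Suc_eq_le)
  have "(\<Sum>r\<in>B'. d' s r * \<phi> r t) = (\<Sum>r\<in>B. \<phi> s r * d r t)" for s t
  proof (cases "t \<in> B")
    case True
    then show ?thesis using \<phi> by (simp add: good_def)
  next
    case False
    then have "\<phi> r t = 0" "d q t = 0" for r q using \<phi>_B F.d_nonzero by blast+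
    then show ?thesis by simp
  qed
  then show ?thesis using \<phi>_B \<phi> unfolding good_def by (intro exI[of _ \<phi>]) blast
qed

text \<open>In this order the summands are \<open>F\<close>, \<open>F'(-X)\<close> and the source
  \<open>F(-X)\<close>, moved up by one degree. On the resolved modules the map is injective,
  because multiplication by the monomial of \<open>X\<close> is. If \<open>X\<close> is a single
  vertex, the cokernel is the quotient ring of the complex with deletion \<open>P\<close> and link
  \<open>P'\<close>.\<close>

fun cone_deg :: "('b \<Rightarrow> nat) \<Rightarrow> ('c \<Rightarrow> nat) \<Rightarrow> 'b + 'c + 'b \<Rightarrow> nat" where
  "cone_deg deg deg' (Inl t) = deg t"
| "cone_deg deg deg' (Inr (Inl t)) = deg' t"
| "cone_deg deg deg' (Inr (Inr t)) = Suc (deg t)"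

fun cone_lab :: "'v set \<Rightarrow> ('b \<Rightarrow> 'v set) \<Rightarrow> ('c \<Rightarrow> 'v set) \<Rightarrow> 'b + 'c + 'b \<Rightarrow> 'v set" where
  "cone_lab X lab lab' (Inl t) = lab t"
| "cone_lab X lab lab' (Inr (Inl t)) = lab' t \<union> X"
| "cone_lab X lab lab' (Inr (Inr t)) = lab t \<union> X"

text \<open>The sign of \<open>- d\<close> on the shifted copy makes the square vanish against the
  blocks \<open>- 1\<close> and \<open>\<phi>\<close>. The test \<open>t \<in> B\<close> keeps the
  identity block inside the basis, as \<open>d_nonzero\<close> demands.\<close>

fun cone_diff :: "'b set \<Rightarrow> ('b \<Rightarrow> 'b \<Rightarrow> 'k) \<Rightarrow> ('c \<Rightarrow> 'c \<Rightarrow> 'k) \<Rightarrow> ('c \<Rightarrow> 'b \<Rightarrow> 'k) \<Rightarrow>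
    'b + 'c + 'b \<Rightarrow> 'b + 'c + 'b \<Rightarrow> 'k::field" where
  "cone_diff B d d' \<phi> (Inl s) (Inl t) = d s t"
| "cone_diff B d d' \<phi> (Inl s) (Inr (Inl t)) = 0"
| "cone_diff B d d' \<phi> (Inl s) (Inr (Inr t)) = (if s = t \<and> t \<in> B then - 1 else 0)"
| "cone_diff B d d' \<phi> (Inr (Inl s)) (Inl t) = 0"
| "cone_diff B d d' \<phi> (Inr (Inl s)) (Inr (Inl t)) = d' s t"
| "cone_diff B d d' \<phi> (Inr (Inl s)) (Inr (Inr t)) = \<phi> s t"
| "cone_diff B d d' \<phi> (Inr (Inr s)) (Inl t) = 0"
| "cone_diff B d d' \<phi> (Inr (Inr s)) (Inr (Inl t)) = 0"
| "cone_diff B d d' \<phi> (Inr (Inr s)) (Inr (Inr t)) = - d s t"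

fun cone_aug :: "('b \<Rightarrow> 'k) \<Rightarrow> ('c \<Rightarrow> 'k) \<Rightarrow> 'b + 'c + 'b \<Rightarrow> 'k::field" where
  "cone_aug a a' (Inl t) = a t"
| "cone_aug a a' (Inr (Inl t)) = a' t"
| "cone_aug a a' (Inr (Inr t)) = 0"

lemma sum_Plus3:
  assumes "finite B" "finite B'"
  shows "(\<Sum>t\<in>B <+> (B' <+> B). f t) =
    (\<Sum>t\<in>B. f (Inl t)) + (\<Sum>t\<in>B'. f (Inr (Inl t))) + (\<Sum>t\<in>B. f (Inr (Inr t)) :: 'k::field)"
  using assms by (simp add: sum.Plus add.assoc)

lemma sum3_cases:
  obtains t where "x = Inl t" | t where "x = Inr (Inl t)" | t where "x = Inr (Inr t)"
  by (metis sum.exhaust)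

text \<open>The mapping cone of \<open>F(-X) \<rightarrow> F'(-X) \<oplus> F\<close>, whose components are \<open>\<phi>\<close> and multiplication
  by the monomial of \<open>X\<close>. Over sets \<open>U\<close> containing \<open>X\<close> the second component is the identity, so
  only \<open>F'\<close> survives in homology; over all other sets only \<open>F\<close> is present.\<close>

lemma squarefree_cone:
  fixes d :: "'b \<Rightarrow> 'b \<Rightarrow> 'k::field" and d' :: "'c \<Rightarrow> 'c \<Rightarrow> 'k"
  assumes F: "squarefree_resolution V P B deg lab d a"
    and G: "squarefree_resolution V P' B' deg' lab' d' a'"
    and P'_P: "\<And>U. U \<subseteq> V \<Longrightarrow> P' U \<Longrightarrow> P U"
    and X: "V \<inter> X = {}"
    and \<phi>_nonzero: "\<And>s t. \<phi> s t \<noteq> 0 \<Longrightarrow> s \<in> B' \<and> t \<in> B \<and> deg' s = deg t \<and> lab' s \<subseteq> lab t"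
    and \<phi>_d: "\<And>s t. (\<Sum>r\<in>B'. d' s r * \<phi> r t) = (\<Sum>r\<in>B. \<phi> s r * d r t)"
    and \<phi>_a: "\<And>t. t \<in> B \<Longrightarrow> P' (lab t) \<Longrightarrow> (\<Sum>s\<in>B'. a' s * \<phi> s t) = a t"
  shows "squarefree_resolution (V \<union> X) (\<lambda>U. if X \<subseteq> U then P' (U - X) else P (U - X))
    (B <+> (B' <+> B)) (cone_deg deg deg') (cone_lab X lab lab') (cone_diff B d d' \<phi>) (cone_aug a a')"
proof -
  interpret F: squarefree_resolution V P B deg lab d a by (fact F)
  interpret G: squarefree_resolution V P' B' deg' lab' d' a' by (fact G)
  note fin = F.finite_B G.finite_B
  let ?B = "B <+> (B' <+> B)" and ?lab = "cone_lab X lab lab'" and ?d = "cone_diff B d d' \<phi>"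
    and ?a = "cone_aug a a'"
  have lab_X: "lab t \<inter> X = {}" if "t \<in> B" for t using F.lab_subset[OF that] X by blast
  have lab'_X: "lab' t \<inter> X = {}" if "t \<in> B'" for t using G.lab_subset[OF that] X by blast
  have id_sum: "(\<Sum>t\<in>B. (if s = t then - 1 else 0) * f t) = (if s \<in> B then - f s else 0)"
    for s and f :: "'b \<Rightarrow> 'k"
  proof -
    have "(\<Sum>t\<in>B. (if s = t then - 1 else 0) * f t) = (\<Sum>t\<in>B. if s = t then - f t else 0)"
      by (intro sum.cong) auto
    then show ?thesis using fin by simp
  qed
  have id_sum': "(\<Sum>r\<in>B. f r * (if r = t then - 1 else 0)) = (if t \<in> B then - f t else 0)"
    for t and f :: "'b \<Rightarrow> 'k"
  proof -
    have "(\<Sum>r\<in>B. f r * (if r = t then - 1 else 0)) = (\<Sum>r\<in>B. if r = t then - f r else 0)"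
      by (intro sum.cong) auto
    then show ?thesis using fin by simp
  qed
  have id_sum'': "(\<Sum>r\<in>B. f r * (if r = t \<and> t \<in> B then - 1 else 0)) = (if t \<in> B then - f t else 0)"
    for t and f :: "'b \<Rightarrow> 'k"
    using id_sum'[of f t] by (cases "t \<in> B") auto
  have d_out: "d s t = 0" if "s \<notin> B \<or> t \<notin> B" for s t using F.d_nonzero that by blast
  show ?thesis
  proof unfold_locales
    fix U U' assume *: "U \<subseteq> U'" "U' \<subseteq> V \<union> X" "if X \<subseteq> U' then P' (U' - X) else P (U' - X)"
    have V: "U' - X \<subseteq> V" "U - X \<subseteq> U' - X" using * by blast+
    show "if X \<subseteq> U then P' (U - X) else P (U - X)"
    proof (cases "X \<subseteq> U'")
      case True
      then have "P' (U - X)" using V * G.mono by simp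
      moreover have "U - X \<subseteq> V" using V by blast
      ultimately show ?thesis using P'_P by simp
    next
      case False
      then have "\<not> X \<subseteq> U" "P (U' - X)" using * by auto
      then show ?thesis using V F.mono by simp
    qed
  next
    show "finite ?B" using fin by simp
  next
    fix b assume "b \<in> ?B"
    then show "?lab b \<subseteq> V \<union> X"
      using F.lab_subset G.lab_subset by (cases b rule: sum3_cases) auto
  next
    fix s t assume "?d s t \<noteq> 0"
    then show "s \<in> ?B \<and> t \<in> ?B \<and> cone_deg deg deg' t = Suc (cone_deg deg deg' s) \<and> ?lab s \<subseteq> ?lab t"
      by (cases s rule: sum3_cases; cases t rule: sum3_cases)
        (auto dest!: F.d_nonzero G.d_nonzero \<phi>_nonzero split: if_splits)
  next
    fix s assume "?a s \<noteq> 0"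
    then show "s \<in> ?B \<and> cone_deg deg deg' s = 0"
      by (cases s rule: sum3_cases) (auto dest!: F.a_nonzero G.a_nonzero)
  next
    fix s r
    show "(\<Sum>t\<in>?B. ?d s t * ?d t r) = 0"
      unfolding sum_Plus3[OF fin]
      by (cases s rule: sum3_cases; cases r rule: sum3_cases)
        (auto simp: F.d_d G.d_d \<phi>_d id_sum id_sum' id_sum'' sum_negf d_out)
  next
    fix t assume P: "if X \<subseteq> ?lab t then P' (?lab t - X) else P (?lab t - X)"
    show "(\<Sum>s\<in>?B. ?a s * ?d s t) = 0"
    proof (cases t rule: sum3_cases)
      case (1 t')
      show ?thesis
      proof (cases "t' \<in> B")
        case True
        then have "lab t' - X = lab t'" using lab_X[OF True] by blast
        then have "P (lab t')"
          using P 1 P'_P[OF F.lab_subset[OF True]] by (auto split: if_splits)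
        then show ?thesis unfolding sum_Plus3[OF fin] using 1 F.a_d by simp
      next
        case False
        then show ?thesis unfolding sum_Plus3[OF fin] using 1 by (simp add: d_out)
      qed
    next
      case (2 t')
      show ?thesis
      proof (cases "t' \<in> B'")
        case True
        then have "lab' t' \<union> X - X = lab' t'" using lab'_X[OF True] by blast
        then have "P' (lab' t')"
          using P 2 by (auto split: if_splits)
        then show ?thesis unfolding sum_Plus3[OF fin] using 2 G.a_d by simp
      next
        case False
        then have "d' s t' = 0" for s using G.d_nonzero by blast
        then show ?thesis unfolding sum_Plus3[OF fin] using 2 by simp
      qed
    next
      case (3 t')
      show ?thesis
      proof (cases "t' \<in> B")
        case True
        then have "lab t' \<union> X - X = lab t'" using lab_X[OF True] by blast
        then have "P' (lab t')"
          using P 3 by (auto split: if_splits)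
        then show ?thesis unfolding sum_Plus3[OF fin] using 3 \<phi>_a True by (simp add: id_sum')
      next
        case False
        then have "\<phi> s t' = 0" for s using \<phi>_nonzero by blast
        then show ?thesis unfolding sum_Plus3[OF fin] using 3 False by (simp add: id_sum')
      qed
    qed
  next
    fix U assume U: "U \<subseteq> V \<union> X" "if X \<subseteq> U then P' (U - X) else P (U - X)"
    have "U - X \<subseteq> V" using U by blast
    then show "\<exists>s\<in>?B. ?a s \<noteq> 0 \<and> ?lab s \<subseteq> U"
    proof (cases "X \<subseteq> U")
      case True
      then have "P' (U - X)" using U by simp
      then obtain s where "s \<in> B'" "a' s \<noteq> 0" "lab' s \<subseteq> U - X"
        using G.a_surj[OF \<open>U - X \<subseteq> V\<close>] by blast
      then show ?thesis using True by (intro bexI[of _ "Inr (Inl s)"]) auto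
    next
      case False
      then have "P (U - X)" using U by simp
      then obtain s where "s \<in> B" "a s \<noteq> 0" "lab s \<subseteq> U - X"
        using F.a_surj[OF \<open>U - X \<subseteq> V\<close>] by blast
      then show ?thesis by (intro bexI[of _ "Inl s"]) auto
    qed
  next
    fix U u
    assume U: "U \<subseteq> V \<union> X" and u: "supported_on ?B ?lab U u"
      and du: "\<And>s. (\<Sum>t\<in>?B. ?d s t * u t) = 0"
      and au: "(if X \<subseteq> U then P' (U - X) else P (U - X)) \<Longrightarrow> (\<Sum>t\<in>?B. ?a t * u t) = 0"
    have UX: "U - X \<subseteq> V" using U by blast
    \<comment> \<open>The components of the chain in \<open>F\<close>, in \<open>F'(-X)\<close> and
      in the shifted copy of \<open>F(-X)\<close>.\<close>
    define l where "l t = u (Inl t)" for t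
    define m where "m t = u (Inr (Inl t))" for t
    define n where "n t = u (Inr (Inr t))" for t
    have l: "supported_on B lab (U - X) l"
      using supported_onD[OF u, of "Inl t" for t] lab_X by (fastforce simp: supported_on_def l_def)
    have m: "supported_on B' lab' (U - X) m"
      using supported_onD[OF u, of "Inr (Inl t)" for t] lab'_X by (fastforce simp: supported_on_def m_def)
    have n: "supported_on B lab (U - X) n"
      using supported_onD[OF u, of "Inr (Inr t)" for t] lab_X by (fastforce simp: supported_on_def n_def)
    \<comment> \<open>The identity block in the first row of the cycle condition forces
      \<open>n\<close> to be the boundary of \<open>l\<close>.\<close>
    have n_eq: "(\<Sum>t\<in>B. d s t * l t) = n s" for s
      using du[of "Inl s"] supported_onD[OF n, of s]
      unfolding sum_Plus3[OF fin] by (auto simp: l_def n_def id_sum d_out split: if_splits)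
    have m_eq: "(\<Sum>t\<in>B'. d' s t * m t) + (\<Sum>t\<in>B. \<phi> s t * n t) = 0" for s
      using du[of "Inr (Inl s)"] unfolding sum_Plus3[OF fin] by (simp add: m_def n_def)
    have au': "(\<Sum>t\<in>B. a t * l t) + (\<Sum>t\<in>B'. a' t * m t) = 0"
      if "if X \<subseteq> U then P' (U - X) else P (U - X)"
      using au[OF that] unfolding sum_Plus3[OF fin] by (simp add: l_def m_def)
    show "\<exists>w. supported_on ?B ?lab U w \<and> (\<forall>s. u s = (\<Sum>t\<in>?B. ?d s t * w t))"
    proof (cases "X \<subseteq> U")
      case False
      have m0: "m t = 0" for t
        using supported_onD[OF u, of "Inr (Inl t)"] False by (auto simp: m_def)
      have n0: "n t = 0" for t
        using supported_onD[OF u, of "Inr (Inr t)"] False by (auto simp: n_def)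
      have "(\<Sum>t\<in>B. d s t * l t) = 0" for s by (simp add: n_eq n0)
      moreover have "(\<Sum>t\<in>B. a t * l t) = 0" if "P (U - X)" using au' that False by (simp add: m0)
      ultimately have "\<exists>w. supported_on B lab (U - X) w \<and> (\<forall>s. l s = (\<Sum>t\<in>B. d s t * w t))"
        by (rule F.exact[OF UX l])
      then obtain w where w: "supported_on B lab (U - X) w" "\<And>s. l s = (\<Sum>t\<in>B. d s t * w t)"
        by blast
      define w' :: "'b + 'c + 'b \<Rightarrow> 'k" where "w' = (\<lambda>t. case t of Inl t \<Rightarrow> w t | _ \<Rightarrow> 0)"
      have "supported_on ?B ?lab U w'"
        unfolding supported_on_def
      proof (intro allI impI)
        fix t assume "w' t \<noteq> 0"
        then show "t \<in> ?B \<and> ?lab t \<subseteq> U"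
          using supported_onD[OF w(1)] by (cases t rule: sum3_cases) (auto simp: w'_def)
      qed
      moreover have "u s = (\<Sum>t\<in>?B. ?d s t * w' t)" for s
      proof (cases s rule: sum3_cases)
        case (1 t)
        then show ?thesis using w(2)[of t] unfolding sum_Plus3[OF fin] by (simp add: w'_def l_def)
      next
        case (2 t)
        then show ?thesis using m0[of t] unfolding sum_Plus3[OF fin] by (simp add: w'_def m_def)
      next
        case (3 t)
        then show ?thesis using n0[of t] unfolding sum_Plus3[OF fin] by (simp add: w'_def n_def)
      qed
      ultimately show ?thesis by blast
    next
      case True
      \<comment> \<open>Adding the boundary of \<open>l\<close>, placed in the shifted copy, clears
        the components \<open>l\<close> and \<open>n\<close> and turns \<open>m\<close> into
        \<open>q\<close>. What is left is a cycle of \<open>F'\<close>.\<close>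
      define q where "q s = m s + (\<Sum>t\<in>B. \<phi> s t * l t)" for s
      have "(\<Sum>s\<in>B'. d' r s * q s) = 0" for r
      proof -
        have "(\<Sum>s\<in>B'. d' r s * (\<Sum>t\<in>B. \<phi> s t * l t)) = (\<Sum>t\<in>B. (\<Sum>s\<in>B'. d' r s * \<phi> s t) * l t)"
          unfolding sum_distrib_left sum_distrib_right
          by (subst sum.swap) (simp add: mult.assoc)
        also have "\<dots> = (\<Sum>s\<in>B. \<phi> r s * (\<Sum>t\<in>B. d s t * l t))"
          unfolding \<phi>_d sum_distrib_left sum_distrib_right
          by (subst sum.swap) (simp add: mult.assoc)
        also have "\<dots> = (\<Sum>s\<in>B. \<phi> r s * n s)" by (simp add: n_eq)
        finally show ?thesis using m_eq[of r] by (simp add: q_def distrib_left sum.distrib)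
      qed
      moreover have "(\<Sum>s\<in>B'. a' s * q s) = 0" if P': "P' (U - X)"
      proof -
        have "(\<Sum>s\<in>B'. a' s * (\<Sum>t\<in>B. \<phi> s t * l t)) = (\<Sum>t\<in>B. (\<Sum>s\<in>B'. a' s * \<phi> s t) * l t)"
          unfolding sum_distrib_left sum_distrib_right
          by (subst sum.swap) (simp add: mult.assoc)
        also have "\<dots> = (\<Sum>t\<in>B. a t * l t)"
        proof (rule sum.cong[OF refl])
          fix t assume t: "t \<in> B"
          show "(\<Sum>s\<in>B'. a' s * \<phi> s t) * l t = a t * l t"
          proof (cases "l t = 0")
            case False
            then have "P' (lab t)" using supported_onD[OF l] G.mono UX P' by blast
            then show ?thesis using \<phi>_a t by simp
          qed simp
        qed
        finally show ?thesis using au' True P' by (simp add: q_def distrib_left sum.distrib add.commute)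
      qed
      moreover have "supported_on B' lab' (U - X) q"
        unfolding supported_on_def
      proof (intro allI impI)
        fix s assume "q s \<noteq> 0"
        then consider "m s \<noteq> 0" | "(\<Sum>t\<in>B. \<phi> s t * l t) \<noteq> 0"
          unfolding q_def by fastforce
        then show "s \<in> B' \<and> lab' s \<subseteq> U - X"
        proof cases
          case 1
          then show ?thesis by (rule supported_onD[OF m])
        next
          case 2
          then obtain t where "\<phi> s t * l t \<noteq> 0" by (meson sum.neutral)
          then show ?thesis using supported_onD[OF l, of t] \<phi>_nonzero[of s t] by auto
        qed
      qed
      ultimately have "\<exists>w. supported_on B' lab' (U - X) w \<and> (\<forall>s. q s = (\<Sum>t\<in>B'. d' s t * w t))"
        using G.exact[OF UX, of q] by blast
      then obtain w where w: "supported_on B' lab' (U - X) w" "\<And>s. q s = (\<Sum>t\<in>B'. d' s t * w t)"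
        by blast
      define w' :: "'b + 'c + 'b \<Rightarrow> 'k"
        where "w' = (\<lambda>t. case t of Inl t \<Rightarrow> 0 | Inr (Inl t) \<Rightarrow> w t | Inr (Inr t) \<Rightarrow> - l t)"
      have "supported_on ?B ?lab U w'"
        unfolding supported_on_def
      proof (intro allI impI)
        fix t assume "w' t \<noteq> 0"
        then show "t \<in> ?B \<and> ?lab t \<subseteq> U"
          using supported_onD[OF w(1)] supported_onD[OF l] True
          by (cases t rule: sum3_cases) (auto simp: w'_def)
      qed
      moreover have "u s = (\<Sum>t\<in>?B. ?d s t * w' t)" for s
      proof (cases s rule: sum3_cases)
        case (1 t)
        then show ?thesis
          using id_sum[of t "\<lambda>t. - l t"] supported_onD[OF l, of t] unfolding sum_Plus3[OF fin]
          by (auto simp: w'_def l_def)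
      next
        case (2 t)
        then show ?thesis
          using w(2)[of t] unfolding sum_Plus3[OF fin] by (simp add: w'_def q_def m_def sum_negf eq_diff_eq)
      next
        case (3 t)
        then show ?thesis
          using n_eq[of t] unfolding sum_Plus3[OF fin] by (simp add: w'_def n_def)
      qed
      ultimately show ?thesis by blast
    qed
  qed
qed

section \<open>Gaussian elimination and minimality\<close>

context squarefree_resolution
begin

text \<open>Gaussian elimination: the basis elements \<open>t0\<close> and \<open>\<partial>t0\<close> span an exact subcomplex, and
  in the quotient \<open>s0\<close> is expressed through the other basis elements.\<close>

lemma cancel:
  assumes c: "d s0 t0 \<noteq> 0" and lab: "lab s0 = lab t0"
  defines "d' \<equiv> \<lambda>s t. if s \<in> {s0, t0} \<or> t \<in> {s0, t0} then 0 else d s t - d s t0 * d s0 t / d s0 t0"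
  shows "squarefree_resolution V P (B - {s0, t0}) deg lab d' (\<lambda>s. if s = s0 then 0 else a s)"
proof -
  let ?B = "B - {s0, t0}" and ?a = "\<lambda>s. if s = s0 then 0 else a s"
  define c where "c = d s0 t0"
  have c0: "c \<noteq> 0" using assms(1) by (simp add: c_def)
  have st: "s0 \<in> B" "t0 \<in> B" "deg t0 = Suc (deg s0)" using d_nonzero[OF assms(1)] by auto
  then have neq: "s0 \<noteq> t0" "t0 \<noteq> s0" by auto
  have d0: "d s0 s0 = 0" "d t0 t0 = 0" "d t0 s0 = 0"
    using d_nonzero[of s0 s0] d_nonzero[of t0 t0] d_nonzero[of t0 s0] st by auto
  have a_t0: "a t0 = 0" using a_nonzero[of t0] st by auto
  have split: "(\<Sum>t\<in>B. f t) = f s0 + f t0 + (\<Sum>t\<in>?B. f t)" for f :: "'b \<Rightarrow> 'k"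
  proof -
    have "B = insert s0 (insert t0 ?B)" using st by auto
    then have "(\<Sum>t\<in>B. f t) = (\<Sum>t\<in>insert s0 (insert t0 ?B). f t)" by simp
    also have "\<dots> = f s0 + f t0 + (\<Sum>t\<in>?B. f t)"
      using neq finite_B by (simp add: add.assoc)
    finally show ?thesis .
  qed
  have sum_B: "(\<Sum>t\<in>?B. f t) = (\<Sum>t\<in>B. f t) - f s0 - f t0" for f :: "'b \<Rightarrow> 'k"
    using split[of f] by (simp add: algebra_simps)
  \<comment> \<open>\<open>d'\<close> is the Schur complement of the pivot \<open>c\<close>.\<close>
  have d'_eq: "d' s t = d s t - d s t0 * d s0 t / c" if "s \<notin> {s0, t0}" "t \<notin> {s0, t0}" for s t
    using that by (simp add: d'_def c_def)
  have d'_apply: "(\<Sum>t\<in>?B. d' s t * u t) = (\<Sum>t\<in>?B. d s t * u t) - d s t0 / c * (\<Sum>t\<in>?B. d s0 t * u t)"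
    if "s \<notin> {s0, t0}" for s u
  proof -
    have "(\<Sum>t\<in>?B. d' s t * u t) = (\<Sum>t\<in>?B. d s t * u t - d s t0 / c * (d s0 t * u t))"
      using that by (intro sum.cong) (auto simp: d'_eq algebra_simps)
    then show ?thesis by (simp add: sum_subtractf sum_distrib_left sum_divide_distrib)
  qed
  show ?thesis
  proof unfold_locales
    show "finite ?B" using finite_B by simp
  next
    fix s t assume nz: "d' s t \<noteq> 0"
    then have st': "s \<notin> {s0, t0}" "t \<notin> {s0, t0}" by (auto simp: d'_def split: if_splits)
    then consider "d s t \<noteq> 0" | "d s t0 \<noteq> 0" "d s0 t \<noteq> 0" using nz by (fastforce simp: d'_eq)
    then show "s \<in> ?B \<and> t \<in> ?B \<and> deg t = Suc (deg s) \<and> lab s \<subseteq> lab t"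
    proof cases
      case 1
      then show ?thesis using d_nonzero[of s t] st' by auto
    next
      case 2
      then show ?thesis using d_nonzero[of s t0] d_nonzero[of s0 t] st' st lab by auto
    qed
  next
    fix s r
    show "(\<Sum>t\<in>?B. d' s t * d' t r) = 0"
    proof (cases "s \<in> {s0, t0} \<or> r \<in> {s0, t0}")
      case True
      then show ?thesis by (intro sum.neutral) (auto simp: d'_def)
    next
      case False
      have "(\<Sum>t\<in>?B. d q t * d' t r) = (\<Sum>t\<in>?B. d q t * d t r) - (\<Sum>t\<in>?B. d q t * d t t0) * d s0 r / c" for q
      proof -
        have "(\<Sum>t\<in>?B. d q t * d' t r) = (\<Sum>t\<in>?B. d q t * d t r - d q t * d t t0 * (d s0 r / c))"
          using False by (intro sum.cong) (auto simp: d'_eq algebra_simps)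
        then show ?thesis by (simp add: sum_subtractf sum_distrib_right sum_divide_distrib)
      qed
      then have "(\<Sum>t\<in>?B. d q t * d' t r) = - d q t0 * d t0 r" if "q \<notin> {t0}" for q
        using c0 by (simp add: sum_B d_d d0 c_def[symmetric])
      then show ?thesis using False neq by (simp add: d'_apply d0 c_def[symmetric] c0)
    qed
  next
    fix t assume P: "P (lab t)"
    show "(\<Sum>s\<in>?B. ?a s * d' s t) = 0"
    proof (cases "t \<in> {s0, t0}")
      case True
      then show ?thesis by (intro sum.neutral) (auto simp: d'_def)
    next
      case False
      have "(\<Sum>s\<in>?B. ?a s * d' s t) = (\<Sum>s\<in>?B. a s * d s t - a s * d s t0 * (d s0 t / c))"
        using False by (intro sum.cong) (auto simp: d'_eq algebra_simps)
      also have "\<dots> = (\<Sum>s\<in>?B. a s * d s t) - (\<Sum>s\<in>?B. a s * d s t0) * (d s0 t / c)"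
        by (simp add: sum_subtractf sum_distrib_right sum_divide_distrib)
      also have "(\<Sum>s\<in>?B. a s * d s t) = - a s0 * d s0 t"
        using a_d[OF P] by (simp add: sum_B a_t0)
      \<comment> \<open>Using \<open>a_d\<close> for the pivot column requires
        \<open>P (lab t0)\<close>. It holds because \<open>lab t0 = lab s0\<close> is contained in
        the face \<open>lab t\<close>.\<close>
      also have "(\<Sum>s\<in>?B. a s * d s t0) * (d s0 t / c) = - a s0 * d s0 t"
      proof (cases "d s0 t = 0")
        case False
        then have "lab t0 \<subseteq> lab t" "t \<in> B" using d_nonzero[of s0 t] lab by auto
        then have "P (lab t0)" using P mono lab_subset by blast
        then show ?thesis using a_d[of t0] c0 by (simp add: sum_B a_t0 c_def[symmetric])
      qed simp
      finally show ?thesis by simp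
    qed
  next
    fix U assume U: "U \<subseteq> V" "P U"
    then obtain s where s: "s \<in> B" "a s \<noteq> 0" "lab s \<subseteq> U" using a_surj by blast
    \<comment> \<open>If the element found is \<open>s0\<close>, the relation \<open>a_d\<close> at
      \<open>t0\<close> shows that \<open>a\<close> is also nonzero on another target of
      \<open>t0\<close>, and its label is contained in \<open>lab t0 = lab s0\<close>.\<close>
    have "\<exists>r. r \<in> B \<and> a r \<noteq> 0 \<and> lab r \<subseteq> U \<and> r \<noteq> s0"
    proof (cases "s = s0")
      case True
      then have "P (lab t0)" using U s lab mono by auto
      then have "(\<Sum>r\<in>?B. a r * d r t0) \<noteq> 0"
        using a_d[of t0] c0 s True by (simp add: sum_B a_t0 c_def[symmetric])
      then obtain r where "r \<in> ?B" "a r * d r t0 \<noteq> 0" by (meson sum.neutral)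
      then show ?thesis using d_nonzero[of r t0] lab s True by auto
    qed (use s in blast)
    then show "\<exists>s\<in>?B. ?a s \<noteq> 0 \<and> lab s \<subseteq> U" using a_t0 by auto
  next
    fix U u
    assume U: "U \<subseteq> V" and u: "supported_on ?B lab U u"
      and du: "\<And>s. (\<Sum>t\<in>?B. d' s t * u t) = 0" and au: "P U \<Longrightarrow> (\<Sum>t\<in>?B. ?a t * u t) = 0"
    \<comment> \<open>The coefficient of \<open>t0\<close> for which the boundary has no component
      at \<open>s0\<close>.\<close>
    define y where "y = - (\<Sum>t\<in>?B. d s0 t * u t) / c"
    define v where "v = u(t0 := y)"
    have u0: "u s0 = 0" using supported_onD[OF u, of s0] by auto
    have v_sum: "(\<Sum>t\<in>B. f t * v t) = (\<Sum>t\<in>?B. f t * u t) + f t0 * y" for f :: "'b \<Rightarrow> 'k"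
    proof -
      have "(\<Sum>t\<in>?B. f t * v t) = (\<Sum>t\<in>?B. f t * u t)" by (intro sum.cong) (auto simp: v_def)
      moreover have "v s0 = 0" "v t0 = y" using neq u0 by (auto simp: v_def)
      ultimately show ?thesis by (simp add: split[of "\<lambda>t. f t * v t"])
    qed
    have lab_U: "lab t0 \<subseteq> U" if "y \<noteq> 0"
    proof -
      have "(\<Sum>t\<in>?B. d s0 t * u t) \<noteq> 0" using that by (auto simp: y_def)
      then obtain t where "d s0 t * u t \<noteq> 0" by (meson sum.neutral)
      then show ?thesis using d_nonzero[of s0 t] supported_onD[OF u, of t] lab by auto
    qed
    have v: "supported_on B lab U v"
      using supported_onD[OF u] lab_U st by (auto simp: supported_on_def v_def)
    have dv: "(\<Sum>t\<in>B. d s t * v t) = 0" if "s \<noteq> t0" for s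
    proof (cases "s = s0")
      case True
      then show ?thesis using c0 by (simp add: v_sum y_def c_def[symmetric])
    next
      case False
      then show ?thesis using du[of s] d'_apply[of s u] that by (simp add: v_sum y_def)
    qed
    \<comment> \<open>The remaining component of the boundary, at \<open>t0\<close>, comes from
      \<open>d_d\<close>: in row \<open>s0\<close> only the pivot term survives.\<close>
    have "(\<Sum>t\<in>B. d s0 t * (\<Sum>r\<in>B. d t r * v r)) = c * (\<Sum>r\<in>B. d t0 r * v r)"
    proof -
      have "(\<Sum>t\<in>?B. d s0 t * (\<Sum>r\<in>B. d t r * v r)) = 0" by (intro sum.neutral) (auto simp: dv)
      then show ?thesis by (simp add: split[of "\<lambda>t. d s0 t * (\<Sum>r\<in>B. d t r * v r)"] d0 c_def)
    qed
    then have "(\<Sum>r\<in>B. d t0 r * v r) = 0" using d_d_apply[of s0 v] c0 by simp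
    then have dv': "(\<Sum>t\<in>B. d s t * v t) = 0" for s using dv by (cases "s = t0") auto
    have "(\<Sum>t\<in>B. a t * v t) = 0" if "P U"
    proof -
      have "(\<Sum>t\<in>?B. a t * u t) = (\<Sum>t\<in>?B. ?a t * u t)" by (intro sum.cong) auto
      then show ?thesis using au[OF that] by (simp add: v_sum a_t0)
    qed
    then obtain w where w: "supported_on B lab U w" "\<And>s. v s = (\<Sum>t\<in>B. d s t * w t)"
      using exact[OF U v dv'] by blast
    \<comment> \<open>Subtracting a multiple of the boundary of \<open>t0\<close> does not change
      the boundary of \<open>w\<close> and removes the coefficient of \<open>s0\<close>.\<close>
    define x where "x t = w t - w s0 / c * d t t0" for t
    have x0: "x s0 = 0" using c0 by (simp add: x_def c_def)
    have x: "supported_on B lab U x"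
      unfolding supported_on_def
    proof (intro allI impI)
      fix t assume "x t \<noteq> 0"
      then consider "w t \<noteq> 0" | "w s0 \<noteq> 0" "d t t0 \<noteq> 0" by (fastforce simp: x_def)
      then show "t \<in> B \<and> lab t \<subseteq> U"
      proof cases
        case 1
        then show ?thesis by (rule supported_onD[OF w(1)])
      next
        case 2
        then show ?thesis using supported_onD[OF w(1), of s0] d_nonzero[of t t0] lab by auto
      qed
    qed
    have v_x: "v s = (\<Sum>t\<in>B. d s t * x t)" for s
    proof -
      have "(\<Sum>t\<in>B. d s t * x t) = (\<Sum>t\<in>B. d s t * w t) - w s0 / c * (\<Sum>t\<in>B. d s t * d t t0)"
        by (simp add: x_def right_diff_distrib sum_subtractf sum_distrib_left mult.left_commute)
      then show ?thesis by (simp add: w(2) d_d)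
    qed
    define z where "z t = (if t = t0 then 0 else x t)" for t
    have z_sum: "(\<Sum>t\<in>?B. f t * z t) = (\<Sum>t\<in>B. f t * x t) - f t0 * x t0" for f :: "'b \<Rightarrow> 'k"
    proof -
      have "(\<Sum>t\<in>?B. f t * z t) = (\<Sum>t\<in>?B. f t * x t)" by (intro sum.cong) (auto simp: z_def)
      then show ?thesis by (simp add: split[of "\<lambda>t. f t * x t"] x0)
    qed
    have "supported_on ?B lab U z"
      using supported_onD[OF x] x0 by (auto simp: supported_on_def z_def)
    moreover have "u s = (\<Sum>t\<in>?B. d' s t * z t)" for s
    proof (cases "s \<in> {s0, t0}")
      case True
      then have "u s = 0" using supported_onD[OF u, of s] by auto
      moreover have "(\<Sum>t\<in>?B. d' s t * z t) = 0"
        using True by (intro sum.neutral) (auto simp: d'_def)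
      ultimately show ?thesis by simp
    next
      case False
      have "v s0 = 0" using u0 neq by (simp add: v_def)
      then have "(\<Sum>t\<in>B. d s0 t * x t) = 0" using v_x[of s0] by simp
      then have "(\<Sum>t\<in>?B. d' s t * z t) = v s"
        unfolding d'_apply[OF False] z_sum using c0 by (simp add: v_x[symmetric] c_def[symmetric])
      then show ?thesis using False by (simp add: v_def)
    qed
    ultimately show "\<exists>w. supported_on ?B lab U w \<and> (\<forall>s. u s = (\<Sum>t\<in>?B. d' s t * w t))"
      by blast
  qed (use mono lab_subset a_nonzero a_t0 in \<open>auto split: if_splits\<close>)
qed

end

text \<open>Each cancellation removes two basis elements, so the process ends. The conclusion
  retains \<open>deg\<close>, \<open>lab\<close> and \<open>B' \<subseteq> B\<close> because bounds
  on labels are carried over through them.\<close>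

lemma squarefree_minimize:
  fixes d :: "'b \<Rightarrow> 'b \<Rightarrow> 'k::field"
  assumes "squarefree_resolution V P B deg lab d a"
  shows "\<exists>B' d' a'. B' \<subseteq> B \<and> squarefree_resolution V P B' deg lab d' (a' :: 'b \<Rightarrow> 'k) \<and>
    (\<forall>s t. d' s t \<noteq> 0 \<longrightarrow> lab s \<noteq> lab t)"
  using assms
proof (induction "card B" arbitrary: B d a rule: less_induct)
  case less
  interpret squarefree_resolution V P B deg lab d a by (fact less.prems)
  show ?case
  proof (cases "\<exists>s t. d s t \<noteq> 0 \<and> lab s = lab t")
    case True
    then obtain s0 t0 where st: "d s0 t0 \<noteq> 0" "lab s0 = lab t0" by blast
    then have "B - {s0, t0} \<subset> B" using d_nonzero by blast
    then have "card (B - {s0, t0}) < card B" using finite_B psubset_card_mono by blast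
    from less.hyps[OF this cancel[OF st]] show ?thesis by blast
  qed (use less.prems in blast)
qed

section \<open>Homogeneous polynomials\<close>

abbreviation (input) lookup where "lookup \<equiv> Poly_Mapping.lookup"
abbreviation (input) keys where "keys \<equiv> Poly_Mapping.keys"
abbreviation (input) single where "single \<equiv> Poly_Mapping.single"

lemma lookup_single_times_add:
  fixes p :: "('v, 'k::field) mpoly"
  shows "lookup (single m c * p) (m + n) = c * lookup p n"
  by (simp add: lookup_mult prod_fun_def lookup_single when_mult)

lemma lookup_single_times_eq_0:
  fixes p :: "('v, 'k::field) mpoly"
  assumes "\<And>n. k \<noteq> m + n"
  shows "lookup (single m c * p) k = 0"
  using assms by (simp add: lookup_mult prod_fun_def lookup_single when_mult)

lemma monomial_add_eq_0_iff: "(0 :: 'v \<Rightarrow>\<^sub>0 nat) = l + q \<longleftrightarrow> l = 0 \<and> q = 0"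
  by (metis add_is_0 lookup_add lookup_zero poly_mapping_eqI add_0)

text \<open>The monomial 1 factors only as 1 times 1. Taking constant terms is thus multiplicative,
  which is what allows reduction of a matrix identity modulo the variables.\<close>

lemma lookup_times_0:
  fixes p q :: "('v, 'k::field) mpoly"
  shows "lookup (p * q) 0 = lookup p 0 * lookup q 0"
proof -
  have "(\<Sum>n. lookup q n when (0 :: 'v \<Rightarrow>\<^sub>0 nat) = l + n) = (lookup q 0 when l = 0)" for l
    by (cases "l = 0") (auto simp: monomial_add_eq_0_iff)
  then show ?thesis
    by (simp add: lookup_mult prod_fun_def mult_when)
qed

lemma poly_expand: "p = (\<Sum>m\<in>keys p. single m (lookup p m))"
  by (rule poly_mapping_eqI) (simp add: lookup_sum lookup_single when_def in_keys_iff)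

lemma keys_monomial_add: "keys (m + n :: 'v \<Rightarrow>\<^sub>0 nat) = keys m \<union> keys n"
  by (auto simp: in_keys_iff lookup_add)

section \<open>Carrier and ring structure of the polynomial ring\<close>

lemma carrier_polynomial_ring_iff:
  "p \<in> carrier (polynomial_ring V) \<longleftrightarrow> (\<forall>m\<in>keys p. keys m \<subseteq> V)"
  by (simp add: polynomial_ring_def)

lemma polynomial_ring_simps [simp]:
  "monoid.mult (polynomial_ring V) = (*)" "one (polynomial_ring V) = 1"
  "zero (polynomial_ring V) = 0" "add (polynomial_ring V) = (+)"
  by (simp_all add: polynomial_ring_def)

lemma carrier_zero [simp]: "0 \<in> carrier (polynomial_ring V)"
  and carrier_one [simp]: "1 \<in> carrier (polynomial_ring V)"
  by (simp_all add: carrier_polynomial_ring_iff)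

lemma carrier_add: "p \<in> carrier (polynomial_ring V) \<Longrightarrow> q \<in> carrier (polynomial_ring V) \<Longrightarrow>
    p + q \<in> carrier (polynomial_ring V)"
  using keys_add[of p q] by (auto simp: carrier_polynomial_ring_iff)

lemma carrier_uminus: "p \<in> carrier (polynomial_ring V) \<Longrightarrow> - p \<in> carrier (polynomial_ring V)"
  by (auto simp: carrier_polynomial_ring_iff in_keys_iff)

lemma carrier_times: "p \<in> carrier (polynomial_ring V) \<Longrightarrow> q \<in> carrier (polynomial_ring V) \<Longrightarrow>
    p * q \<in> carrier (polynomial_ring V)"
  using keys_mult[of p q] by (fastforce simp: carrier_polynomial_ring_iff keys_monomial_add)

lemma carrier_sum: "(\<And>x. x \<in> A \<Longrightarrow> f x \<in> carrier (polynomial_ring V)) \<Longrightarrow>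
    sum f A \<in> carrier (polynomial_ring V)"
  by (induction A rule: infinite_finite_induct) (simp_all add: carrier_add)

lemma carrier_single: "keys m \<subseteq> V \<Longrightarrow> single m c \<in> carrier (polynomial_ring V)"
  by (simp add: carrier_polynomial_ring_iff)

lemma cring_polynomial_ring: "cring (polynomial_ring V)"
proof (intro cringI abelian_groupI comm_monoidI)
  fix x assume "x \<in> carrier (polynomial_ring V)"
  then show "\<exists>y\<in>carrier (polynomial_ring V). y \<oplus>\<^bsub>polynomial_ring V\<^esub> x = \<zero>\<^bsub>polynomial_ring V\<^esub>"
    by (intro bexI[of _ "- x"]) (simp_all add: carrier_uminus)
qed (simp_all add: carrier_add carrier_times algebra_simps)

lemma a_minus_polynomial_ring:
  assumes "p \<in> carrier (polynomial_ring V)" "q \<in> carrier (polynomial_ring V)"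
  shows "p \<ominus>\<^bsub>polynomial_ring V\<^esub> q = p - q"
proof -
  interpret cring "polynomial_ring V" by (rule cring_polynomial_ring)
  have "\<ominus>\<^bsub>polynomial_ring V\<^esub> q = - q"
    using assms(2) by (intro minus_equality) (simp_all add: carrier_uminus)
  then show ?thesis by (simp add: a_minus_def)
qed

section \<open>Degrees and homogeneous components\<close>

lemma monomial_degree_add: "monomial_degree (m + n) = monomial_degree m + monomial_degree n"
proof -
  have *: "monomial_degree k = (\<Sum>x\<in>keys m \<union> keys n. lookup k x)" if "keys k \<subseteq> keys m \<union> keys n"
    for k
    unfolding monomial_degree_def using that
    by (intro sum.mono_neutral_left) (auto simp: in_keys_iff)
  show ?thesis
    by (simp add: *[of m] *[of n] *[of "m + n"] keys_monomial_add lookup_add sum.distrib)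
qed

lemma homogeneous_part_carrier: "p \<in> homogeneous_part V j \<Longrightarrow> p \<in> carrier (polynomial_ring V)"
  by (simp add: homogeneous_part_def)

lemma homogeneous_part_degree:
  "p \<in> homogeneous_part V j \<Longrightarrow> m \<in> keys p \<Longrightarrow> int (monomial_degree m) = j"
  by (simp add: homogeneous_part_def)

lemma homogeneous_part_zero [simp]: "0 \<in> homogeneous_part V j"
  by (simp add: homogeneous_part_def)

lemma homogeneous_part_one [simp]: "1 \<in> homogeneous_part V 0"
  by (simp add: homogeneous_part_def monomial_degree_def)

lemma homogeneous_part_add:
  "p \<in> homogeneous_part V j \<Longrightarrow> q \<in> homogeneous_part V j \<Longrightarrow> p + q \<in> homogeneous_part V j"
  using keys_add[of p q] by (auto simp: homogeneous_part_def carrier_add)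

lemma homogeneous_part_uminus: "p \<in> homogeneous_part V j \<Longrightarrow> - p \<in> homogeneous_part V j"
  by (auto simp: homogeneous_part_def carrier_uminus in_keys_iff)

lemma homogeneous_part_diff:
  "p \<in> homogeneous_part V j \<Longrightarrow> q \<in> homogeneous_part V j \<Longrightarrow> p - q \<in> homogeneous_part V j"
  using homogeneous_part_add[of p V j "- q"] homogeneous_part_uminus by auto

lemma homogeneous_part_times:
  assumes "p \<in> homogeneous_part V i" "q \<in> homogeneous_part V j"
  shows "p * q \<in> homogeneous_part V (i + j)"
proof -
  have "int (monomial_degree m) = i + j" if m: "m \<in> keys (p * q)" for m
  proof -
    obtain m1 m2 where "m = m1 + m2" "m1 \<in> keys p" "m2 \<in> keys q"
      using m keys_mult[of p q] by blast
    then show ?thesis using assms homogeneous_part_degree by (metis monomial_degree_add of_nat_add)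
  qed
  then show ?thesis using assms by (simp add: homogeneous_part_def carrier_times)
qed

lemma homogeneous_part_sum:
  "(\<And>x. x \<in> A \<Longrightarrow> f x \<in> homogeneous_part V j) \<Longrightarrow> sum f A \<in> homogeneous_part V j"
  by (induction A rule: infinite_finite_induct) (simp_all add: homogeneous_part_add)

lift_definition homogeneous_component :: "int \<Rightarrow> ('v, 'k::field) mpoly \<Rightarrow> ('v, 'k) mpoly" is
  "\<lambda>j p m. if int (monomial_degree m) = j then p m else 0"
proof -
  fix j :: int and p :: "('v \<Rightarrow>\<^sub>0 nat) \<Rightarrow> 'k"
  assume "finite {m. p m \<noteq> 0}"
  then show "finite {m. (if int (monomial_degree m) = j then p m else 0) \<noteq> 0}"
    by (rule finite_subset[rotated]) auto
qed

lemma lookup_homogeneous_component: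
  "lookup (homogeneous_component j p) m = (if int (monomial_degree m) = j then lookup p m else 0)"
  by transfer simp

lemma keys_homogeneous_component:
  "keys (homogeneous_component j p) = {m \<in> keys p. int (monomial_degree m) = j}"
  by (auto simp: in_keys_iff lookup_homogeneous_component split: if_splits)

lemma homogeneous_component_mem:
  "p \<in> carrier (polynomial_ring V) \<Longrightarrow> homogeneous_component j p \<in> homogeneous_part V j"
  by (auto simp: homogeneous_part_def carrier_polynomial_ring_iff keys_homogeneous_component)

lemma homogeneous_component_id:
  assumes "p \<in> homogeneous_part V j"
  shows "homogeneous_component j p = p"
proof (rule poly_mapping_eqI)
  fix m show "lookup (homogeneous_component j p) m = lookup p m"
    using homogeneous_part_degree[OF assms, of m]
    by (auto simp: lookup_homogeneous_component in_keys_iff)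
qed

lemma homogeneous_component_add:
  "homogeneous_component j (p + q) = homogeneous_component j p + homogeneous_component j q"
  by (rule poly_mapping_eqI) (simp add: lookup_homogeneous_component lookup_add)

lemma homogeneous_component_diff:
  "homogeneous_component j (p - q) = homogeneous_component j p - homogeneous_component j q"
  by (rule poly_mapping_eqI) (simp add: lookup_homogeneous_component lookup_minus)

lemma homogeneous_component_zero [simp]: "homogeneous_component j 0 = 0"
  by (rule poly_mapping_eqI) (simp add: lookup_homogeneous_component)

lemma homogeneous_component_sum:
  "homogeneous_component j (sum f A) = (\<Sum>x\<in>A. homogeneous_component j (f x))"
  by (induction A rule: infinite_finite_induct) (simp_all add: homogeneous_component_add)

lemma homogeneous_component_times:
  assumes q: "q \<in> homogeneous_part V k"
  shows "homogeneous_component j (q * p) = q * homogeneous_component (j - k) p"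
proof -
  let ?p = "homogeneous_component (j - k) p"
  have deg: "int (monomial_degree m2) = int (monomial_degree (m1 + m2)) - k" if "m1 \<in> keys q" for m1 m2
    using homogeneous_part_degree[OF q that] by (simp add: monomial_degree_add)
  \<comment> \<open>\<open>q * ?p\<close> lives in degree \<open>j\<close> and
    \<open>q * (p - ?p)\<close> misses it, so the component of their sum is the first
    summand.\<close>
  have 1: "int (monomial_degree m) = j" if m: "m \<in> keys (q * ?p)" for m
  proof -
    obtain m1 m2 where "m = m1 + m2" "m1 \<in> keys q" "m2 \<in> keys ?p"
      using m keys_mult[of q ?p] by blast
    then show ?thesis using deg[of m1 m2] by (simp add: keys_homogeneous_component)
  qed
  have 2: "int (monomial_degree m) \<noteq> j" if m: "m \<in> keys (q * (p - ?p))" for m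
  proof -
    obtain m1 m2 where "m = m1 + m2" "m1 \<in> keys q" "m2 \<in> keys (p - ?p)"
      using m keys_mult[of q "p - ?p"] by blast
    then show ?thesis using deg[of m1 m2]
      by (auto simp: in_keys_iff lookup_minus lookup_homogeneous_component split: if_splits)
  qed
  have "q * p = q * ?p + q * (p - ?p)" by (simp add: algebra_simps)
  then have split: "lookup (q * p) m = lookup (q * ?p) m + lookup (q * (p - ?p)) m" for m
    by (metis lookup_add)
  show ?thesis
  proof (rule poly_mapping_eqI)
    fix m show "lookup (homogeneous_component j (q * p)) m = lookup (q * ?p) m"
      using 1[of m] 2[of m] split[of m] by (auto simp: lookup_homogeneous_component in_keys_iff)
  qed
qed

section \<open>Graded free resolutions of cyclic modules\<close>

text \<open>Vectors and matrices become functions on all of \<open>nat\<close> that vanish beyond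
  the rank. Equality is then equality of functions, and products carry no dimension side
  conditions.\<close>

definition free_functions :: "'v set \<Rightarrow> nat \<Rightarrow> (nat \<Rightarrow> ('v, 'k::field) mpoly) set" where
  "free_functions V n = {u. (\<forall>t. u t \<in> carrier (polynomial_ring V)) \<and> (\<forall>t\<ge>n. u t = 0)}"

definition map_compose :: "nat \<Rightarrow> (nat \<Rightarrow> nat \<Rightarrow> 'r::comm_ring_1) \<Rightarrow> (nat \<Rightarrow> nat \<Rightarrow> 'r) \<Rightarrow> nat \<Rightarrow> nat \<Rightarrow> 'r" where
  "map_compose n A B = (\<lambda>s t. \<Sum>r<n. A s r * B r t)"

lemma compose_assoc: "map_compose m (map_compose n A B) C = map_compose n A (map_compose m B C)"
proof (intro ext)
  fix s t
  have "map_compose m (map_compose n A B) C s t = (\<Sum>r<m. \<Sum>q<n. A s q * (B q r * C r t))"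
    by (simp add: map_compose_def sum_distrib_right mult.assoc)
  also have "\<dots> = map_compose n A (map_compose m B C) s t"
    by (subst sum.swap) (simp add: map_compose_def sum_distrib_left)
  finally show "map_compose m (map_compose n A B) C s t = map_compose n A (map_compose m B C) s t" .
qed

lemma compose_diff_left: "map_compose n (\<lambda>s t. A s t - B s t) C = (\<lambda>s t. map_compose n A C s t - map_compose n B C s t)"
  by (simp add: map_compose_def left_diff_distrib sum_subtractf)

lemma compose_diff_right: "map_compose n A (\<lambda>s t. B s t - C s t) = (\<lambda>s t. map_compose n A B s t - map_compose n A C s t)"
  by (simp add: map_compose_def right_diff_distrib sum_subtractf)

definition homogeneous_map ::
  "'v set \<Rightarrow> nat \<Rightarrow> (nat \<Rightarrow> int) \<Rightarrow> nat \<Rightarrow> (nat \<Rightarrow> int) \<Rightarrow> (nat \<Rightarrow> nat \<Rightarrow> ('v, 'k::field) mpoly) \<Rightarrow> bool" where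
  "homogeneous_map V n a m b A \<longleftrightarrow>
     (\<forall>s t. A s t \<in> homogeneous_part V (b t - a s)) \<and> (\<forall>s t. s \<ge> n \<or> t \<ge> m \<longrightarrow> A s t = 0)"

lemma homogeneous_map_compose:
  assumes "homogeneous_map V n a m b A" "homogeneous_map V m b l c B"
  shows "homogeneous_map V n a l c (map_compose m A B)"
  unfolding homogeneous_map_def
proof (intro conjI allI impI)
  fix s t
  have "A s r * B r t \<in> homogeneous_part V (c t - a s)" for r
    using homogeneous_part_times[of "A s r" V "b r - a s" "B r t" "c t - b r"] assms
    by (simp add: homogeneous_map_def)
  then show "map_compose m A B s t \<in> homogeneous_part V (c t - a s)"
    by (simp add: map_compose_def homogeneous_part_sum)
next
  fix s t assume "n \<le> s \<or> l \<le> t"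
  then show "map_compose m A B s t = 0" using assms by (auto simp: map_compose_def homogeneous_map_def)
qed

lemma homogeneous_map_carrier:
  "homogeneous_map V n a m b A \<Longrightarrow> A s t \<in> carrier (polynomial_ring V)"
  using homogeneous_part_carrier unfolding homogeneous_map_def by blast

lemma homogeneous_map_diff:
  "homogeneous_map V n a m b A \<Longrightarrow> homogeneous_map V n a m b B \<Longrightarrow>
    homogeneous_map V n a m b (\<lambda>s t. A s t - B s t)"
  by (simp add: homogeneous_map_def homogeneous_part_diff)

definition identity_map :: "nat \<Rightarrow> nat \<Rightarrow> nat \<Rightarrow> 'r::comm_ring_1" where
  "identity_map n = (\<lambda>s t. if s = t \<and> s < n then 1 else 0)"

lemma homogeneous_map_identity: "homogeneous_map V n a n a (identity_map n)"
  by (auto simp: homogeneous_map_def identity_map_def)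

lemma sum_identity_map_left:
  assumes "s < n"
  shows "(\<Sum>r<n. identity_map n s r * f r) = f s"
proof -
  have "(\<Sum>r<n. identity_map n s r * f r) = (\<Sum>r<n. if s = r then f r else 0)"
    using assms by (intro sum.cong) (auto simp: identity_map_def)
  then show ?thesis using assms by simp
qed

lemma sum_identity_map_right:
  assumes "t < n"
  shows "(\<Sum>r<n. f r * identity_map n r t) = f t"
proof -
  have "(\<Sum>r<n. f r * identity_map n r t) = (\<Sum>r<n. if r = t then f r else 0)"
    using assms by (intro sum.cong) (auto simp: identity_map_def)
  then show ?thesis using assms by simp
qed

lemma compose_identity_left:
  assumes "homogeneous_map V n a m b A"
  shows "map_compose n (identity_map n) A = A"
proof (intro ext)
  fix s t show "map_compose n (identity_map n) A s t = A s t"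
  proof (cases "s < n")
    case True
    then show ?thesis by (simp add: map_compose_def sum_identity_map_left)
  next
    case False
    then show ?thesis using assms by (simp add: map_compose_def identity_map_def homogeneous_map_def)
  qed
qed

lemma compose_identity_right:
  assumes "homogeneous_map V n a m b A"
  shows "map_compose m A (identity_map m) = A"
proof (intro ext)
  fix s t show "map_compose m A (identity_map m) s t = A s t"
  proof (cases "t < m")
    case True
    then show ?thesis by (simp add: map_compose_def sum_identity_map_right)
  next
    case False
    have "(\<Sum>r<m. A s r * identity_map m r t) = 0"
      using False by (intro sum.neutral) (auto simp: identity_map_def)
    then show ?thesis using False assms by (simp add: map_compose_def homogeneous_map_def)
  qed
qed

locale graded_ideal =
  fixes V :: "'v set" and I :: "('v, 'k::field) mpoly set"
  assumes ideal_I: "ideal I (polynomial_ring V)"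
    and component_I: "p \<in> I \<Longrightarrow> homogeneous_component j p \<in> I"
begin

lemma I_zero: "0 \<in> I"
  using additive_subgroup.zero_closed[OF ideal.axioms(1)[OF ideal_I]] by simp

lemma I_add: "p \<in> I \<Longrightarrow> q \<in> I \<Longrightarrow> p + q \<in> I"
  using additive_subgroup.a_closed[OF ideal.axioms(1)[OF ideal_I]] by simp

lemma I_times: "p \<in> I \<Longrightarrow> q \<in> carrier (polynomial_ring V) \<Longrightarrow> p * q \<in> I"
  using ideal.I_r_closed[OF ideal_I] by simp

lemma I_sum: "(\<And>x. x \<in> A \<Longrightarrow> f x \<in> I) \<Longrightarrow> sum f A \<in> I"
  by (induction A rule: infinite_finite_induct) (simp_all add: I_add I_zero)

end

text \<open>The resolved module is the quotient by \<open>I\<close>, and \<open>q t\<close> is a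
  polynomial representing the image of the \<open>t\<close>-th basis element. With representatives,
  statements about cosets turn into membership in \<open>I\<close>.\<close>

locale coordinate_resolution = graded_ideal V I
  for V :: "'v set" and I :: "('v, 'k::field) mpoly set" +
  fixes n :: "nat \<Rightarrow> nat" and sh :: "nat \<Rightarrow> nat \<Rightarrow> int"
    and D :: "nat \<Rightarrow> nat \<Rightarrow> nat \<Rightarrow> ('v, 'k) mpoly" and q :: "nat \<Rightarrow> ('v, 'k) mpoly"
  assumes D_hom: "homogeneous_map V (n i) (sh i) (n (Suc i)) (sh (Suc i)) (D i)"
    and q_hom: "q t \<in> homogeneous_part V (sh 0 t)"
    and q_out: "t \<ge> n 0 \<Longrightarrow> q t = 0"
    and q_surj: "p \<in> carrier (polynomial_ring V) \<Longrightarrow>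
      \<exists>u\<in>free_functions V (n 0). (\<Sum>t<n 0. q t * u t) - p \<in> I"
    and q_exact: "u \<in> free_functions V (n 0) \<Longrightarrow> (\<Sum>t<n 0. q t * u t) \<in> I \<longleftrightarrow>
      (\<exists>w\<in>free_functions V (n 1). u = (\<lambda>s. \<Sum>t<n 1. D 0 s t * w t))"
    and D_exact: "u \<in> free_functions V (n (Suc i)) \<Longrightarrow> (\<forall>s. (\<Sum>t<n (Suc i). D i s t * u t) = 0) \<longleftrightarrow>
      (\<exists>w\<in>free_functions V (n (Suc (Suc i))). u = (\<lambda>s. \<Sum>t<n (Suc (Suc i)). D (Suc i) s t * w t))"
begin

text \<open>The condition under which the columns of \<open>A\<close> lift through
  \<open>D i\<close>. In degree 0 the augmentation takes the place of the outgoing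
  differential.\<close>

fun cycle :: "nat \<Rightarrow> (nat \<Rightarrow> nat \<Rightarrow> ('v, 'k) mpoly) \<Rightarrow> bool" where
  "cycle 0 A \<longleftrightarrow> (\<forall>t. (\<Sum>r<n 0. q r * A r t) \<in> I)"
| "cycle (Suc i) A \<longleftrightarrow> map_compose (n (Suc i)) (D i) A = (\<lambda>s t. 0)"

lemma homogeneous_map_column:
  "homogeneous_map V m a l b A \<Longrightarrow> (\<lambda>s. A s t) \<in> free_functions V m"
  using homogeneous_part_carrier by (fastforce simp: homogeneous_map_def free_functions_def)

text \<open>A column of \<open>D (Suc i)\<close> is the image of a unit vector, so the exactness
  equivalence can be applied to it.\<close>

lemma D_D: "map_compose (n (Suc i)) (D i) (D (Suc i)) = (\<lambda>s t. 0)"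
proof (intro ext)
  fix s t
  show "map_compose (n (Suc i)) (D i) (D (Suc i)) s t = 0"
  proof (cases "t < n (Suc (Suc i))")
    case True
    have "\<exists>w\<in>free_functions V (n (Suc (Suc i))).
        (\<lambda>s. D (Suc i) s t) = (\<lambda>s. \<Sum>r<n (Suc (Suc i)). D (Suc i) s r * w r)"
      using True by (intro bexI[OF _ homogeneous_map_column[OF homogeneous_map_identity, where t = t]])
        (simp add: sum_identity_map_right)
    from iffD2[OF D_exact[OF homogeneous_map_column[OF D_hom]] this]
    show ?thesis by (simp add: map_compose_def)
  next
    case False
    then show ?thesis using D_hom[of "Suc i"] by (simp add: map_compose_def homogeneous_map_def)
  qed
qed

lemma q_D: "(\<Sum>r<n 0. q r * D 0 r t) \<in> I"
proof (cases "t < n 1")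
  case True
  have "\<exists>w\<in>free_functions V (n 1). (\<lambda>s. D 0 s t) = (\<lambda>s. \<Sum>r<n 1. D 0 s r * w r)"
    using True by (intro bexI[OF _ homogeneous_map_column[OF homogeneous_map_identity, where t = t]])
      (simp add: sum_identity_map_right)
  from iffD2[OF q_exact[OF homogeneous_map_column[OF D_hom]] this] show ?thesis .
next
  case False
  then show ?thesis using D_hom[of 0] by (simp add: homogeneous_map_def I_zero)
qed

text \<open>Exactness yields a preimage of each column, possibly inhomogeneous. Since
  \<open>D i\<close> and \<open>A\<close> are homogeneous, the components in the expected degrees
  already form a preimage.\<close>

lemma lift_map:
  assumes A: "homogeneous_map V (n i) (sh i) m b A" and cyc: "cycle i A"
  shows "\<exists>Y. homogeneous_map V (n (Suc i)) (sh (Suc i)) m b Y \<and> map_compose (n (Suc i)) (D i) Y = A"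
proof -
  have "\<exists>w\<in>free_functions V (n (Suc i)). (\<lambda>s. A s t) = (\<lambda>s. \<Sum>r<n (Suc i). D i s r * w r)" for t
  proof (cases i)
    case 0
    then show ?thesis using q_exact[OF homogeneous_map_column[OF A[unfolded 0], where t = t]] cyc by simp
  next
    case (Suc j)
    have "\<forall>s. (\<Sum>r<n (Suc j). D j s r * A r t) = 0"
      using cyc Suc by (simp add: map_compose_def fun_eq_iff)
    then show ?thesis using D_exact[OF homogeneous_map_column[OF A[unfolded Suc], where t = t]] Suc by simp
  qed
  then obtain W where W: "\<And>t. W t \<in> free_functions V (n (Suc i))"
    and A_W: "\<And>t. (\<lambda>s. A s t) = (\<lambda>s. \<Sum>r<n (Suc i). D i s r * W t r)"
    by metis
  define Y where "Y r t = (if t < m then homogeneous_component (b t - sh (Suc i) r) (W t r) else 0)" for r t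
  have "homogeneous_map V (n (Suc i)) (sh (Suc i)) m b Y"
    using W by (auto simp: homogeneous_map_def Y_def free_functions_def homogeneous_component_mem)
  moreover have "map_compose (n (Suc i)) (D i) Y s t = A s t" for s t
  proof (cases "t < m")
    case True
    have "D i s r * Y r t = homogeneous_component (b t - sh i s) (D i s r * W t r)" for r
      using True homogeneous_component_times[of "D i s r" V "sh (Suc i) r - sh i s" "b t - sh i s" "W t r"]
        D_hom[of i]
      by (simp add: Y_def homogeneous_map_def)
    then have "map_compose (n (Suc i)) (D i) Y s t = homogeneous_component (b t - sh i s) (A s t)"
      using A_W[of t, THEN fun_cong, of s] by (simp add: map_compose_def homogeneous_component_sum)
    moreover have "A s t \<in> homogeneous_part V (b t - sh i s)" using A by (simp add: homogeneous_map_def)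
    ultimately show ?thesis by (simp add: homogeneous_component_id)
  next
    case False
    then show ?thesis using A by (simp add: map_compose_def Y_def homogeneous_map_def)
  qed
  ultimately show ?thesis by blast
qed

lemma lift_row:
  assumes hom: "\<And>t. p t \<in> homogeneous_part V (b t)" and out: "\<And>t. t \<ge> m \<Longrightarrow> p t = 0"
  shows "\<exists>Y. homogeneous_map V (n 0) (sh 0) m b Y \<and> (\<forall>t. (\<Sum>r<n 0. q r * Y r t) - p t \<in> I)"
proof -
  have "\<exists>u\<in>free_functions V (n 0). (\<Sum>r<n 0. q r * u r) - p t \<in> I" for t
    using q_surj hom homogeneous_part_carrier by blast
  then obtain W where W: "\<And>t. W t \<in> free_functions V (n 0)"
    and p_W: "\<And>t. (\<Sum>r<n 0. q r * W t r) - p t \<in> I"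
    by metis
  define Y where "Y r t = (if t < m then homogeneous_component (b t - sh 0 r) (W t r) else 0)" for r t
  have "homogeneous_map V (n 0) (sh 0) m b Y"
    using W by (auto simp: homogeneous_map_def Y_def free_functions_def homogeneous_component_mem)
  moreover have "(\<Sum>r<n 0. q r * Y r t) - p t \<in> I" for t
  proof (cases "t < m")
    case True
    have "q r * Y r t = homogeneous_component (b t) (q r * W t r)" for r
      using True homogeneous_component_times[OF q_hom, of "b t" r "W t r"] by (simp add: Y_def)
    then have "(\<Sum>r<n 0. q r * Y r t) - p t = homogeneous_component (b t) ((\<Sum>r<n 0. q r * W t r) - p t)"
      using homogeneous_component_id[OF hom[of t]]
      by (simp add: homogeneous_component_sum homogeneous_component_diff)
    then show ?thesis using component_I p_W by simp
  next
    case False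
    then show ?thesis by (simp add: Y_def out I_zero)
  qed
  ultimately show ?thesis by blast
qed

text \<open>\<open>\<gamma>\<close> is a chain map inducing 0 on the module. The homotopy is built
  upwards from degree 0, each map lifting what its predecessor leaves over.\<close>

lemma null_homotopy:
  assumes hom: "\<And>i. homogeneous_map V (n i) (sh i) (n i) (sh i) (\<gamma> i)"
    and chain: "\<And>i. map_compose (n (Suc i)) (D i) (\<gamma> (Suc i)) = map_compose (n i) (\<gamma> i) (D i)"
    and aug: "\<And>t. (\<Sum>r<n 0. q r * \<gamma> 0 r t) \<in> I"
  shows "\<exists>h. map_compose (n 1) (D 0) (h 0) = \<gamma> 0 \<and>
    (\<forall>i. map_compose (n (Suc (Suc i))) (D (Suc i)) (h (Suc i)) =
      (\<lambda>s t. \<gamma> (Suc i) s t - map_compose (n i) (h i) (D i) s t))"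
proof -
  \<comment> \<open>The part of \<open>\<gamma> (Suc i)\<close> not yet accounted for by the
    homotopy \<open>y\<close> in degree \<open>i\<close>; it is the next map to be lifted.\<close>
  define \<delta> where "\<delta> i y = (\<lambda>s t. \<gamma> (Suc i) s t - map_compose (n i) y (D i) s t)" for i y
  define P where "P i y \<longleftrightarrow> homogeneous_map V (n (Suc i)) (sh (Suc i)) (n i) (sh i) y \<and>
      cycle (Suc i) (\<delta> i y) \<and> (i = 0 \<longrightarrow> map_compose (n 1) (D 0) y = \<gamma> 0)" for i y
  have \<delta>_hom: "homogeneous_map V (n (Suc i)) (sh (Suc i)) (n (Suc i)) (sh (Suc i)) (\<delta> i y)" if "P i y" for i y
  proof -
    have "homogeneous_map V (n (Suc i)) (sh (Suc i)) (n i) (sh i) y" using that by (simp add: P_def)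
    from homogeneous_map_diff[OF hom homogeneous_map_compose[OF this D_hom]]
    show ?thesis by (simp add: \<delta>_def)
  qed
  have "\<exists>h. \<forall>i. P i (h i) \<and> map_compose (n (Suc (Suc i))) (D (Suc i)) (h (Suc i)) = \<delta> i (h i)"
  proof (rule dependent_nat_choice)
    have "cycle 0 (\<gamma> 0)" using aug by simp
    from lift_map[OF hom this] obtain y where
      y: "homogeneous_map V (n 1) (sh 1) (n 0) (sh 0) y" "map_compose (n 1) (D 0) y = \<gamma> 0"
      by auto
    have "map_compose (n 1) (D 0) (\<delta> 0 y) = (\<lambda>s t. 0)"
      using chain[of 0] y(2) by (simp add: \<delta>_def compose_diff_right compose_assoc[symmetric])
    then have "P 0 y" using y by (simp add: P_def)
    then show "\<exists>y. P 0 y" by blast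
  next
    fix y i assume y: "P i y"
    have "cycle (Suc i) (\<delta> i y)" using y by (simp add: P_def)
    from lift_map[OF \<delta>_hom[OF y] this] obtain z where
      z: "homogeneous_map V (n (Suc (Suc i))) (sh (Suc (Suc i))) (n (Suc i)) (sh (Suc i)) z"
        "map_compose (n (Suc (Suc i))) (D (Suc i)) z = \<delta> i y" by blast
    have "map_compose (n (Suc (Suc i))) (D (Suc i)) (\<delta> (Suc i) z) =
        (\<lambda>s t. map_compose (n (Suc i)) (\<gamma> (Suc i)) (D (Suc i)) s t - map_compose (n (Suc i)) (\<delta> i y) (D (Suc i)) s t)"
      using chain[of "Suc i"] z(2) by (simp add: \<delta>_def[of "Suc i"] compose_diff_right compose_assoc[symmetric])
    also have "map_compose (n (Suc i)) (\<delta> i y) (D (Suc i)) = map_compose (n (Suc i)) (\<gamma> (Suc i)) (D (Suc i))"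
      by (simp add: \<delta>_def compose_diff_left compose_assoc D_D) (simp add: map_compose_def)
    finally have "P (Suc i) z" using z(1) by (simp add: P_def)
    then show "\<exists>z. P (Suc i) z \<and> map_compose (n (Suc (Suc i))) (D (Suc i)) z = \<delta> i y" using z(2) by blast
  qed
  then obtain h where "\<And>i. P i (h i)"
    "\<And>i. map_compose (n (Suc (Suc i))) (D (Suc i)) (h (Suc i)) = \<delta> i (h i)" by blast
  then show ?thesis unfolding \<delta>_def P_def by (intro exI[of _ h]) simp
qed

end

text \<open>Free modules are projective, so the maps can be chosen one degree after the other. The
  invariant \<open>P\<close> includes that \<open>y\<close> composed with \<open>DF i\<close> is a
  cycle, because the next choice depends on the current map only.\<close>

lemma chain_map_exists:
  fixes I :: "('v, 'k::field) mpoly set"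
  assumes F: "coordinate_resolution V I nF shF DF qF" and G: "coordinate_resolution V I nG shG DG qG"
  shows "\<exists>\<alpha>. (\<forall>i. homogeneous_map V (nG i) (shG i) (nF i) (shF i) (\<alpha> i)) \<and>
    (\<forall>t. (\<Sum>r<nG 0. qG r * \<alpha> 0 r t) - qF t \<in> I) \<and>
    (\<forall>i. map_compose (nG (Suc i)) (DG i) (\<alpha> (Suc i)) = map_compose (nF i) (\<alpha> i) (DF i))"
proof -
  interpret F: coordinate_resolution V I nF shF DF qF by (fact F)
  interpret G: coordinate_resolution V I nG shG DG qG by (fact G)
  define P where "P i y \<longleftrightarrow> homogeneous_map V (nG i) (shG i) (nF i) (shF i) y \<and>
      G.cycle i (map_compose (nF i) y (DF i)) \<and> (i = 0 \<longrightarrow> (\<forall>t. (\<Sum>r<nG 0. qG r * y r t) - qF t \<in> I))" for i y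
  have "\<exists>\<alpha>. \<forall>i. P i (\<alpha> i) \<and> map_compose (nG (Suc i)) (DG i) (\<alpha> (Suc i)) = map_compose (nF i) (\<alpha> i) (DF i)"
  proof (rule dependent_nat_choice)
    obtain y where y: "homogeneous_map V (nG 0) (shG 0) (nF 0) (shF 0) y"
      "\<And>t. (\<Sum>r<nG 0. qG r * y r t) - qF t \<in> I"
      using G.lift_row[of qF "shF 0" "nF 0", OF F.q_hom F.q_out] by blast
    have "(\<Sum>r<nG 0. qG r * map_compose (nF 0) y (DF 0) r t) \<in> I" for t
    proof -
      have "(\<Sum>r<nG 0. qG r * map_compose (nF 0) y (DF 0) r t) = (\<Sum>s<nF 0. (\<Sum>r<nG 0. qG r * y r s) * DF 0 s t)"
        unfolding map_compose_def sum_distrib_left sum_distrib_right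
        by (subst sum.swap) (simp add: mult.assoc)
      \<comment> \<open>\<open>qG\<close> after \<open>y\<close> agrees with \<open>qF\<close> only
        modulo \<open>I\<close>, so the error is split off as a summand of its own.\<close>
      also have "\<dots> = (\<Sum>s<nF 0. ((\<Sum>r<nG 0. qG r * y r s) - qF s) * DF 0 s t) + (\<Sum>s<nF 0. qF s * DF 0 s t)"
        by (simp add: sum.distrib[symmetric] distrib_right[symmetric])
      also have "\<dots> \<in> I"
        by (intro F.I_add F.I_sum F.I_times F.q_D y(2) homogeneous_map_carrier[OF F.D_hom])
      finally show ?thesis .
    qed
    then have "P 0 y" using y by (simp add: P_def)
    then show "\<exists>y. P 0 y" by blast
  next
    fix y i assume y: "P i y"
    have "homogeneous_map V (nG i) (shG i) (nF (Suc i)) (shF (Suc i)) (map_compose (nF i) y (DF i))"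
      using y F.D_hom by (auto simp: P_def intro: homogeneous_map_compose)
    then obtain z where z: "homogeneous_map V (nG (Suc i)) (shG (Suc i)) (nF (Suc i)) (shF (Suc i)) z"
        "map_compose (nG (Suc i)) (DG i) z = map_compose (nF i) y (DF i)"
      using G.lift_map y unfolding P_def by blast
    have "map_compose (nG (Suc i)) (DG i) (map_compose (nF (Suc i)) z (DF (Suc i))) =
        map_compose (nF i) y (map_compose (nF (Suc i)) (DF i) (DF (Suc i)))"
      by (simp add: compose_assoc[symmetric] z(2))
    then have "P (Suc i) z" using z(1) by (simp add: P_def F.D_D) (simp add: map_compose_def)
    then show "\<exists>z. P (Suc i) z \<and> map_compose (nG (Suc i)) (DG i) z = map_compose (nF i) y (DF i)"
      using z(2) by blast
  qed
  then obtain \<alpha> where "\<And>i. P i (\<alpha> i)"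
    "\<And>i. map_compose (nG (Suc i)) (DG i) (\<alpha> (Suc i)) = map_compose (nF i) (\<alpha> i) (DF i)" by blast
  then show ?thesis unfolding P_def by (intro exI[of _ \<alpha>]) simp
qed

text \<open>A chain map \<open>F \<rightarrow> G \<rightarrow> F\<close> over the identity is homotopic to the identity, hence equal to it
  modulo the variables when \<open>F\<close> is minimal. So \<open>F \<rightarrow> G\<close> has an entry with nonzero constant term in
  every column, and by homogeneity such an entry connects basis elements of the same degree.\<close>

theorem minimal_shift_occurs:
  fixes I :: "('v, 'k::field) mpoly set"
  assumes F: "coordinate_resolution V I nF shF DF qF" and G: "coordinate_resolution V I nG shG DG qG"
    and minimal: "\<And>i s t. lookup (DF i s t) 0 = 0"
    and t: "t < nF i"
  shows "\<exists>s<nG i. shG i s = shF i t"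
proof -
  interpret F: coordinate_resolution V I nF shF DF qF by (fact F)
  interpret G: coordinate_resolution V I nG shG DG qG by (fact G)
  obtain \<alpha> where \<alpha>: "\<And>i. homogeneous_map V (nG i) (shG i) (nF i) (shF i) (\<alpha> i)"
      "\<And>t. (\<Sum>r<nG 0. qG r * \<alpha> 0 r t) - qF t \<in> I"
      "\<And>i. map_compose (nG (Suc i)) (DG i) (\<alpha> (Suc i)) = map_compose (nF i) (\<alpha> i) (DF i)"
    using chain_map_exists[OF F G] by blast
  obtain \<beta> where \<beta>: "\<And>i. homogeneous_map V (nF i) (shF i) (nG i) (shG i) (\<beta> i)"
      "\<And>t. (\<Sum>r<nF 0. qF r * \<beta> 0 r t) - qG t \<in> I"
      "\<And>i. map_compose (nF (Suc i)) (DF i) (\<beta> (Suc i)) = map_compose (nG i) (\<beta> i) (DG i)"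
    using chain_map_exists[OF G F] by blast
  define \<gamma> where "\<gamma> i = (\<lambda>s t. map_compose (nG i) (\<beta> i) (\<alpha> i) s t - identity_map (nF i) s t)" for i
  have "\<exists>h. map_compose (nF 1) (DF 0) (h 0) = \<gamma> 0 \<and>
    (\<forall>i. map_compose (nF (Suc (Suc i))) (DF (Suc i)) (h (Suc i)) =
      (\<lambda>s t. \<gamma> (Suc i) s t - map_compose (nF i) (h i) (DF i) s t))"
  proof (rule F.null_homotopy)
    fix i
    show "homogeneous_map V (nF i) (shF i) (nF i) (shF i) (\<gamma> i)"
      unfolding \<gamma>_def
      by (rule homogeneous_map_diff[OF homogeneous_map_compose[OF \<beta>(1) \<alpha>(1)] homogeneous_map_identity])
    have "map_compose (nF (Suc i)) (DF i) (map_compose (nG (Suc i)) (\<beta> (Suc i)) (\<alpha> (Suc i))) =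
        map_compose (nF i) (map_compose (nG i) (\<beta> i) (\<alpha> i)) (DF i)"
    proof -
      have "map_compose (nF (Suc i)) (DF i) (map_compose (nG (Suc i)) (\<beta> (Suc i)) (\<alpha> (Suc i))) =
          map_compose (nG (Suc i)) (map_compose (nG i) (\<beta> i) (DG i)) (\<alpha> (Suc i))"
        by (simp only: compose_assoc[symmetric] \<beta>(3))
      also have "\<dots> = map_compose (nG i) (\<beta> i) (map_compose (nF i) (\<alpha> i) (DF i))"
        by (simp only: compose_assoc \<alpha>(3))
      finally show ?thesis by (simp only: compose_assoc)
    qed
    then show "map_compose (nF (Suc i)) (DF i) (\<gamma> (Suc i)) = map_compose (nF i) (\<gamma> i) (DF i)"
      by (simp add: \<gamma>_def compose_diff_left compose_diff_right
          compose_identity_left[OF F.D_hom] compose_identity_right[OF F.D_hom])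
  next
    fix t
    have id: "(\<Sum>r<nF 0. qF r * identity_map (nF 0) r t) = qF t"
    proof (cases "t < nF 0")
      case False
      then have "(\<Sum>r<nF 0. qF r * identity_map (nF 0) r t) = 0"
        by (intro sum.neutral) (auto simp: identity_map_def)
      then show ?thesis using F.q_out False by simp
    qed (rule sum_identity_map_right)
    have "(\<Sum>r<nF 0. qF r * \<gamma> 0 r t) =
        (\<Sum>r<nF 0. qF r * map_compose (nG 0) (\<beta> 0) (\<alpha> 0) r t) - qF t"
      by (simp add: \<gamma>_def right_diff_distrib sum_subtractf id)
    also have "(\<Sum>r<nF 0. qF r * map_compose (nG 0) (\<beta> 0) (\<alpha> 0) r t) =
        (\<Sum>s<nG 0. (\<Sum>r<nF 0. qF r * \<beta> 0 r s) * \<alpha> 0 s t)"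
      unfolding map_compose_def sum_distrib_left sum_distrib_right
      by (subst sum.swap) (simp add: mult.assoc)
    also have "\<dots> = (\<Sum>s<nG 0. ((\<Sum>r<nF 0. qF r * \<beta> 0 r s) - qG s) * \<alpha> 0 s t) + (\<Sum>s<nG 0. qG s * \<alpha> 0 s t)"
      by (simp add: sum.distrib[symmetric] distrib_right[symmetric])
    also have "\<dots> - qF t = (\<Sum>s<nG 0. ((\<Sum>r<nF 0. qF r * \<beta> 0 r s) - qG s) * \<alpha> 0 s t) +
        ((\<Sum>s<nG 0. qG s * \<alpha> 0 s t) - qF t)"
      by simp
    also have "\<dots> \<in> I"
      by (intro F.I_add F.I_sum F.I_times \<alpha>(2) \<beta>(2) homogeneous_map_carrier[OF \<alpha>(1)])
    finally show "(\<Sum>r<nF 0. qF r * \<gamma> 0 r t) \<in> I" .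
  qed
  then obtain h where h0: "map_compose (nF 1) (DF 0) (h 0) = \<gamma> 0"
    and hS: "\<And>i. map_compose (nF (Suc (Suc i))) (DF (Suc i)) (h (Suc i)) =
      (\<lambda>s t. \<gamma> (Suc i) s t - map_compose (nF i) (h i) (DF i) s t)" by blast
  \<comment> \<open>One factor without constant terms is enough. In the homotopy formula each
    summand has a differential of \<open>F\<close> as a factor, and these are minimal.\<close>
  have const: "lookup (map_compose m A B s t) 0 = 0"
    if "(\<forall>s t. lookup (A s t) 0 = 0) \<or> (\<forall>s t. lookup (B s t) 0 = 0)"
    for m and A B :: "nat \<Rightarrow> nat \<Rightarrow> ('v, 'k) mpoly" and s t
    using that by (auto simp: map_compose_def lookup_sum lookup_times_0)
  have "lookup (\<gamma> i t t) 0 = 0"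
  proof (cases i)
    case 0
    then show ?thesis using const minimal by (simp flip: h0)
  next
    case (Suc j)
    have "\<gamma> (Suc j) t t = map_compose (nF (Suc (Suc j))) (DF (Suc j)) (h (Suc j)) t t +
        map_compose (nF j) (h j) (DF j) t t"
      using hS[of j] by (simp add: fun_eq_iff)
    then show ?thesis using const minimal Suc by (simp add: lookup_add)
  qed
  then have "lookup (map_compose (nG i) (\<beta> i) (\<alpha> i) t t) 0 = 1"
    using t by (simp add: \<gamma>_def lookup_minus identity_map_def)
  then have "(\<Sum>s<nG i. lookup (\<beta> i t s) 0 * lookup (\<alpha> i s t) 0) \<noteq> 0"
    by (simp add: map_compose_def lookup_sum lookup_times_0)
  then obtain s where s: "s < nG i" "lookup (\<alpha> i s t) 0 \<noteq> 0"
    by (metis (no_types, lifting) lessThan_iff mult_zero_right sum.neutral)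
  then have "0 \<in> keys (\<alpha> i s t)" by (simp add: in_keys_iff)
  moreover have "\<alpha> i s t \<in> homogeneous_part V (shF i t - shG i s)"
    using \<alpha>(1)[of i] by (simp add: homogeneous_map_def)
  ultimately have "int (monomial_degree (0 :: 'v \<Rightarrow>\<^sub>0 nat)) = shF i t - shG i s"
    by (rule homogeneous_part_degree[rotated])
  then show ?thesis using s by (intro exI[of _ s]) (simp add: monomial_degree_def)
qed

section \<open>Translation between matrices and coordinate functions\<close>

definition entry :: "nat \<Rightarrow> nat \<Rightarrow> 'r::zero mat \<Rightarrow> nat \<Rightarrow> nat \<Rightarrow> 'r" where
  "entry m n A = (\<lambda>s t. if s < m \<and> t < n then A $$ (s, t) else 0)"

lemma vec_mem_free_vecs: "u \<in> free_functions V n \<Longrightarrow> vec n u \<in> free_vecs V n"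
  by (simp add: free_functions_def free_vecs_def)

lemma free_vecs_cases:
  assumes "v \<in> free_vecs V n"
  obtains u where "u \<in> free_functions V n" "v = vec n u"
proof
  show "(\<lambda>t. if t < n then v $ t else 0) \<in> free_functions V n"
    using assms by (simp add: free_functions_def free_vecs_def)
  show "v = vec n (\<lambda>t. if t < n then v $ t else 0)"
    using assms by (intro eq_vecI) (auto simp: free_vecs_def)
qed

lemma free_vecs_eq: "free_vecs V n = vec n ` free_functions V n"
  by (auto elim: free_vecs_cases intro: vec_mem_free_vecs)

lemma vec_eq_iff_free_functions:
  assumes "u \<in> free_functions V n" "u' \<in> free_functions V n"
  shows "vec n u = vec n u' \<longleftrightarrow> u = u'"
proof
  assume eq: "vec n u = vec n u'"
  show "u = u'"
  proof
    fix t show "u t = u' t"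
    proof (cases "t < n")
      case True
      then show ?thesis using arg_cong[OF eq, of "\<lambda>v. v $ t"] by simp
    qed (use assms in \<open>simp add: free_functions_def\<close>)
  qed
qed simp

lemma mult_mat_vec_vec:
  assumes "A \<in> carrier_mat m n"
  shows "A *\<^sub>v vec n w = vec m (\<lambda>s. \<Sum>t<n. entry m n A s t * w t)"
proof (rule eq_vecI)
  fix s assume "s < dim_vec (vec m (\<lambda>s. \<Sum>t<n. entry m n A s t * w t))"
  then show "(A *\<^sub>v vec n w) $ s = vec m (\<lambda>s. \<Sum>t<n. entry m n A s t * w t) $ s"
    using assms by (auto simp: scalar_prod_def entry_def lessThan_atLeast0 intro!: sum.cong)
qed (use assms in simp)

lemma mat_image_free_functions:
  assumes "\<And>s t. entry m n A s t \<in> carrier (polynomial_ring V)" "w \<in> free_functions V n"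
  shows "(\<lambda>s. \<Sum>t<n. entry m n A s t * w t) \<in> free_functions V m"
  unfolding free_functions_def
proof (intro CollectI conjI allI impI)
  fix s show "(\<Sum>t<n. entry m n A s t * w t) \<in> carrier (polynomial_ring V)"
    using assms by (intro carrier_sum carrier_times) (auto simp: free_functions_def)
qed (simp add: entry_def)

text \<open>The kernel is described by an arbitrary predicate \<open>Q\<close> so that exactness at
  the augmentation and at the later differentials are instances of one fact.\<close>

lemma kernel_eq_image_iff:
  assumes A: "A \<in> carrier_mat m n" and carrier: "\<And>s t. entry m n A s t \<in> carrier (polynomial_ring V)"
    and Q: "\<And>u. u \<in> free_functions V m \<Longrightarrow> Q (vec m u) \<longleftrightarrow> Q' u"
  shows "{v \<in> free_vecs V m. Q v} = (\<lambda>w. A *\<^sub>v w) ` free_vecs V n \<longleftrightarrow>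
    (\<forall>u\<in>free_functions V m. Q' u \<longleftrightarrow>
      (\<exists>w\<in>free_functions V n. u = (\<lambda>s. \<Sum>t<n. entry m n A s t * w t)))"
proof -
  have mem: "vec m u \<in> (\<lambda>w. A *\<^sub>v w) ` free_vecs V n \<longleftrightarrow>
      (\<exists>w\<in>free_functions V n. u = (\<lambda>s. \<Sum>t<n. entry m n A s t * w t))" if u: "u \<in> free_functions V m" for u
  proof
    assume "vec m u \<in> (\<lambda>w. A *\<^sub>v w) ` free_vecs V n"
    then obtain v where v: "v \<in> free_vecs V n" "vec m u = A *\<^sub>v v" by blast
    from v(1) obtain w where w: "w \<in> free_functions V n" "v = vec n w" by (rule free_vecs_cases)
    then have "vec m u = vec m (\<lambda>s. \<Sum>t<n. entry m n A s t * w t)"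
      using v A by (simp add: mult_mat_vec_vec)
    then have "u = (\<lambda>s. \<Sum>t<n. entry m n A s t * w t)"
      using vec_eq_iff_free_functions[OF u mat_image_free_functions[OF carrier w(1)]] by simp
    then show "\<exists>w\<in>free_functions V n. u = (\<lambda>s. \<Sum>t<n. entry m n A s t * w t)" using w by blast
  next
    assume "\<exists>w\<in>free_functions V n. u = (\<lambda>s. \<Sum>t<n. entry m n A s t * w t)"
    then obtain w where w: "w \<in> free_functions V n" "u = (\<lambda>s. \<Sum>t<n. entry m n A s t * w t)" by blast
    then have "vec m u = A *\<^sub>v vec n w" using A by (simp add: mult_mat_vec_vec)
    then show "vec m u \<in> (\<lambda>w. A *\<^sub>v w) ` free_vecs V n" using vec_mem_free_vecs[OF w(1)] by blast
  qed
  have sub: "(\<lambda>w. A *\<^sub>v w) ` free_vecs V n \<subseteq> free_vecs V m"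
  proof (intro image_subsetI)
    fix v :: "('a, 'b) mpoly vec" assume "v \<in> free_vecs V n"
    then obtain w where w: "w \<in> free_functions V n" "v = vec n w" by (rule free_vecs_cases)
    show "A *\<^sub>v v \<in> free_vecs V m"
      using vec_mem_free_vecs[OF mat_image_free_functions[OF carrier w(1)]] A w(2)
      by (simp add: mult_mat_vec_vec)
  qed
  have "{v \<in> free_vecs V m. Q v} = (\<lambda>w. A *\<^sub>v w) ` free_vecs V n \<longleftrightarrow>
      (\<forall>v\<in>free_vecs V m. Q v \<longleftrightarrow> v \<in> (\<lambda>w. A *\<^sub>v w) ` free_vecs V n)"
    using sub by blast
  also have "\<dots> \<longleftrightarrow> (\<forall>u\<in>free_functions V m. Q (vec m u) \<longleftrightarrow> vec m u \<in> (\<lambda>w. A *\<^sub>v w) ` free_vecs V n)"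
    unfolding free_vecs_eq[of V m] by (simp only: ball_simps)
  also have "\<dots> \<longleftrightarrow> (\<forall>u\<in>free_functions V m. Q' u \<longleftrightarrow>
      (\<exists>w\<in>free_functions V n. u = (\<lambda>s. \<Sum>t<n. entry m n A s t * w t)))"
    by (intro ball_cong refl) (simp only: Q mem)
  finally show ?thesis .
qed

section \<open>The quotient module and its graded free resolutions\<close>

context graded_ideal
begin

abbreviation M where "M \<equiv> quotient_module (polynomial_ring V) I"
abbreviation coset where "coset p \<equiv> I +>\<^bsub>polynomial_ring V\<^esub> p"

lemma carrier_M: "carrier M = coset ` carrier (polynomial_ring V)"
  by (auto simp: quotient_module_def FactRing_def A_RCOSETS_def' )

lemma coset_eq_iff:
  assumes "p \<in> carrier (polynomial_ring V)" "q \<in> carrier (polynomial_ring V)"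
  shows "coset p = coset q \<longleftrightarrow> p - q \<in> I"
proof -
  interpret cring "polynomial_ring V" by (rule cring_polynomial_ring)
  show ?thesis
    using quotient_eq_iff_same_a_r_cos[OF ideal_I assms] assms by (simp add: a_minus_polynomial_ring)
qed

lemma zero_M: "zero M = coset 0"
proof -
  interpret ideal I "polynomial_ring V" by (rule ideal_I)
  show ?thesis
    using a_rcos_zero[OF ideal_I I_zero] by (simp add: quotient_module_def FactRing_def)
qed

lemma add_M:
  assumes "p \<in> carrier (polynomial_ring V)" "q \<in> carrier (polynomial_ring V)"
  shows "coset p \<oplus>\<^bsub>M\<^esub> coset q = coset (p + q)"
proof -
  interpret ideal I "polynomial_ring V" by (rule ideal_I)
  show ?thesis using a_rcos_sum[OF assms] by (simp add: quotient_module_def FactRing_def)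
qed

lemma smult_M:
  assumes "r \<in> carrier (polynomial_ring V)" "p \<in> carrier (polynomial_ring V)"
  shows "r \<odot>\<^bsub>M\<^esub> coset p = coset (r * p)"
proof -
  interpret ideal I "polynomial_ring V" by (rule ideal_I)
  show ?thesis using rcoset_mult_add[OF assms] by (simp add: quotient_module_def FactRing_def)
qed

lemma abelian_monoid_M: "abelian_monoid M"
proof -
  interpret ideal I "polynomial_ring V" by (rule ideal_I)
  interpret Q: ring "polynomial_ring V Quot I" by (rule quotient_is_ring)
  show ?thesis
    by (intro abelian_monoidI) (simp_all add: quotient_module_def Q.a_ac)
qed

lemma finsum_M:
  assumes "finite A" "\<And>t. t \<in> A \<Longrightarrow> f t \<in> carrier (polynomial_ring V)"
  shows "(\<Oplus>\<^bsub>M\<^esub>t\<in>A. coset (f t)) = coset (\<Sum>t\<in>A. f t)"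
  using assms
proof (induction A rule: finite_induct)
  case empty
  interpret M: abelian_monoid M by (rule abelian_monoid_M)
  show ?case by (simp add: zero_M)
next
  case (insert x A)
  interpret M: abelian_monoid M by (rule abelian_monoid_M)
  have "(\<Oplus>\<^bsub>M\<^esub>t\<in>insert x A. coset (f t)) = coset (f x) \<oplus>\<^bsub>M\<^esub> (\<Oplus>\<^bsub>M\<^esub>t\<in>A. coset (f t))"
    using insert by (intro M.finsum_insert) (auto simp: carrier_M)
  then show ?case using insert by (simp add: add_M carrier_sum)
qed

lemma aug_map_vec:
  assumes aug: "\<And>t. t < rnk F 0 \<Longrightarrow> aug F t = coset (q t)"
    and q: "\<And>t. q t \<in> carrier (polynomial_ring V)" and u: "u \<in> free_functions V (rnk F 0)"
  shows "aug_map M F (vec (rnk F 0) u) = coset (\<Sum>t<rnk F 0. q t * u t)"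
proof -
  interpret M: abelian_monoid M by (rule abelian_monoid_M)
  have u': "u t \<in> carrier (polynomial_ring V)" for t using u by (simp add: free_functions_def)
  have "aug_map M F (vec (rnk F 0) u) = (\<Oplus>\<^bsub>M\<^esub>t\<in>{..<rnk F 0}. coset (q t * u t))"
    unfolding aug_map_def
    by (intro M.finsum_cong' refl)
      (auto simp: aug smult_M[OF u' q] carrier_M carrier_times q u' mult.commute)
  then show ?thesis using finsum_M[of "{..<rnk F 0}" "\<lambda>t. q t * u t"] by (simp add: carrier_times q u')
qed

text \<open>These are equivalences because the translation is needed both ways: to analyse a given
  \<open>graded_free_resolution\<close> and to produce one from coordinates.\<close>

lemma exactness_iff:
  assumes dim: "\<And>i. diff F i \<in> carrier_mat (rnk F i) (rnk F (Suc i))"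
    and D: "\<And>i s t. entry (rnk F i) (rnk F (Suc i)) (diff F i) s t \<in> carrier (polynomial_ring V)"
    and aug_q: "\<forall>t<rnk F 0. aug F t = coset (q t)"
    and q: "\<And>t. q t \<in> carrier (polynomial_ring V)"
  shows "aug_map M F ` free_vecs V (rnk F 0) = carrier M \<longleftrightarrow>
      (\<forall>p\<in>carrier (polynomial_ring V). \<exists>u\<in>free_functions V (rnk F 0). (\<Sum>t<rnk F 0. q t * u t) - p \<in> I)"
    (is ?surj)
  and "{u \<in> free_vecs V (rnk F 0). aug_map M F u = \<zero>\<^bsub>M\<^esub>} = (\<lambda>w. diff F 0 *\<^sub>v w) ` free_vecs V (rnk F 1) \<longleftrightarrow>
      (\<forall>u\<in>free_functions V (rnk F 0). (\<Sum>t<rnk F 0. q t * u t) \<in> I \<longleftrightarrow>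
        (\<exists>w\<in>free_functions V (rnk F 1). u = (\<lambda>s. \<Sum>t<rnk F 1. entry (rnk F 0) (rnk F 1) (diff F 0) s t * w t)))"
    (is ?aug)
  and "{u \<in> free_vecs V (rnk F (Suc i)). diff F i *\<^sub>v u = 0\<^sub>v (rnk F i)} =
        (\<lambda>w. diff F (Suc i) *\<^sub>v w) ` free_vecs V (rnk F (Suc (Suc i))) \<longleftrightarrow>
      (\<forall>u\<in>free_functions V (rnk F (Suc i)).
        (\<forall>s. (\<Sum>t<rnk F (Suc i). entry (rnk F i) (rnk F (Suc i)) (diff F i) s t * u t) = 0) \<longleftrightarrow>
        (\<exists>w\<in>free_functions V (rnk F (Suc (Suc i))). u = (\<lambda>s. \<Sum>t<rnk F (Suc (Suc i)).
          entry (rnk F (Suc i)) (rnk F (Suc (Suc i))) (diff F (Suc i)) s t * w t)))"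
    (is ?diff)
proof -
  have aug: "\<And>t. t < rnk F 0 \<Longrightarrow> aug F t = coset (q t)" using aug_q by blast
  have row: "(\<Sum>t<rnk F 0. q t * u t) \<in> carrier (polynomial_ring V)" if "u \<in> free_functions V (rnk F 0)" for u
    using that q by (intro carrier_sum carrier_times) (auto simp: free_functions_def)
  have image: "aug_map M F ` free_vecs V (rnk F 0) =
      (\<lambda>u. coset (\<Sum>t<rnk F 0. q t * u t)) ` free_functions V (rnk F 0)"
    unfolding free_vecs_eq image_image
    by (intro image_cong refl aug_map_vec) (simp_all add: aug q)
  have "aug_map M F ` free_vecs V (rnk F 0) \<subseteq> carrier M"
    unfolding image carrier_M using row by blast
  then have "aug_map M F ` free_vecs V (rnk F 0) = carrier M \<longleftrightarrow>
      (\<forall>p\<in>carrier (polynomial_ring V). coset p \<in> aug_map M F ` free_vecs V (rnk F 0))"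
    unfolding carrier_M by blast
  also have "\<dots> \<longleftrightarrow> (\<forall>p\<in>carrier (polynomial_ring V).
      \<exists>u\<in>free_functions V (rnk F 0). coset p = coset (\<Sum>t<rnk F 0. q t * u t))"
    by (simp only: image image_iff)
  also have "\<dots> \<longleftrightarrow> (\<forall>p\<in>carrier (polynomial_ring V).
      \<exists>u\<in>free_functions V (rnk F 0). (\<Sum>t<rnk F 0. q t * u t) - p \<in> I)"
  proof (intro ball_cong bex_cong refl)
    fix p :: "('v, 'k) mpoly" and u :: "nat \<Rightarrow> ('v, 'k) mpoly"
    assume p: "p \<in> carrier (polynomial_ring V)" and u: "u \<in> free_functions V (rnk F 0)"
    show "coset p = coset (\<Sum>t<rnk F 0. q t * u t) \<longleftrightarrow> (\<Sum>t<rnk F 0. q t * u t) - p \<in> I"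
      using coset_eq_iff[OF row[OF u] p] by auto
  qed
  finally show ?surj .
  have "aug_map M F (vec (rnk F 0) u) = \<zero>\<^bsub>M\<^esub> \<longleftrightarrow> (\<Sum>t<rnk F 0. q t * u t) \<in> I"
    if u: "u \<in> free_functions V (rnk F 0)" for u
    using aug_map_vec[OF aug q u] coset_eq_iff[OF row[OF u] carrier_zero] by (simp add: zero_M)
  then show ?aug
    using kernel_eq_image_iff[OF dim[of 0, folded One_nat_def] D[of 0, folded One_nat_def]] by simp
  have "diff F i *\<^sub>v vec (rnk F (Suc i)) u = 0\<^sub>v (rnk F i) \<longleftrightarrow>
      (\<forall>s. (\<Sum>t<rnk F (Suc i). entry (rnk F i) (rnk F (Suc i)) (diff F i) s t * u t) = 0)"
    if u: "u \<in> free_functions V (rnk F (Suc i))" for u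
  proof -
    have zero: "0\<^sub>v (rnk F i) = vec (rnk F i) (\<lambda>_. 0)" by auto
    have "(\<lambda>_. 0) \<in> free_functions V (rnk F i)" by (simp add: free_functions_def)
    then show ?thesis
      unfolding mult_mat_vec_vec[OF dim] zero
      by (subst vec_eq_iff_free_functions[OF mat_image_free_functions[OF D u]]) (auto simp: fun_eq_iff)
  qed
  then show ?diff by (rule kernel_eq_image_iff[OF dim D])
qed

lemma coordinate_resolution_of_graded:
  assumes "graded_free_resolution V M (quotient_grading V I) F"
  shows "\<exists>q. coordinate_resolution V I (rnk F) (shift F) (\<lambda>i. entry (rnk F i) (rnk F (Suc i)) (diff F i)) q"
proof -
  note F = assms[unfolded graded_free_resolution_def]
  note aug = F[THEN conjunct1, rule_format]
  note dim = F[THEN conjunct2, THEN conjunct1, rule_format]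
  note D = F[THEN conjunct2, THEN conjunct2, THEN conjunct1, rule_format]
  note surj = F[THEN conjunct2, THEN conjunct2, THEN conjunct2, THEN conjunct1]
  note aug_exact = F[THEN conjunct2, THEN conjunct2, THEN conjunct2, THEN conjunct2, THEN conjunct1]
  note D_exact = F[THEN conjunct2, THEN conjunct2, THEN conjunct2, THEN conjunct2, THEN conjunct2, rule_format]
  \<comment> \<open>Homogeneous representatives exist since \<open>quotient_grading\<close> consists
    of images of homogeneous polynomials; beyond the rank the value 0 is taken.\<close>
  have "\<exists>p. (t < rnk F 0 \<longrightarrow> aug F t = coset p) \<and> (t \<ge> rnk F 0 \<longrightarrow> p = 0) \<and>
      p \<in> homogeneous_part V (shift F 0 t)" for t
    using aug[of t] homogeneous_part_zero by (cases "t < rnk F 0") (auto simp: quotient_grading_def)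
  then obtain q where q: "\<And>t. t < rnk F 0 \<Longrightarrow> aug F t = coset (q t)" "\<And>t. t \<ge> rnk F 0 \<Longrightarrow> q t = 0"
    "\<And>t. q t \<in> homogeneous_part V (shift F 0 t)"
    by metis
  have hom: "homogeneous_map V (rnk F i) (shift F i) (rnk F (Suc i)) (shift F (Suc i))
      (entry (rnk F i) (rnk F (Suc i)) (diff F i))" for i
    using D by (auto simp: homogeneous_map_def entry_def)
  have aug_q: "\<forall>t<rnk F 0. aug F t = coset (q t)" using q(1) by blast
  note iff = exactness_iff[OF dim homogeneous_map_carrier[OF hom] aug_q homogeneous_part_carrier[OF q(3)]]
  have "coordinate_resolution V I (rnk F) (shift F) (\<lambda>i. entry (rnk F i) (rnk F (Suc i)) (diff F i)) q"
  proof unfold_locales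
    fix p :: "('v, 'k) mpoly" assume "p \<in> carrier (polynomial_ring V)"
    then show "\<exists>u\<in>free_functions V (rnk F 0). (\<Sum>t<rnk F 0. q t * u t) - p \<in> I"
      by (rule surj[unfolded iff(1), rule_format])
  next
    fix u :: "nat \<Rightarrow> ('v, 'k) mpoly" assume "u \<in> free_functions V (rnk F 0)"
    then show "(\<Sum>t<rnk F 0. q t * u t) \<in> I \<longleftrightarrow> (\<exists>w\<in>free_functions V (rnk F 1).
        u = (\<lambda>s. \<Sum>t<rnk F 1. entry (rnk F 0) (rnk F (Suc 0)) (diff F 0) s t * w t))"
      using aug_exact[unfolded iff(2), THEN bspec] by simp
  next
    fix u :: "nat \<Rightarrow> ('v, 'k) mpoly" and i assume "u \<in> free_functions V (rnk F (Suc i))"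
    then show "(\<forall>s. (\<Sum>t<rnk F (Suc i). entry (rnk F i) (rnk F (Suc i)) (diff F i) s t * u t) = 0) \<longleftrightarrow>
        (\<exists>w\<in>free_functions V (rnk F (Suc (Suc i))). u = (\<lambda>s. \<Sum>t<rnk F (Suc (Suc i)).
          entry (rnk F (Suc i)) (rnk F (Suc (Suc i))) (diff F (Suc i)) s t * w t))"
      by (rule D_exact[of i, unfolded iff(3), THEN bspec])
  qed (use hom q in auto)
  then show ?thesis by (rule exI[of _ q])
qed

lemma graded_of_coordinate_resolution:
  assumes "coordinate_resolution V I n sh D q"
  shows "graded_free_resolution V M (quotient_grading V I)
    \<lparr>rnk = n, shift = sh, diff = \<lambda>i. mat (n i) (n (Suc i)) (\<lambda>(s, t). D i s t), aug = \<lambda>t. coset (q t)\<rparr>"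
    (is "graded_free_resolution V M _ ?F")
proof -
  interpret coordinate_resolution V I n sh D q by (fact assms)
  have entry: "entry (n i) (n (Suc i)) (diff ?F i) = D i" for i
    using D_hom[of i] by (auto simp: entry_def homogeneous_map_def fun_eq_iff)
  have carrier: "entry (rnk ?F i) (rnk ?F (Suc i)) (diff ?F i) s t \<in> carrier (polynomial_ring V)" for i s t
    using homogeneous_map_carrier[OF D_hom] entry by simp
  have dim: "diff ?F i \<in> carrier_mat (rnk ?F i) (rnk ?F (Suc i))" for i by simp
  have aug: "\<forall>t<rnk ?F 0. aug ?F t = coset (q t)" by simp
  note iff = exactness_iff[OF dim carrier aug homogeneous_part_carrier[OF q_hom]]
  show ?thesis
    unfolding graded_free_resolution_def
  proof (intro conjI allI impI)
    show "aug_map M ?F ` free_vecs V (rnk ?F 0) = carrier M"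
      unfolding iff using q_surj by simp
    show "{u \<in> free_vecs V (rnk ?F 0). aug_map M ?F u = \<zero>\<^bsub>M\<^esub>} = (*\<^sub>v) (diff ?F 0) ` free_vecs V (rnk ?F 1)"
      unfolding iff using q_exact entry[of 0] by simp
    fix i
    show "{u \<in> free_vecs V (rnk ?F (Suc i)). diff ?F i *\<^sub>v u = 0\<^sub>v (rnk ?F i)} =
        (*\<^sub>v) (diff ?F (Suc i)) ` free_vecs V (rnk ?F (Suc (Suc i)))"
      unfolding iff using D_exact[of _ i] entry[of i] entry[of "Suc i"] by simp
  qed (use D_hom q_hom in \<open>auto simp: homogeneous_map_def quotient_grading_def\<close>)
qed

end

section \<open>From squarefree resolutions to graded free resolutions\<close>

definition squarefree_monomial :: "'v set \<Rightarrow> 'v \<Rightarrow>\<^sub>0 nat" where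
  "squarefree_monomial W = (\<Sum>x\<in>W. single x 1)"

lemma lookup_squarefree_monomial:
  "finite W \<Longrightarrow> lookup (squarefree_monomial W) x = (if x \<in> W then 1 else 0)"
  by (simp add: squarefree_monomial_def lookup_sum lookup_single when_def)

lemma keys_squarefree_monomial: "finite W \<Longrightarrow> keys (squarefree_monomial W) = W"
  by (auto simp: in_keys_iff lookup_squarefree_monomial split: if_splits)

lemma monomial_degree_squarefree_monomial: "finite W \<Longrightarrow> monomial_degree (squarefree_monomial W) = card W"
  by (simp add: monomial_degree_def keys_squarefree_monomial lookup_squarefree_monomial)

lemma squarefree_monomial_add_diff:
  assumes "finite U" "W \<subseteq> U"
  shows "squarefree_monomial W + squarefree_monomial (U - W) = squarefree_monomial U"
  using assms finite_subset[OF assms(2,1)]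
  by (intro poly_mapping_eqI) (auto simp: lookup_add lookup_squarefree_monomial)

lemma squarefree_monomial_add_minus:
  assumes "finite W" "W \<subseteq> keys m"
  shows "squarefree_monomial W + (m - squarefree_monomial W) = m"
proof (rule poly_mapping_eqI)
  fix x
  show "lookup (squarefree_monomial W + (m - squarefree_monomial W)) x = lookup m x"
    using assms by (auto simp: lookup_add lookup_minus lookup_squarefree_monomial in_keys_iff)
qed

lemma keys_minus_subset: "keys (m - n :: 'v \<Rightarrow>\<^sub>0 nat) \<subseteq> keys m"
  by (auto simp: in_keys_iff lookup_minus)

text \<open>Free modules over the ring have numbered coordinates, a squarefree basis has none:
  \<open>e i\<close> lists its elements of degree \<open>i\<close>, and \<open>g i\<close> inverts
  the list.\<close>

locale enumerated_resolution = squarefree_resolution V P B deg lab d a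
  for V :: "'v set" and P B deg and lab :: "'b \<Rightarrow> 'v set" and d :: "'b \<Rightarrow> 'b \<Rightarrow> 'k::field" and a +
  fixes n :: "nat \<Rightarrow> nat" and e :: "nat \<Rightarrow> nat \<Rightarrow> 'b" and g :: "nat \<Rightarrow> 'b \<Rightarrow> nat"
  assumes finite_V: "finite V"
    and e_mem: "t < n i \<Longrightarrow> e i t \<in> B \<and> deg (e i t) = i \<and> g i (e i t) = t"
    and g_mem: "b \<in> B \<Longrightarrow> deg b = i \<Longrightarrow> g i b < n i \<and> e i (g i b) = b"
begin

lemma finite_lab: "b \<in> B \<Longrightarrow> finite (lab b)"
  using lab_subset finite_V finite_subset by blast

lemma sum_enumerate: "(\<Sum>t<n i. f (e i t)) = (\<Sum>b\<in>{b \<in> B. deg b = i}. f b)"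
  by (rule sum.reindex_bij_witness[of _ "g i" "e i"]) (auto simp: e_mem g_mem)

definition basis_monomial :: "'b \<Rightarrow> ('v, 'k) mpoly" where
  "basis_monomial b = single (squarefree_monomial (lab b)) 1"

text \<open>The homogenization of \<open>d\<close>: the monomial fills the gap between the two
  labels, so the sizes of the labels become the shifts.\<close>

definition diff_map :: "nat \<Rightarrow> nat \<Rightarrow> nat \<Rightarrow> ('v, 'k) mpoly" where
  "diff_map i s t = (if s < n i \<and> t < n (Suc i)
    then single (squarefree_monomial (lab (e (Suc i) t) - lab (e i s))) (d (e i s) (e (Suc i) t)) else 0)"

definition aug_row :: "nat \<Rightarrow> ('v, 'k) mpoly" where
  "aug_row t = (if t < n 0 then single (squarefree_monomial (lab (e 0 t))) (a (e 0 t)) else 0)"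

text \<open>The component of \<open>u \<in> F\<^sub>i\<close> in the multidegree of \<open>m\<close>. Multiplying by the monomial of the label
  makes the differential act by the scalars \<open>d\<close>.\<close>

definition strand :: "nat \<Rightarrow> (nat \<Rightarrow> ('v, 'k) mpoly) \<Rightarrow> ('v \<Rightarrow>\<^sub>0 nat) \<Rightarrow> 'b \<Rightarrow> 'k" where
  "strand i u m b = (if b \<in> B \<and> deg b = i then lookup (basis_monomial b * u (g i b)) m else 0)"

lemma basis_monomial_diff_map:
  assumes "s < n i" "t < n (Suc i)"
  shows "basis_monomial (e i s) * diff_map i s t = single 0 (d (e i s) (e (Suc i) t)) * basis_monomial (e (Suc i) t)"
proof (cases "d (e i s) (e (Suc i) t) = 0")
  case False
  then have "lab (e i s) \<subseteq> lab (e (Suc i) t)" "finite (lab (e (Suc i) t))"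
    using d_nonzero e_mem[OF assms(2)] finite_lab by auto
  then show ?thesis
    using assms by (simp add: basis_monomial_def diff_map_def mult_single squarefree_monomial_add_diff)
qed (use assms in \<open>simp add: diff_map_def\<close>)

lemma lookup_const_times:
  fixes p :: "('v, 'k) mpoly"
  shows "lookup (single 0 c * p) m = c * lookup p m"
  using lookup_single_times_add[of 0 c p m] by simp

text \<open>A nonzero coefficient requires the monomial of the label to divide \<open>m\<close>. As
  labels are squarefree, this depends on the support of \<open>m\<close> alone, so the chain in
  multidegree \<open>m\<close> belongs to the strand over \<open>keys m\<close>.\<close>

lemma strand_nonzero:
  assumes "strand i u m b \<noteq> 0"
  shows "b \<in> B \<and> deg b = i \<and> lab b \<subseteq> keys m"
proof -
  have b: "b \<in> B" "deg b = i" "lookup (basis_monomial b * u (g i b)) m \<noteq> 0"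
    using assms by (auto simp: strand_def split: if_splits)
  then obtain k where "m = squarefree_monomial (lab b) + k"
    unfolding basis_monomial_def using lookup_single_times_eq_0 by blast
  then show ?thesis using b by (simp add: keys_monomial_add keys_squarefree_monomial[OF finite_lab])
qed

lemma strand_zero: "strand i (\<lambda>_. 0) m b = 0"
  by (simp add: strand_def)

lemma strand_subset_V:
  assumes u: "u \<in> free_functions V k" and nz: "strand i u m b \<noteq> 0"
  shows "keys m \<subseteq> V"
proof -
  have b: "b \<in> B" "lookup (basis_monomial b * u (g i b)) m \<noteq> 0"
    using nz by (auto simp: strand_def split: if_splits)
  have "basis_monomial b \<in> carrier (polynomial_ring V)"
    unfolding basis_monomial_def using b lab_subset by (intro carrier_single) (simp add: keys_squarefree_monomial finite_lab)
  then have "basis_monomial b * u (g i b) \<in> carrier (polynomial_ring V)"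
    using u by (intro carrier_times) (auto simp: free_functions_def)
  then show ?thesis using b by (auto simp: carrier_polynomial_ring_iff in_keys_iff)
qed

lemma strand_diff_map:
  "strand i (\<lambda>s. \<Sum>t<n (Suc i). diff_map i s t * w t) m b = (\<Sum>t\<in>B. d b t * strand (Suc i) w m t)"
proof (cases "b \<in> B \<and> deg b = i")
  case True
  define s where "s = g i b"
  have s: "s < n i" "e i s = b" using g_mem True by (auto simp: s_def)
  have "basis_monomial b * (diff_map i s t * w t) = single 0 (d b (e (Suc i) t)) * (basis_monomial (e (Suc i) t) * w t)"
    if "t < n (Suc i)" for t
    using arg_cong[OF basis_monomial_diff_map[OF s(1) that], of "\<lambda>p. p * w t"] s(2)
    by (simp add: mult.assoc)
  then have "strand i (\<lambda>s. \<Sum>t<n (Suc i). diff_map i s t * w t) m b =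
      (\<Sum>t<n (Suc i). d b (e (Suc i) t) * lookup (basis_monomial (e (Suc i) t) * w t) m)"
    using True by (simp add: strand_def s_def[symmetric] sum_distrib_left lookup_sum lookup_const_times)
  also have "\<dots> = (\<Sum>t<n (Suc i). d b (e (Suc i) t) * strand (Suc i) w m (e (Suc i) t))"
    by (intro sum.cong) (auto simp: strand_def e_mem)
  also have "\<dots> = (\<Sum>t\<in>{t \<in> B. deg t = Suc i}. d b t * strand (Suc i) w m t)"
    by (rule sum_enumerate[of "\<lambda>t. d b t * strand (Suc i) w m t"])
  also have "\<dots> = (\<Sum>t\<in>B. d b t * strand (Suc i) w m t)"
    using finite_B by (intro sum.mono_neutral_left) (auto simp: strand_def)
  finally show ?thesis .
next
  case False
  have "d b t * strand (Suc i) w m t = 0" for t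
    using d_nonzero[of b t] False by (cases "d b t = 0") (auto simp: strand_def)
  then have "(\<Sum>t\<in>B. d b t * strand (Suc i) w m t) = 0" by (intro sum.neutral ballI)
  moreover have "strand i (\<lambda>s. \<Sum>t<n (Suc i). diff_map i s t * w t) m b = 0"
    using False by (auto simp: strand_def)
  ultimately show ?thesis by simp
qed

lemma strand_inject:
  assumes u: "u \<in> free_functions V (n i)" and u': "u' \<in> free_functions V (n i)"
    and eq: "\<And>m b. strand i u m b = strand i u' m b"
  shows "u = u'"
proof
  fix t
  show "u t = u' t"
  proof (cases "t < n i")
    case True
    show ?thesis
    proof (rule poly_mapping_eqI)
      fix m
      have "lookup (basis_monomial (e i t) * u t) (squarefree_monomial (lab (e i t)) + m) =
          lookup (basis_monomial (e i t) * u' t) (squarefree_monomial (lab (e i t)) + m)"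
        using eq[of "squarefree_monomial (lab (e i t)) + m" "e i t"] e_mem[OF True]
        by (simp add: strand_def)
      then show "lookup (u t) m = lookup (u' t) m"
        by (simp add: basis_monomial_def lookup_single_times_add)
    qed
  next
    case False
    then show ?thesis using u u' by (simp add: free_functions_def)
  qed
qed

text \<open>Together with \<open>strand_inject\<close> this shows that an element of the free module
  is the same thing as a family of chains, one per multidegree. Finiteness of \<open>S\<close>,
  which collects the multidegrees that occur, makes the entries polynomials.\<close>

lemma strand_surj:
  assumes W: "\<And>m b. W m b \<noteq> 0 \<Longrightarrow> b \<in> B \<and> deg b = i \<and> lab b \<subseteq> keys m \<and> keys m \<subseteq> V \<and> m \<in> S"
    and S: "finite S"
  shows "\<exists>w\<in>free_functions V (n i). \<forall>m b. strand i w m b = W m b"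
proof -
  define w where "w t = (if t < n i then
      \<Sum>m\<in>S. single (m - squarefree_monomial (lab (e i t))) (W m (e i t)) else 0)" for t
  have "w t \<in> carrier (polynomial_ring V)" for t
  proof -
    have "single (m - squarefree_monomial (lab (e i t))) (W m (e i t)) \<in> carrier (polynomial_ring V)" for m
    proof (cases "W m (e i t) = 0")
      case False
      then have "keys m \<subseteq> V" using W by blast
      then show ?thesis using keys_minus_subset[of m] by (intro carrier_single) blast
    qed simp
    then show ?thesis by (simp add: w_def carrier_sum)
  qed
  then have "w \<in> free_functions V (n i)" by (simp add: free_functions_def w_def)
  moreover have "strand i w m b = W m b" for m b
  proof (cases "b \<in> B \<and> deg b = i")
    case True
    define t where "t = g i b"
    have t: "t < n i" "e i t = b" using True g_mem by (auto simp: t_def)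
    have "basis_monomial b * single (k - squarefree_monomial (lab b)) (W k b) = single k (W k b)" for k
      using W[of k b] finite_lab True
      by (cases "W k b = 0") (auto simp: basis_monomial_def mult_single squarefree_monomial_add_minus)
    then have "basis_monomial b * w t = (\<Sum>k\<in>S. single k (W k b))"
      using t by (simp add: w_def sum_distrib_left)
    then have "strand i w m b = (\<Sum>k\<in>S. lookup (single k (W k b)) m)"
      using True by (simp add: strand_def t_def[symmetric] lookup_sum)
    also have "\<dots> = W m b"
      using W[of m b] S by (auto simp: lookup_single when_def)
    finally show ?thesis .
  next
    case False
    then show ?thesis using W[of m b] by (auto simp: strand_def)
  qed
  ultimately show ?thesis by blast
qed

lemma diff_map_carrier: "diff_map i s t \<in> carrier (polynomial_ring V)"
proof (cases "s < n i \<and> t < n (Suc i)")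
  case True
  then have "e (Suc i) t \<in> B" using e_mem by blast
  then have "finite (lab (e (Suc i) t))" "lab (e (Suc i) t) \<subseteq> V" using finite_lab lab_subset by blast+
  then show ?thesis using True
    by (simp add: diff_map_def) (intro carrier_single, auto simp: keys_squarefree_monomial)
qed (auto simp: diff_map_def)

lemma diff_map_image: "w \<in> free_functions V k \<Longrightarrow>
    (\<lambda>s. \<Sum>t<n (Suc i). diff_map i s t * w t) \<in> free_functions V (n i)"
  unfolding free_functions_def
proof (intro CollectI conjI allI impI)
  fix s assume "w \<in> {u. (\<forall>t. u t \<in> carrier (polynomial_ring V)) \<and> (\<forall>t\<ge>k. u t = 0)}"
  then show "(\<Sum>t<n (Suc i). diff_map i s t * w t) \<in> carrier (polynomial_ring V)"
    by (intro carrier_sum carrier_times diff_map_carrier) simp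
qed (simp add: diff_map_def)

text \<open>The equation is solved in every multidegree \<open>m\<close> separately, inside the
  strand over \<open>keys m\<close>. Where \<open>u\<close> has no component the solution is set to
  0, so only finitely many parts are nonzero.\<close>

lemma strand_exact:
  assumes u: "u \<in> free_functions V (n i)"
    and du: "\<And>m s. (\<Sum>t\<in>B. d s t * strand i u m t) = 0"
    and au: "\<And>m. keys m \<subseteq> V \<Longrightarrow> P (keys m) \<Longrightarrow> (\<Sum>t\<in>B. a t * strand i u m t) = 0"
  shows "\<exists>w\<in>free_functions V (n (Suc i)). u = (\<lambda>s. \<Sum>t<n (Suc i). diff_map i s t * w t)"
proof -
  define S where "S = {m. \<exists>b. strand i u m b \<noteq> 0}"
  have "S \<subseteq> (\<Union>b\<in>B. keys (basis_monomial b * u (g i b)))"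
    by (auto simp: S_def strand_def in_keys_iff split: if_splits)
  then have "finite S" using finite_B by (meson finite_UN finite_keys finite_subset)
  have "\<exists>w. (\<forall>b. w b \<noteq> 0 \<longrightarrow> b \<in> B \<and> deg b = Suc i \<and> lab b \<subseteq> keys m \<and> keys m \<subseteq> V \<and> m \<in> S) \<and>
      (\<forall>s. strand i u m s = (\<Sum>t\<in>B. d s t * w t))" for m
  proof (cases "m \<in> S")
    case False
    then show ?thesis by (intro exI[of _ "\<lambda>_. 0"]) (auto simp: S_def)
  next
    case True
    then have V: "keys m \<subseteq> V" using strand_subset_V[OF u] by (auto simp: S_def)
    have "supported_on B lab (keys m) (strand i u m)"
      using strand_nonzero by (auto simp: supported_on_def)
    then obtain w where w: "supported_on B lab (keys m) w" "\<And>s. strand i u m s = (\<Sum>t\<in>B. d s t * w t)"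
      using exact[OF V _ du au[OF V]] by blast
    define w' where "w' t = (if deg t = Suc i then w t else 0)" for t
    have "strand i u m s = (\<Sum>t\<in>B. d s t * w' t)" for s
    proof (cases "deg s = i")
      case True
      have "d s t * w' t = d s t * w t" for t
        using d_nonzero[of s t] True by (cases "d s t = 0") (auto simp: w'_def)
      then have "(\<Sum>t\<in>B. d s t * w' t) = (\<Sum>t\<in>B. d s t * w t)" by (rule sum.cong[OF refl])
      then show ?thesis using w(2) by simp
    next
      case False
      have "d s t * w' t = 0" for t
        using d_nonzero[of s t] False by (cases "d s t = 0") (auto simp: w'_def)
      then have "(\<Sum>t\<in>B. d s t * w' t) = 0" by (intro sum.neutral ballI)
      then show ?thesis using False by (simp add: strand_def)
    qed
    then show ?thesis
      using supported_onD[OF w(1)] V True by (intro exI[of _ w']) (auto simp: w'_def)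
  qed
  then obtain W where W: "\<And>m b. W m b \<noteq> 0 \<Longrightarrow>
      b \<in> B \<and> deg b = Suc i \<and> lab b \<subseteq> keys m \<and> keys m \<subseteq> V \<and> m \<in> S"
    and u_W: "\<And>m s. strand i u m s = (\<Sum>t\<in>B. d s t * W m t)"
    by metis
  obtain w where w: "w \<in> free_functions V (n (Suc i))" "\<And>m b. strand (Suc i) w m b = W m b"
    using strand_surj[of W, OF W \<open>finite S\<close>] by blast
  have "u = (\<lambda>s. \<Sum>t<n (Suc i). diff_map i s t * w t)"
    by (rule strand_inject[OF u diff_map_image[OF w(1)]]) (simp add: strand_diff_map w(2) u_W)
  then show ?thesis using w(1) by blast
qed

lemma aug_row_hom: "aug_row t \<in> homogeneous_part V (int (card (lab (e 0 t))))"
proof (cases "t < n 0")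
  case True
  then have "finite (lab (e 0 t))" "lab (e 0 t) \<subseteq> V" using finite_lab lab_subset e_mem by blast+
  then show ?thesis
    by (auto simp: aug_row_def homogeneous_part_def carrier_polynomial_ring_iff keys_squarefree_monomial
        monomial_degree_squarefree_monomial)
qed (simp add: aug_row_def)

lemma lookup_aug_row:
  "lookup (\<Sum>t<n 0. aug_row t * u t) m = (\<Sum>b\<in>B. a b * strand 0 u m b)"
proof -
  have "aug_row t = single 0 (a (e 0 t)) * basis_monomial (e 0 t)" if "t < n 0" for t
    using that by (simp add: aug_row_def basis_monomial_def mult_single)
  then have "lookup (\<Sum>t<n 0. aug_row t * u t) m = (\<Sum>t<n 0. a (e 0 t) * lookup (basis_monomial (e 0 t) * u t) m)"
    by (simp add: lookup_sum mult.assoc lookup_const_times)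
  also have "\<dots> = (\<Sum>t<n 0. a (e 0 t) * strand 0 u m (e 0 t))"
    by (intro sum.cong) (auto simp: strand_def e_mem)
  also have "\<dots> = (\<Sum>t\<in>{t \<in> B. deg t = 0}. a t * strand 0 u m t)"
    by (rule sum_enumerate[of "\<lambda>t. a t * strand 0 u m t"])
  also have "\<dots> = (\<Sum>t\<in>B. a t * strand 0 u m t)"
    using finite_B by (intro sum.mono_neutral_left) (auto simp: strand_def)
  finally show ?thesis .
qed

lemma diff_map_hom:
  "homogeneous_map V (n i) (\<lambda>t. int (card (lab (e i t)))) (n (Suc i)) (\<lambda>t. int (card (lab (e (Suc i) t)))) (diff_map i)"
  unfolding homogeneous_map_def
proof (intro conjI allI impI)
  fix s t
  show "diff_map i s t \<in> homogeneous_part V (int (card (lab (e (Suc i) t))) - int (card (lab (e i s))))"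
  proof (cases "diff_map i s t = 0")
    case False
    then have "s < n i \<and> t < n (Suc i)" and nz: "d (e i s) (e (Suc i) t) \<noteq> 0"
      by (auto simp: diff_map_def split: if_splits)
    then have B: "e i s \<in> B" "e (Suc i) t \<in> B" using e_mem by auto
    have "lab (e i s) \<subseteq> lab (e (Suc i) t)" using d_nonzero[OF nz] by blast
    then have "int (card (lab (e (Suc i) t) - lab (e i s))) = int (card (lab (e (Suc i) t))) - int (card (lab (e i s)))"
      using card_Diff_subset[OF finite_lab[OF B(1)]] card_mono[OF finite_lab[OF B(2)]]
      by (simp add: of_nat_diff)
    then show ?thesis
      using diff_map_carrier[of i s t] finite_lab[OF B(2)]
      by (auto simp: homogeneous_part_def diff_map_def monomial_degree_squarefree_monomial split: if_splits)
  qed simp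
qed (auto simp: diff_map_def)

lemma coordinate_resolution:
  assumes I: "I = {p \<in> carrier (polynomial_ring V). \<forall>m\<in>keys p. \<not> P (keys m)}"
    and ideal: "ideal I (polynomial_ring V)" and P_empty: "P {}"
  shows "coordinate_resolution V I n (\<lambda>i t. int (card (lab (e i t)))) diff_map aug_row"
proof -
  have comp: "homogeneous_component j p \<in> I" if "p \<in> I" for j p
    using that homogeneous_component_mem[of p V j, THEN homogeneous_part_carrier]
    by (auto simp: I keys_homogeneous_component)
  interpret graded_ideal V I by (intro graded_ideal.intro ideal comp)
  \<comment> \<open>\<open>I\<close> is spanned by the monomials whose support is not a face, so
    membership is tested in the other multidegrees only. This matches the guard in
    \<open>exact\<close>.\<close>
  have in_I: "(\<Sum>t<n 0. aug_row t * u t) \<in> I \<longleftrightarrow>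
      (\<forall>m. keys m \<subseteq> V \<longrightarrow> P (keys m) \<longrightarrow> (\<Sum>b\<in>B. a b * strand 0 u m b) = 0)"
    if u: "u \<in> free_functions V k" for u k
  proof -
    define S where "S = (\<Sum>t<n 0. aug_row t * u t)"
    have "u t \<in> carrier (polynomial_ring V)" for t using u by (simp add: free_functions_def)
    then have S: "S \<in> carrier (polynomial_ring V)"
      unfolding S_def by (intro carrier_sum carrier_times homogeneous_part_carrier[OF aug_row_hom])
    then have "keys m \<subseteq> V" if "lookup S m \<noteq> 0" for m
      using that by (simp add: carrier_polynomial_ring_iff in_keys_iff)
    then have "S \<in> I \<longleftrightarrow> (\<forall>m. keys m \<subseteq> V \<longrightarrow> P (keys m) \<longrightarrow> lookup S m = 0)"
      using S unfolding I Ball_def in_keys_iff mem_Collect_eq by blast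
    then show ?thesis by (simp only: S_def lookup_aug_row)
  qed
  show ?thesis
  proof unfold_locales
    fix p :: "('v, 'k) mpoly" assume p: "p \<in> carrier (polynomial_ring V)"
    \<comment> \<open>The empty face provides a generator with empty label, whose augmentation is a
      nonzero constant and hence a unit.\<close>
    obtain s where s: "s \<in> B" "a s \<noteq> 0" "lab s = {}" using a_surj[OF _ P_empty] by auto
    define t where "t = g 0 s"
    have t: "t < n 0" "e 0 t = s" using g_mem a_nonzero s by (auto simp: t_def)
    define u where "u r = (if r = t then single 0 (1 / a s) * p else 0)" for r
    have "single 0 (1 / a s) * p \<in> carrier (polynomial_ring V)"
      using p by (intro carrier_times carrier_single) auto
    then have "u \<in> free_functions V (n 0)" using t by (auto simp: free_functions_def u_def)
    moreover have "(\<Sum>r<n 0. aug_row r * u r) = p"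
    proof -
      have "(\<Sum>r<n 0. aug_row r * u r) = (\<Sum>r<n 0. if r = t then aug_row t * (single 0 (1 / a s) * p) else 0)"
        by (intro sum.cong) (auto simp: u_def)
      also have "\<dots> = (aug_row t * single 0 (1 / a s)) * p" using t by (simp add: mult.assoc)
      also have "aug_row t * single 0 (1 / a s) = 1"
        using t s by (simp add: aug_row_def squarefree_monomial_def mult_single)
      finally show ?thesis by simp
    qed
    ultimately show "\<exists>u\<in>free_functions V (n 0). (\<Sum>t<n 0. aug_row t * u t) - p \<in> I"
      using I_zero by (intro bexI[of _ u]) auto
  next
    fix u :: "nat \<Rightarrow> ('v, 'k) mpoly" assume u: "u \<in> free_functions V (n 0)"
    show "(\<Sum>t<n 0. aug_row t * u t) \<in> I \<longleftrightarrow>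
        (\<exists>w\<in>free_functions V (n 1). u = (\<lambda>s. \<Sum>t<n 1. diff_map 0 s t * w t))"
    proof
      assume "(\<Sum>t<n 0. aug_row t * u t) \<in> I"
      then have au: "(\<Sum>b\<in>B. a b * strand 0 u m b) = 0" if "keys m \<subseteq> V" "P (keys m)" for m
        using in_I[OF u] that by blast
      have "(\<Sum>t\<in>B. d s t * strand 0 u m t) = 0" for m s
      proof (intro sum.neutral ballI)
        fix t show "d s t * strand 0 u m t = 0"
          using d_nonzero[of s t] by (cases "d s t = 0") (auto simp: strand_def)
      qed
      from strand_exact[OF u this au]
      show "\<exists>w\<in>free_functions V (n 1). u = (\<lambda>s. \<Sum>t<n 1. diff_map 0 s t * w t)" by simp
    next
      assume "\<exists>w\<in>free_functions V (n 1). u = (\<lambda>s. \<Sum>t<n 1. diff_map 0 s t * w t)"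
      then obtain w where w: "w \<in> free_functions V (n 1)"
          "u = (\<lambda>s. \<Sum>t<n (Suc 0). diff_map 0 s t * w t)" by auto
      have "(\<Sum>b\<in>B. a b * strand 0 u m b) = 0" if "keys m \<subseteq> V" "P (keys m)" for m
      proof -
        have "supported_on B lab (keys m) (strand (Suc 0) w m)"
          using strand_nonzero by (auto simp: supported_on_def)
        then show ?thesis unfolding w(2) strand_diff_map by (rule a_d_apply[OF that])
      qed
      then show "(\<Sum>t<n 0. aug_row t * u t) \<in> I" using in_I[OF u] by blast
    qed
  next
    fix u :: "nat \<Rightarrow> ('v, 'k) mpoly" and i assume u: "u \<in> free_functions V (n (Suc i))"
    show "(\<forall>s. (\<Sum>t<n (Suc i). diff_map i s t * u t) = 0) \<longleftrightarrow>
        (\<exists>w\<in>free_functions V (n (Suc (Suc i))). u = (\<lambda>s. \<Sum>t<n (Suc (Suc i)). diff_map (Suc i) s t * w t))"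
    proof
      assume "\<forall>s. (\<Sum>t<n (Suc i). diff_map i s t * u t) = 0"
      then have "(\<Sum>t\<in>B. d s t * strand (Suc i) u m t) = 0" for m s
        using strand_diff_map[of i u m s] strand_zero[of i m s] by simp
      moreover have "(\<Sum>t\<in>B. a t * strand (Suc i) u m t) = 0" for m
      proof (intro sum.neutral ballI)
        fix t show "a t * strand (Suc i) u m t = 0"
          using a_nonzero[of t] by (cases "a t = 0") (auto simp: strand_def)
      qed
      ultimately show "\<exists>w\<in>free_functions V (n (Suc (Suc i))).
          u = (\<lambda>s. \<Sum>t<n (Suc (Suc i)). diff_map (Suc i) s t * w t)"
        by (intro strand_exact[OF u])
    next
      assume "\<exists>w\<in>free_functions V (n (Suc (Suc i))). u = (\<lambda>s. \<Sum>t<n (Suc (Suc i)). diff_map (Suc i) s t * w t)"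
      then obtain w where w: "w \<in> free_functions V (n (Suc (Suc i)))"
          "u = (\<lambda>s. \<Sum>t<n (Suc (Suc i)). diff_map (Suc i) s t * w t)" by blast
      have "(\<lambda>s. \<Sum>t<n (Suc i). diff_map i s t * u t) = (\<lambda>_. 0)"
      proof (rule strand_inject[OF diff_map_image[OF u]])
        show "(\<lambda>_. 0) \<in> free_functions V (n i)" by (simp add: free_functions_def)
        fix m b
        have "(\<Sum>t\<in>B. d b t * strand (Suc i) u m t) = 0"
          unfolding w(2) strand_diff_map by (rule d_d_apply)
        then show "strand i (\<lambda>s. \<Sum>t<n (Suc i). diff_map i s t * u t) m b = strand i (\<lambda>_. 0) m b"
          by (simp add: strand_diff_map strand_zero)
      qed
      then show "\<forall>s. (\<Sum>t<n (Suc i). diff_map i s t * u t) = 0" by (simp add: fun_eq_iff)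
    qed
  next
    fix i
    show "homogeneous_map V (n i) (\<lambda>t. int (card (lab (e i t)))) (n (Suc i))
        (\<lambda>t. int (card (lab (e (Suc i) t)))) (diff_map i)" by (rule diff_map_hom)
  next
    fix t show "aug_row t \<in> homogeneous_part V (int (card (lab (e 0 t))))" by (rule aug_row_hom)
  next
    fix t assume "n 0 \<le> t"
    then show "aug_row t = 0" by (simp add: aug_row_def)
  qed
qed

text \<open>Where \<open>d\<close> is nonzero the labels are nested, so the monomial of the entry is
  1 only if they coincide. Minimality over the ring is therefore a condition on labels.\<close>

lemma lookup_diff_map_0:
  assumes "\<And>s t. d s t \<noteq> 0 \<Longrightarrow> lab s \<noteq> lab t"
  shows "lookup (diff_map i s t) 0 = 0"
proof (rule ccontr)
  assume "lookup (diff_map i s t) 0 \<noteq> 0"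
  then have st: "t < n (Suc i)" "d (e i s) (e (Suc i) t) \<noteq> 0"
      "squarefree_monomial (lab (e (Suc i) t) - lab (e i s)) = 0"
    by (auto simp: diff_map_def lookup_single when_def split: if_splits)
  have "finite (lab (e (Suc i) t))" using finite_lab e_mem[OF st(1)] by blast
  then have "lab (e (Suc i) t) - lab (e i s) = {}"
    using keys_squarefree_monomial[of "lab (e (Suc i) t) - lab (e i s)"] st(3) by simp
  then show False using d_nonzero[OF st(2)] assms[OF st(2)] by blast
qed

end

lemma (in squarefree_resolution) coordinate_resolution_exists:
  fixes I :: "('v, 'k) mpoly set"
  assumes "finite V" and "I = {p \<in> carrier (polynomial_ring V). \<forall>m\<in>keys p. \<not> P (keys m)}"
    and "ideal I (polynomial_ring V)" and "P {}"
    and minimal: "\<And>s t. d s t \<noteq> 0 \<Longrightarrow> lab s \<noteq> lab t"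
  shows "\<exists>n sh D q. coordinate_resolution V I n sh D q \<and> (\<forall>i s t. lookup (D i s t) 0 = 0) \<and>
    (\<forall>i j. (\<exists>t<n i. sh i t = j) \<longleftrightarrow> (\<exists>b\<in>B. deg b = i \<and> int (card (lab b)) = j))"
proof -
  define n where "n i = card {b \<in> B. deg b = i}" for i
  have "\<exists>h. bij_betw h {0..<n i} {b \<in> B. deg b = i}" for i
    unfolding n_def using finite_B by (intro ex_bij_betw_nat_finite) simp
  then obtain e where e: "\<And>i. bij_betw (e i) {0..<n i} {b \<in> B. deg b = i}" by metis
  define g where "g i = the_inv_into {0..<n i} (e i)" for i
  interpret enumerated_resolution V P B deg lab d a n e g
  proof unfold_locales
    fix t i assume t: "t < n i"
    then have "e i t \<in> {b \<in> B. deg b = i}" using bij_betw_apply[OF e[of i]] by simp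
    moreover have "g i (e i t) = t"
      using the_inv_into_f_f[OF bij_betw_imp_inj_on[OF e[of i]]] t by (simp add: g_def)
    ultimately show "e i t \<in> B \<and> deg (e i t) = i \<and> g i (e i t) = t" by simp
  next
    fix b i assume "b \<in> B" "deg b = i"
    then have b: "b \<in> e i ` {0..<n i}" using e[of i] by (auto simp: bij_betw_def)
    show "g i b < n i \<and> e i (g i b) = b"
      using f_the_inv_into_f[OF bij_betw_imp_inj_on[OF e[of i]] b]
        the_inv_into_into[OF bij_betw_imp_inj_on[OF e[of i]] b subset_refl] by (simp add: g_def)
  qed (fact assms(1))
  have "(\<exists>t<n i. int (card (lab (e i t))) = j) \<longleftrightarrow> (\<exists>b\<in>B. deg b = i \<and> int (card (lab b)) = j)" for i j
    using e_mem g_mem by metis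
  then show ?thesis
    by (intro exI[of _ n] exI[of _ "\<lambda>i t. int (card (lab (e i t)))"] exI[of _ diff_map]
        exI[of _ aug_row] conjI allI coordinate_resolution[OF assms(2-4)] lookup_diff_map_0[OF minimal])
qed

section \<open>Edge ideals\<close>

text \<open>The right side is an ideal containing the generators, and each term of one of its
  members is a multiple of a generator. In this form the faces of the associated complex are the
  independent sets.\<close>

lemma edge_ideal_eq:
  fixes E :: "'v set set"
  assumes E: "\<And>e. e \<in> E \<Longrightarrow> e \<subseteq> V \<and> card e = 2"
  shows "(edge_ideal V E :: ('v, 'k::field) mpoly set) =
    {p \<in> carrier (polynomial_ring V). \<forall>m\<in>keys p. \<exists>e\<in>E. e \<subseteq> keys m}" (is "_ = ?J")
    and "ideal (edge_ideal V E :: ('v, 'k::field) mpoly set) (polynomial_ring V)"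
proof -
  interpret cring "polynomial_ring V :: ('v, 'k) mpoly ring" by (rule cring_polynomial_ring)
  let ?G = "{var x * var y | x y. {x, y} \<in> E} :: ('v, 'k) mpoly set"
  have var_times: "var x * var y = (single (single x (Suc 0) + single y (Suc 0)) 1 :: ('v, 'k) mpoly)" for x y :: 'v
    by (simp add: var_def mult_single)
  have keys_xy: "keys (single x (Suc 0) + single y (Suc 0) :: 'v \<Rightarrow>\<^sub>0 nat) = {x, y}" for x y :: 'v
    by (auto simp: keys_monomial_add)
  have G: "?G \<subseteq> carrier (polynomial_ring V)"
    by (auto simp: var_times carrier_polynomial_ring_iff keys_xy dest!: E)
  show ideal: "ideal (edge_ideal V E :: ('v, 'k) mpoly set) (polynomial_ring V)"
    unfolding edge_ideal_def by (rule genideal_ideal[OF G])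
  have J_times: "q * p \<in> ?J" if p: "p \<in> ?J" and q: "q \<in> carrier (polynomial_ring V)"
    for p q :: "('v, 'k) mpoly"
  proof -
    have "\<exists>e\<in>E. e \<subseteq> keys m" if m: "m \<in> keys (q * p)" for m
    proof -
      obtain m1 m2 where "m = m1 + m2" "m2 \<in> keys p" using m keys_mult[of q p] by blast
      moreover from this obtain e where "e \<in> E" "e \<subseteq> keys m2" using p by blast
      ultimately show ?thesis by (auto simp: keys_monomial_add)
    qed
    then show ?thesis using p q by (simp add: carrier_times)
  qed
  have J: "ideal ?J (polynomial_ring V)"
  proof (rule idealI)
    show "ring (polynomial_ring V :: ('v, 'k) mpoly ring)" by (rule ring_axioms)
    show "subgroup ?J (add_monoid (polynomial_ring V))"
    proof (rule add.subgroupI)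
      fix p :: "('v, 'k) mpoly" assume p: "p \<in> ?J"
      have "\<ominus>\<^bsub>polynomial_ring V\<^esub> p = - p"
        using p by (intro minus_equality) (simp_all add: carrier_uminus)
      moreover have "- p \<in> ?J" using J_times[OF p, of "- 1"] by (simp add: carrier_uminus)
      ultimately show "\<ominus>\<^bsub>polynomial_ring V\<^esub> p \<in> ?J" by simp
    next
      fix p q :: "('v, 'k) mpoly" assume "p \<in> ?J" "q \<in> ?J"
      then show "p \<oplus>\<^bsub>polynomial_ring V\<^esub> q \<in> ?J"
        using keys_add[of p q] by (auto simp: carrier_add)
    next
      have "0 \<in> ?J" by simp
      then show "?J \<noteq> {}" by blast
    qed auto
  next
    fix p q :: "('v, 'k) mpoly" assume pq: "p \<in> ?J" "q \<in> carrier (polynomial_ring V)"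
    show "q \<otimes>\<^bsub>polynomial_ring V\<^esub> p \<in> ?J" using J_times[OF pq] by simp
    show "p \<otimes>\<^bsub>polynomial_ring V\<^esub> q \<in> ?J" using J_times[OF pq] by (simp add: mult.commute)
  qed
  have "?G \<subseteq> ?J"
    using G by (auto simp: var_times keys_xy)
  then have "edge_ideal V E \<subseteq> ?J"
    unfolding edge_ideal_def by (rule genideal_minimal[OF J])
  moreover have "p \<in> edge_ideal V E" if p: "p \<in> ?J" for p :: "('v, 'k) mpoly"
  proof -
    have terms: "single m (lookup p m) \<in> edge_ideal V E" if m: "m \<in> keys p" for m
    proof -
      obtain e where e: "e \<in> E" "e \<subseteq> keys m" using p m by blast
      then obtain x y where xy: "e = {x, y}" "x \<noteq> y" using E by (metis card_2_iff)
      have "var x * var y \<in> (edge_ideal V E :: ('v, 'k) mpoly set)"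
        unfolding edge_ideal_def using genideal_self[OF G] e xy by blast
      moreover have "single (m - (single x (Suc 0) + single y (Suc 0))) (lookup p m) \<in> carrier (polynomial_ring V)"
      proof -
        have "keys m \<subseteq> V" using p m by (auto simp: carrier_polynomial_ring_iff)
        moreover have "keys (m - (single x (Suc 0) + single y (Suc 0))) \<subseteq> keys m"
          by (auto simp: in_keys_iff lookup_minus)
        ultimately show ?thesis by (intro carrier_single) blast
      qed
      ultimately have "single (m - (single x (Suc 0) + single y (Suc 0))) (lookup p m) * (var x * var y) \<in> edge_ideal V E"
        using ideal.I_l_closed[OF ideal] by simp
      moreover have "m - (single x (Suc 0) + single y (Suc 0)) + (single x (Suc 0) + single y (Suc 0)) = m"
      proof (rule poly_mapping_eqI)
        fix z show "lookup (m - (single x (Suc 0) + single y (Suc 0)) + (single x (Suc 0) + single y (Suc 0))) z = lookup m z"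
          using e xy by (auto simp: lookup_add lookup_minus lookup_single when_def in_keys_iff)
      qed
      ultimately show ?thesis by (simp add: var_times mult_single)
    qed
    have sum_mem: "sum f A \<in> edge_ideal V E" if "\<And>m. m \<in> A \<Longrightarrow> f m \<in> edge_ideal V E"
      for f :: "('v \<Rightarrow>\<^sub>0 nat) \<Rightarrow> ('v, 'k) mpoly" and A
      using that additive_subgroup.zero_closed[OF ideal.axioms(1)[OF ideal]]
        additive_subgroup.a_closed[OF ideal.axioms(1)[OF ideal]]
      by (induction A rule: infinite_finite_induct) simp_all
    have "(\<Sum>m\<in>keys p. single m (lookup p m)) \<in> edge_ideal V E"
      by (rule sum_mem) (rule terms)
    then show ?thesis by (simp only: poly_expand[symmetric])
  qed
  ultimately show "(edge_ideal V E :: ('v, 'k) mpoly set) = ?J" by blast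
qed

section \<open>Resolutions of edge ideals\<close>

text \<open>An upper bound for the regularity, read off from a resolution that need not be minimal.
  \<open>r\<close> is an integer since adding loops asks for the bound \<open>r - 1\<close> even at
  \<open>r = 0\<close>. The index type is fixed to \<open>nat\<close> for the sake of induction, and
  \<open>K\<close> records the field.\<close>

definition bounded_resolution :: "'k::field itself \<Rightarrow> 'v set \<Rightarrow> ('v set \<Rightarrow> bool) \<Rightarrow> int \<Rightarrow> bool" where
  "bounded_resolution K V P r \<longleftrightarrow> (\<exists>(B :: nat set) deg lab (d :: nat \<Rightarrow> nat \<Rightarrow> 'k) a.
     squarefree_resolution V P B deg lab d a \<and> (\<forall>b\<in>B. int (card (lab b)) \<le> int (deg b) + r))"

lemma bounded_resolution_cong:
  assumes "bounded_resolution TYPE('k::field) V P r" and eq: "\<And>U. U \<subseteq> V \<Longrightarrow> P U \<longleftrightarrow> P' U"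
  shows "bounded_resolution TYPE('k) V P' r"
proof -
  obtain B :: "nat set" and deg lab and d :: "nat \<Rightarrow> nat \<Rightarrow> 'k" and a
    where F: "squarefree_resolution V P B deg lab d a" and "\<forall>b\<in>B. int (card (lab b)) \<le> int (deg b) + r"
    using assms(1) unfolding bounded_resolution_def by blast
  moreover have "squarefree_resolution V P' B deg lab d a"
    by (rule squarefree_resolution.cong_predicate[OF F eq])
  ultimately show ?thesis unfolding bounded_resolution_def by blast
qed

lemma bounded_resolution_mono:
  assumes "bounded_resolution K V P r" "r \<le> r'"
  shows "bounded_resolution K V P r'"
  using assms unfolding bounded_resolution_def by (meson add_left_mono order_trans)

lemma bounded_resolution_void: "bounded_resolution K V (\<lambda>U. False) r"
  unfolding bounded_resolution_def using squarefree_resolution_void by blast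

lemma bounded_resolution_full: "bounded_resolution TYPE('k::field) V (\<lambda>U. True) 0"
  unfolding bounded_resolution_def
  using squarefree_resolution_full[of V "0::nat"] by (intro exI conjI) (assumption, simp)

definition decode3 :: "nat \<Rightarrow> nat + nat + nat" where
  "decode3 m = (case sum_decode m of Inl k \<Rightarrow> Inl k | Inr k \<Rightarrow> Inr (sum_decode k))"

lemma bij_decode3: "bij decode3"
proof -
  define encode3 where "encode3 z = (case z of Inl k \<Rightarrow> sum_encode (Inl k) | Inr y \<Rightarrow> sum_encode (Inr (sum_encode y)))"
    for z :: "nat + nat + nat"
  have "decode3 (encode3 z) = z" for z by (simp add: decode3_def encode3_def split: sum.split)
  moreover have "encode3 (decode3 m) = m" for m
  proof (cases "sum_decode m")
    case (Inl k)
    then show ?thesis using sum_decode_inverse[of m] by (simp add: decode3_def encode3_def)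
  next
    case (Inr k)
    then show ?thesis using sum_decode_inverse[of m] by (simp add: decode3_def encode3_def)
  qed
  ultimately show ?thesis by (intro o_bij[of encode3]) auto
qed

text \<open>Deletion and link of the vertex \<open>x\<close>: passing to the link costs one step of the bound.\<close>

lemma bounded_resolution_cone:
  assumes F: "bounded_resolution TYPE('k::field) V P r" and G: "bounded_resolution TYPE('k) V P' (r - 1)"
    and P'_P: "\<And>U. U \<subseteq> V \<Longrightarrow> P' U \<Longrightarrow> P U" and x: "x \<notin> V"
  shows "bounded_resolution TYPE('k) (insert x V) (\<lambda>U. if x \<in> U then P' (U - {x}) else P U) r"
proof -
  obtain B :: "nat set" and deg lab and d :: "nat \<Rightarrow> nat \<Rightarrow> 'k" and a
    where F': "squarefree_resolution V P B deg lab d a" and F_bound: "\<And>b. b \<in> B \<Longrightarrow> int (card (lab b)) \<le> int (deg b) + r"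
    using F unfolding bounded_resolution_def by blast
  obtain B' :: "nat set" and deg' lab' and d' :: "nat \<Rightarrow> nat \<Rightarrow> 'k" and a'
    where G': "squarefree_resolution V P' B' deg' lab' d' a'"
      and G_bound: "\<And>b. b \<in> B' \<Longrightarrow> int (card (lab' b)) \<le> int (deg' b) + (r - 1)"
    using G unfolding bounded_resolution_def by blast
  obtain \<phi> where \<phi>: "\<And>s t. \<phi> s t \<noteq> 0 \<Longrightarrow> s \<in> B' \<and> t \<in> B \<and> deg' s = deg t \<and> lab' s \<subseteq> lab t"
    "\<And>s t. (\<Sum>r\<in>B'. d' s r * \<phi> r t) = (\<Sum>r\<in>B. \<phi> s r * d r t)"
    "\<And>t. t \<in> B \<Longrightarrow> P' (lab t) \<Longrightarrow> (\<Sum>s\<in>B'. a' s * \<phi> s t) = a t"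
    using squarefree_lift[OF F' G' P'_P] by blast
  have "V \<inter> {x} = {}" using x by simp
  from squarefree_cone[OF F' G' P'_P this \<phi>]
  have cone: "squarefree_resolution (V \<union> {x}) (\<lambda>U. if {x} \<subseteq> U then P' (U - {x}) else P (U - {x}))
      (B <+> (B' <+> B)) (cone_deg deg deg') (cone_lab {x} lab lab') (cone_diff B d d' \<phi>) (cone_aug a a')" .
  have bound: "int (card (cone_lab {x} lab lab' b)) \<le> int (cone_deg deg deg' b) + r" if "b \<in> B <+> (B' <+> B)" for b
  proof -
    have card: "card (A \<union> {x}) \<le> card A + 1" for A :: "'a set"
      using card_Un_le[of A "{x}"] by simp
    show ?thesis
    proof (cases b rule: sum3_cases)
      case (1 t)
      then show ?thesis using F_bound that by auto
    next
      case (2 t)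
      then have "int (card (lab' t)) \<le> int (deg' t) + (r - 1)" using G_bound that by auto
      then show ?thesis using 2 card[of "lab' t"] by simp
    next
      case (3 t)
      then have "int (card (lab t)) \<le> int (deg t) + r" using F_bound that by auto
      then show ?thesis using 3 card[of "lab t"] by simp
    qed
  qed
  have "bounded_resolution TYPE('k) (V \<union> {x}) (\<lambda>U. if {x} \<subseteq> U then P' (U - {x}) else P (U - {x})) r"
    unfolding bounded_resolution_def
    using squarefree_resolution.reindex[OF cone bij_decode3] bound
    by (intro exI conjI) (assumption, simp)
  then have "bounded_resolution TYPE('k) (insert x V) (\<lambda>U. if {x} \<subseteq> U then P' (U - {x}) else P (U - {x})) r"
    by simp
  then show ?thesis by (rule bounded_resolution_cong) auto
qed

text \<open>Adding vertices that lie in no independent set: this turns a resolution for \<open>G - N[x]\<close> into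
  one for the link of \<open>x\<close>.\<close>

lemma bounded_resolution_loops:
  assumes "finite L" "L \<inter> V = {}" "bounded_resolution TYPE('k::field) V P r"
  shows "bounded_resolution TYPE('k) (V \<union> L) (\<lambda>U. U \<inter> L = {} \<and> P U) r"
  using assms
proof (induction L rule: finite_induct)
  case empty
  then show ?case by simp
next
  case (insert y L)
  then have IH: "bounded_resolution TYPE('k) (V \<union> L) (\<lambda>U. U \<inter> L = {} \<and> P U) r" by simp
  have "y \<notin> V \<union> L" using insert by auto
  \<comment> \<open>With the void complex as link, \<open>y\<close> lies in no face. The zero
    resolution satisfies every bound, so nothing is lost.\<close>
  from bounded_resolution_cone[OF IH bounded_resolution_void _ this]
  have "bounded_resolution TYPE('k) (insert y (V \<union> L)) (\<lambda>U. if y \<in> U then False else U \<inter> L = {} \<and> P U) r"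
    by simp
  then have "bounded_resolution TYPE('k) (V \<union> insert y L) (\<lambda>U. if y \<in> U then False else U \<inter> L = {} \<and> P U) r"
    by simp
  then show ?case by (rule bounded_resolution_cong) auto
qed

section \<open>Pairwise 3-disjoint edges and shedding vertices\<close>

lemma simple_graph_finite: "simple_graph V E \<Longrightarrow> finite E"
  unfolding simple_graph_def by (meson Pow_iff finite_Pow_iff finite_subset subsetI)

lemma simple_graph_edgeD:
  assumes "simple_graph V E" "{x, y} \<in> E"
  shows "x \<in> V" "y \<in> V" "x \<noteq> y"
  using assms by (fastforce simp: simple_graph_def)+

lemma simple_graph_induced:
  "simple_graph V E \<Longrightarrow> W \<subseteq> V \<Longrightarrow> simple_graph W (induced_edges E W)"
  by (auto simp: simple_graph_def induced_edges_def intro: finite_subset)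

lemma C5_free_induced: "C5_free V E \<Longrightarrow> W \<subseteq> V \<Longrightarrow> C5_free W (induced_edges E W)"
  unfolding C5_free_def induced_edges_def by blast

lemma three_disjoint_number_card_set:
  assumes "finite E"
  shows "finite {card A | A. pairwise_three_disjoint E A}" "{card A | A. pairwise_three_disjoint E A} \<noteq> {}"
proof -
  have "{card A | A. pairwise_three_disjoint E A} \<subseteq> card ` Pow E"
    by (auto simp: pairwise_three_disjoint_def)
  then show "finite {card A | A. pairwise_three_disjoint E A}"
    using assms by (meson finite_Pow_iff finite_imageI finite_subset)
  have "pairwise_three_disjoint E {}" by (simp add: pairwise_three_disjoint_def)
  then show "{card A | A. pairwise_three_disjoint E A} \<noteq> {}" by blast
qed

lemma three_disjoint_number_ge:
  "finite E \<Longrightarrow> pairwise_three_disjoint E A \<Longrightarrow> card A \<le> three_disjoint_number E"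
  unfolding three_disjoint_number_def by (rule Max_ge) (auto simp: three_disjoint_number_card_set)

lemma three_disjoint_number_attained:
  assumes "finite E"
  obtains A where "pairwise_three_disjoint E A" "card A = three_disjoint_number E"
  using Max_in[OF three_disjoint_number_card_set[OF assms]] unfolding three_disjoint_number_def by auto

text \<open>3-disjointness inspects only edges inside \<open>e \<union> f\<close>, and these are the
  same in the graph and in its induced subgraph on \<open>W\<close>.\<close>

lemma pairwise_three_disjoint_induced:
  assumes "pairwise_three_disjoint (induced_edges E W) A"
  shows "pairwise_three_disjoint E A"
proof -
  have sub: "e \<in> E \<and> e \<subseteq> W" if "e \<in> A" for e
    using assms that by (auto simp: pairwise_three_disjoint_def induced_edges_def)
  have "three_disjoint E e f" if "e \<in> A" "f \<in> A" "e \<noteq> f" for e f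
  proof -
    have "three_disjoint (induced_edges E W) e f" using assms that by (simp add: pairwise_three_disjoint_def)
    moreover have "induced_edges (induced_edges E W) (e \<union> f) = induced_edges E (e \<union> f)"
      using sub[OF that(1)] sub[OF that(2)] by (auto simp: induced_edges_def)
    ultimately show ?thesis by (simp add: three_disjoint_def)
  qed
  then show ?thesis using sub by (auto simp: pairwise_three_disjoint_def)
qed

lemma three_disjoint_number_induced_le:
  assumes "simple_graph V E" "W \<subseteq> V"
  shows "three_disjoint_number (induced_edges E W) \<le> three_disjoint_number E"
proof -
  obtain A where A: "pairwise_three_disjoint (induced_edges E W) A"
      "card A = three_disjoint_number (induced_edges E W)"
    using three_disjoint_number_attained simple_graph_finite[OF simple_graph_induced[OF assms]] by blast
  then show ?thesis
    using three_disjoint_number_ge[OF simple_graph_finite[OF assms(1)] pairwise_three_disjoint_induced] by metis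
qed

lemma three_disjoint_sym: "three_disjoint E e f \<longleftrightarrow> three_disjoint E f e"
  by (simp add: three_disjoint_def Int_commute Un_commute insert_commute)

lemma independent_set_extend:
  assumes "finite V" "independent_set V E S"
  obtains T where "S \<subseteq> T" "maximal_independent_set V E T"
proof -
  let ?F = "{T. independent_set V E T \<and> S \<subseteq> T}"
  have "?F \<subseteq> Pow V" by (auto simp: independent_set_def)
  then have "finite ?F" using assms(1) finite_subset by blast
  moreover have "?F \<noteq> {}" using assms(2) by blast
  ultimately obtain T where "T \<in> ?F" "\<forall>T'\<in>?F. T \<subseteq> T' \<longrightarrow> T = T'"
    using finite_has_maximal by meson
  then show ?thesis using that[of T] unfolding maximal_independent_set_def by blast
qed

text \<open>If every neighbour \<open>y\<close> of \<open>x\<close> had a neighbour \<open>Z y\<close> outside \<open>N[x]\<close>, the vertices \<open>Z y\<close> would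
  be independent, as an edge between two of them closes a 5-cycle through \<open>x\<close>. A maximal
  independent set of \<open>G - N[x]\<close> containing them dominates \<open>N(x)\<close>, so \<open>x\<close> would not be shedding.\<close>

lemma shedding_vertex_dominated_neighbor:
  assumes G: "simple_graph V E" and C5: "C5_free V E" and x: "x \<in> V"
    and shed: "\<forall>S. independent_set (V - closed_neighbors E x) (induced_edges E (V - closed_neighbors E x)) S \<longrightarrow>
      \<not> maximal_independent_set (V - {x}) (induced_edges E (V - {x})) S"
  shows "\<exists>y\<in>neighbors E x. neighbors E y \<subseteq> closed_neighbors E x"
proof (rule ccontr)
  let ?V2 = "V - closed_neighbors E x"
  let ?E1 = "induced_edges E (V - {x})" and ?E2 = "induced_edges E ?V2"
  assume "\<not> ?thesis"
  then have "\<forall>y\<in>neighbors E x. \<exists>z. z \<in> neighbors E y \<and> z \<notin> closed_neighbors E x" by blast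
  then obtain Z where Z: "\<And>y. {x, y} \<in> E \<Longrightarrow> {y, Z y} \<in> E \<and> Z y \<noteq> x \<and> {x, Z y} \<notin> E"
    unfolding neighbors_def closed_neighbors_def by (metis insert_iff mem_Collect_eq)
  note edgeD = simple_graph_edgeD[OF G]
  let ?S = "Z ` neighbors E x"
  have S_V2: "?S \<subseteq> ?V2"
  proof (intro image_subsetI)
    fix y assume "y \<in> neighbors E x"
    then show "Z y \<in> ?V2"
      using Z[of y] edgeD(2)[of y "Z y"] by (auto simp: neighbors_def closed_neighbors_def)
  qed
  have "independent_set ?V2 ?E2 ?S"
    unfolding independent_set_def
  proof (intro conjI ballI notI S_V2)
    fix e assume e: "e \<in> ?E2" "e \<subseteq> ?S"
    then have "card e = 2" "e \<in> E" using G by (auto simp: induced_edges_def simple_graph_def)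
    then obtain u v where uv: "e = {u, v}" "u \<noteq> v" by (metis card_2_iff)
    then obtain y y' where y: "{x, y} \<in> E" "u = Z y" "{x, y'} \<in> E" "v = Z y'"
      using e(2) by (auto simp: neighbors_def)
    let ?xs = "[x, y, Z y, Z y', y']"
    have "y \<noteq> y'" "Z y \<noteq> Z y'" using uv y by auto
    \<comment> \<open>\<open>y'\<close> is adjacent to \<open>x\<close> and \<open>Z y\<close> is
      not.\<close>
    moreover have "Z y \<noteq> y'" "Z y' \<noteq> y" using Z[OF y(1)] Z[OF y(3)] y by auto
    moreover have "x \<noteq> y" "x \<noteq> y'" "y \<noteq> Z y" "y' \<noteq> Z y'" using edgeD(3) y Z by blast+
    ultimately have "distinct ?xs" using Z[OF y(1)] Z[OF y(3)] by auto
    moreover have "set ?xs \<subseteq> V" using edgeD y Z[OF y(1)] Z[OF y(3)] by auto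
    moreover have "{?xs ! i, ?xs ! ((i + 1) mod 5)} \<in> E" if "i < 5" for i
    proof -
      from that consider "i = 0" | "i = 1" | "i = 2" | "i = 3" | "i = 4" by linarith
      then show ?thesis
        using y Z[OF y(1)] Z[OF y(3)] \<open>e \<in> E\<close> uv by cases (auto simp: insert_commute)
    qed
    ultimately have "length ?xs = 5 \<and> distinct ?xs \<and> set ?xs \<subseteq> V \<and>
        (\<forall>i<5. {?xs ! i, ?xs ! ((i + 1) mod 5)} \<in> E)" by simp
    then show False using C5 unfolding C5_free_def by blast
  qed
  moreover have "finite ?V2" using G by (simp add: simple_graph_def)
  ultimately obtain T where T: "?S \<subseteq> T" "maximal_independent_set ?V2 ?E2 T"
    by (metis independent_set_extend)
  then have T_V2: "T \<subseteq> ?V2" and T_ind: "\<And>e. e \<in> ?E2 \<Longrightarrow> \<not> e \<subseteq> T"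
    by (auto simp: maximal_independent_set_def independent_set_def)
  have "maximal_independent_set (V - {x}) ?E1 T"
    unfolding maximal_independent_set_def
  proof (intro conjI allI impI)
    show "independent_set (V - {x}) ?E1 T"
      using T_V2 T_ind by (fastforce simp: independent_set_def induced_edges_def closed_neighbors_def)
    fix T' assume T': "independent_set (V - {x}) ?E1 T' \<and> T \<subseteq> T'"
    \<comment> \<open>A neighbour \<open>v\<close> of \<open>x\<close> in \<open>T'\<close> would be
      adjacent to \<open>Z v\<close>, which already lies in \<open>T\<close>.\<close>
    have "T' \<subseteq> ?V2"
    proof
      fix v assume v: "v \<in> T'"
      then have v': "v \<in> V" "v \<noteq> x" using T' by (auto simp: independent_set_def)
      have "v \<notin> neighbors E x"
      proof
        assume "v \<in> neighbors E x"
        then have "{v, Z v} \<in> E" "Z v \<noteq> x" "Z v \<in> T'" using Z T(1) T' by (auto simp: neighbors_def)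
        moreover from this have "{v, Z v} \<in> ?E1" using edgeD(2) v' by (auto simp: induced_edges_def)
        ultimately show False using T' v by (auto simp: independent_set_def)
      qed
      then show "v \<in> ?V2" using v' by (simp add: closed_neighbors_def)
    qed
    moreover have "?E2 \<subseteq> ?E1" by (auto simp: induced_edges_def closed_neighbors_def)
    ultimately have "independent_set ?V2 ?E2 T'"
      using T' unfolding independent_set_def by blast
    then show "T' = T" using T(2) T' by (auto simp: maximal_independent_set_def)
  qed
  then show False using shed T(2) unfolding maximal_independent_set_def by blast
qed

text \<open>Both ends of an edge that meets \<open>{x, y}\<close> lie in \<open>N[x]\<close>,
  because \<open>N[y]\<close> does. So no edge joins \<open>{x, y}\<close> to an edge of
  \<open>G - N[x]\<close>.\<close>

lemma three_disjoint_number_link: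
  assumes G: "simple_graph V E" and y: "y \<in> neighbors E x" "neighbors E y \<subseteq> closed_neighbors E x"
  shows "Suc (three_disjoint_number (induced_edges E (V - closed_neighbors E x))) \<le> three_disjoint_number E"
proof -
  let ?V2 = "V - closed_neighbors E x" and ?E2 = "induced_edges E (V - closed_neighbors E x)"
  note edgeD = simple_graph_edgeD[OF G]
  have xy: "{x, y} \<in> E" using y by (simp add: neighbors_def)
  have G2: "simple_graph ?V2 ?E2" using simple_graph_induced[OF G] by blast
  obtain A where A: "pairwise_three_disjoint ?E2 A" "card A = three_disjoint_number ?E2"
    using three_disjoint_number_attained[OF simple_graph_finite[OF G2]] by blast
  have A_E2: "A \<subseteq> ?E2" using A by (simp add: pairwise_three_disjoint_def)
  have A_E: "pairwise_three_disjoint E A" using pairwise_three_disjoint_induced[OF A(1)] .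
  have disjoint: "three_disjoint E {x, y} f" if f: "f \<in> A" for f
  proof -
    have f': "f \<in> E" "f \<inter> closed_neighbors E x = {}" using f A_E2 by (auto simp: induced_edges_def)
    have "e = {x, y} \<or> e = f" if e: "e \<in> E" "e \<subseteq> {x, y} \<union> f" for e
    proof (cases "e \<subseteq> f")
      case True
      have "card e = 2" "card f = 2" using e f' G by (auto simp: simple_graph_def)
      moreover have "finite f" using \<open>card f = 2\<close> card.infinite by fastforce
      ultimately show ?thesis using True card_subset_eq by metis
    next
      case False
      obtain u v where uv: "e = {u, v}" using e G by (metis card_2_iff simple_graph_def)
      have key: "e' = {x, y}" if "{u', v'} = e'" "e' \<in> E" "e' \<subseteq> {x, y} \<union> f" "u' \<in> {x, y}" for u' v' e'
      proof -
        have "v' \<in> closed_neighbors E x"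
          using that y(2) by (auto simp: neighbors_def closed_neighbors_def)
        then have "v' \<in> {x, y}" using that f' by auto
        moreover have "u' \<noteq> v'" using that edgeD(3) by blast
        ultimately show ?thesis using that by auto
      qed
      have "u \<in> {x, y} \<or> v \<in> {x, y}" using False uv e by auto
      then show ?thesis using key[of u v e] key[of v u e] uv e by (auto simp: insert_commute)
    qed
    moreover have "{x, y} \<inter> f = {}" using f' y(1) by (auto simp: closed_neighbors_def)
    ultimately show ?thesis using xy f' by (auto simp: three_disjoint_def induced_edges_def)
  qed
  have "pairwise_three_disjoint E (insert {x, y} A)"
    using A_E disjoint three_disjoint_sym[of E] xy unfolding pairwise_three_disjoint_def by (metis insert_iff insert_subset)
  moreover have "{x, y} \<notin> A" using A_E2 by (auto simp: induced_edges_def closed_neighbors_def)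
  moreover have "finite A" using A_E2 simple_graph_finite[OF G2] finite_subset by blast
  ultimately show ?thesis using three_disjoint_number_ge[OF simple_graph_finite[OF G]] A(2) by fastforce
qed

theorem bounded_resolution_vertex_decomposable:
  assumes "vertex_decomposable V E" "simple_graph V E" "C5_free V E"
  shows "bounded_resolution TYPE('k::field) V (\<lambda>U. \<forall>e\<in>E. \<not> e \<subseteq> U) (int (three_disjoint_number E))"
  using assms
proof (induction rule: vertex_decomposable.induct)
  case (no_edges V)
  have "bounded_resolution TYPE('k) V (\<lambda>U. \<forall>e\<in>{}. \<not> e \<subseteq> U) 0"
    using bounded_resolution_full by simp
  then show ?case by (rule bounded_resolution_mono) simp
next
  case (shedding x V V1 E1 E V2 E2)
  note G = \<open>simple_graph V E\<close>
  note edgeD = simple_graph_edgeD[OF G]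
  let ?c = "int (three_disjoint_number E)"
  let ?N = "neighbors E x"
  have V: "V1 \<subseteq> V" "V2 \<subseteq> V" "V = insert x V1" "V1 = V2 \<union> ?N" "?N \<inter> V2 = {}" "x \<notin> V1"
    using shedding.hyps(1,2,4) edgeD edgeD(3)[of x x] by (auto simp: closed_neighbors_def neighbors_def)
  have E12: "E1 = induced_edges E V1" "E2 = induced_edges E V2" using shedding.hyps by auto
  have "finite ?N" using V G finite_subset by (metis Un_upper2 order_trans simple_graph_def)
  have "bounded_resolution TYPE('k) V1 (\<lambda>U. \<forall>e\<in>E1. \<not> e \<subseteq> U) (int (three_disjoint_number E1))"
    using shedding.IH(1) simple_graph_induced[OF G V(1)] C5_free_induced[OF shedding.prems(2) V(1)] E12 by simp
  then have del: "bounded_resolution TYPE('k) V1 (\<lambda>U. \<forall>e\<in>E1. \<not> e \<subseteq> U) ?c"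
    using three_disjoint_number_induced_le[OF G V(1)] E12 by (elim bounded_resolution_mono) simp
  have "\<exists>y\<in>neighbors E x. neighbors E y \<subseteq> closed_neighbors E x"
    using shedding_vertex_dominated_neighbor[OF G shedding.prems(2)] shedding.hyps by blast
  then have "three_disjoint_number E2 + 1 \<le> three_disjoint_number E"
    using three_disjoint_number_link[OF G] E12 shedding.hyps(4) by auto
  moreover have "bounded_resolution TYPE('k) V2 (\<lambda>U. \<forall>e\<in>E2. \<not> e \<subseteq> U) (int (three_disjoint_number E2))"
    using shedding.IH(2) simple_graph_induced[OF G V(2)] C5_free_induced[OF shedding.prems(2) V(2)] E12 by simp
  ultimately have "bounded_resolution TYPE('k) V2 (\<lambda>U. \<forall>e\<in>E2. \<not> e \<subseteq> U) (?c - 1)"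
    by (elim bounded_resolution_mono) simp
  \<comment> \<open>The cone needs the link of \<open>x\<close> as a complex on all of
    \<open>V1\<close>. Its faces avoid the neighbours of \<open>x\<close>, which therefore enter as
    loops.\<close>
  from bounded_resolution_loops[OF \<open>finite ?N\<close> V(5) this]
  have link: "bounded_resolution TYPE('k) V1 (\<lambda>U. U \<inter> ?N = {} \<and> (\<forall>e\<in>E2. \<not> e \<subseteq> U)) (?c - 1)"
    using V(4) by simp
  have E2_mem: "e \<in> E2" if "e \<in> E" "e \<subseteq> V1" "e \<inter> ?N = {}" for e
    using that V(4) E12 by (auto simp: induced_edges_def)
  have "bounded_resolution TYPE('k) (insert x V1) (\<lambda>U. if x \<in> U
      then (U - {x}) \<inter> ?N = {} \<and> (\<forall>e\<in>E2. \<not> e \<subseteq> U - {x}) else \<forall>e\<in>E1. \<not> e \<subseteq> U) ?c"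
  proof (rule bounded_resolution_cone[OF del link _ V(6)])
    fix U assume U: "U \<subseteq> V1" "U \<inter> ?N = {} \<and> (\<forall>e\<in>E2. \<not> e \<subseteq> U)"
    show "\<forall>e\<in>E1. \<not> e \<subseteq> U"
    proof (intro ballI notI)
      fix e assume "e \<in> E1" "e \<subseteq> U"
      then have "e \<in> E" "e \<subseteq> V1" "e \<inter> ?N = {}" using U E12 by (auto simp: induced_edges_def)
      then have "e \<in> E2" by (rule E2_mem)
      then show False using U \<open>e \<subseteq> U\<close> by blast
    qed
  qed
  then show ?case
    unfolding V(3)[symmetric]
  proof (rule bounded_resolution_cong)
    fix U assume U: "U \<subseteq> V"
    show "(if x \<in> U then (U - {x}) \<inter> ?N = {} \<and> (\<forall>e\<in>E2. \<not> e \<subseteq> U - {x}) else \<forall>e\<in>E1. \<not> e \<subseteq> U) \<longleftrightarrow>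
        (\<forall>e\<in>E. \<not> e \<subseteq> U)"
    proof (cases "x \<in> U")
      case False
      then have "e \<in> E1" if "e \<in> E" "e \<subseteq> U" for e using that U V(3) E12 by (auto simp: induced_edges_def)
      moreover have "E1 \<subseteq> E" using E12 by (auto simp: induced_edges_def)
      ultimately show ?thesis using False by auto
    next
      case True
      show ?thesis
      proof
        assume "if x \<in> U then (U - {x}) \<inter> ?N = {} \<and> (\<forall>e\<in>E2. \<not> e \<subseteq> U - {x}) else \<forall>e\<in>E1. \<not> e \<subseteq> U"
        then have N: "(U - {x}) \<inter> ?N = {}" and ind: "\<And>e. e \<in> E2 \<Longrightarrow> \<not> e \<subseteq> U - {x}" using True by auto
        show "\<forall>e\<in>E. \<not> e \<subseteq> U"
        proof (intro ballI notI)
          fix e assume e: "e \<in> E" "e \<subseteq> U"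
          show False
          proof (cases "x \<in> e")
            case True
            obtain u v where "e = {u, v}" using e G by (metis card_2_iff simple_graph_def)
            then obtain y where y: "e = {x, y}" using True by (metis insert_commute insertE singletonD)
            then have "y \<in> ?N" "y \<noteq> x" using e edgeD(3) by (auto simp: neighbors_def)
            then show False using N e y by auto
          next
            case False
            then have "e \<subseteq> U - {x}" "e \<subseteq> V1" using e U V(3) by auto
            then show False using E2_mem[OF e(1)] ind N by blast
          qed
        qed
      next
        assume ind: "\<forall>e\<in>E. \<not> e \<subseteq> U"
        have "E2 \<subseteq> E" using E12 by (auto simp: induced_edges_def)
        moreover have "(U - {x}) \<inter> ?N = {}" using ind True by (auto simp: neighbors_def)
        ultimately show "if x \<in> U then (U - {x}) \<inter> ?N = {} \<and> (\<forall>e\<in>E2. \<not> e \<subseteq> U - {x}) else \<forall>e\<in>E1. \<not> e \<subseteq> U"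
          using ind True by auto
      qed
    qed
  qed
qed

text \<open>The Koszul complex on the monomials of the members of \<open>A\<close>, obtained by
  iterated cones whose middle summand is zero. The last clause records its top basis element, the
  one that will witness the lower bound.\<close>

lemma matching_resolution:
  assumes "finite A" "\<forall>e\<in>A. e \<noteq> {}" "\<forall>e\<in>A. \<forall>f\<in>A. e \<noteq> f \<longrightarrow> e \<inter> f = {}"
  shows "\<exists>(B :: nat set) deg lab (d :: nat \<Rightarrow> nat \<Rightarrow> 'k::field) a.
    squarefree_resolution (\<Union>A) (\<lambda>U. \<forall>e\<in>A. \<not> e \<subseteq> U) B deg lab d a \<and>
    (\<forall>s t. d s t \<noteq> 0 \<longrightarrow> lab s \<noteq> lab t) \<and> (\<exists>b\<in>B. deg b = card A \<and> lab b = \<Union>A)"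
  using assms
proof (induction A rule: finite_induct)
  case empty
  have "squarefree_resolution (\<Union>{}) (\<lambda>U. \<forall>e\<in>{}. \<not> e \<subseteq> U) {0::nat} (\<lambda>s. 0) (\<lambda>s. {}) (\<lambda>s t. 0 :: 'k) (\<lambda>s. if s = 0 then 1 else 0)"
    using squarefree_resolution_full[of "\<Union>{}" "0::nat"] by simp
  then show ?case by (intro exI conjI) (assumption, auto)
next
  case (insert X A)
  have "\<forall>e\<in>A. e \<noteq> {}" "\<forall>e\<in>A. \<forall>f\<in>A. e \<noteq> f \<longrightarrow> e \<inter> f = {}" using insert.prems by auto
  from insert.IH[OF this] obtain B :: "nat set" and deg lab and d :: "nat \<Rightarrow> nat \<Rightarrow> 'k" and a where
    F: "squarefree_resolution (\<Union>A) (\<lambda>U. \<forall>e\<in>A. \<not> e \<subseteq> U) B deg lab d a"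
    and minimal: "\<And>s t. d s t \<noteq> 0 \<Longrightarrow> lab s \<noteq> lab t"
    and top: "\<exists>b\<in>B. deg b = card A \<and> lab b = \<Union>A" by blast
  interpret F: squarefree_resolution "\<Union>A" "\<lambda>U. \<forall>e\<in>A. \<not> e \<subseteq> U" B deg lab d a by (fact F)
  have X: "\<Union>A \<inter> X = {}" "X \<noteq> {}" using insert.prems insert.hyps(2) by (fastforce)+
  let ?B = "B <+> (({} :: nat set) <+> B)" and ?deg = "cone_deg deg (\<lambda>_. 0)"
    and ?lab = "cone_lab X lab (\<lambda>_. {})" and ?d = "cone_diff B d (\<lambda>_ _. 0) (\<lambda>_ _. 0)" and ?a = "cone_aug a (\<lambda>_. 0)"
  have cone: "squarefree_resolution (\<Union>A \<union> X) (\<lambda>U. if X \<subseteq> U then False else \<forall>e\<in>A. \<not> e \<subseteq> U - X) ?B ?deg ?lab ?d ?a"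
    by (rule squarefree_cone[OF F squarefree_resolution_void _ X(1)]) auto
  have disj: "lab b \<inter> X = {}" if "b \<in> B" for b using F.lab_subset[OF that] X by blast
  have "?lab s \<noteq> ?lab t" if "?d s t \<noteq> 0" for s t
  proof (cases s rule: sum3_cases; cases t rule: sum3_cases)
    fix s' t' assume "s = Inl s'" "t = Inl t'"
    then show ?thesis using that minimal by simp
  next
    \<comment> \<open>The identity block: the two labels differ by the nonempty set
      \<open>X\<close>.\<close>
    fix s' t' assume st: "s = Inl s'" "t = Inr (Inr t')"
    then have "s' = t'" "t' \<in> B" using that by (auto split: if_splits)
    then show ?thesis using st disj X(2) by auto
  next
    fix s' t' assume st: "s = Inr (Inr s')" "t = Inr (Inr t')"
    then have "d s' t' \<noteq> 0" using that by simp
    moreover from this have "lab s' \<inter> X = {}" "lab t' \<inter> X = {}" using F.d_nonzero disj by blast+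
    ultimately have "lab s' \<noteq> lab t'" "lab s' = (lab s' \<union> X) - X" "lab t' = (lab t' \<union> X) - X"
      using minimal by blast+
    then show ?thesis using st by auto
  qed (use that in auto)
  moreover have "\<exists>b\<in>?B. ?deg b = card (insert X A) \<and> ?lab b = \<Union>(insert X A)"
  proof -
    obtain b where "b \<in> B" "deg b = card A" "lab b = \<Union>A" using top by blast
    then show ?thesis using insert.hyps by (intro bexI[of _ "Inr (Inr b)"]) auto
  qed
  moreover have "squarefree_resolution (\<Union>(insert X A)) (\<lambda>U. \<forall>e\<in>insert X A. \<not> e \<subseteq> U) ?B ?deg ?lab ?d ?a"
  proof -
    have "(if X \<subseteq> U then False else \<forall>e\<in>A. \<not> e \<subseteq> U - X) \<longleftrightarrow> (\<forall>e\<in>insert X A. \<not> e \<subseteq> U)" for U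
    proof -
      have "e \<subseteq> U - X \<longleftrightarrow> e \<subseteq> U" if "e \<in> A" for e using X(1) that by blast
      then show ?thesis by auto
    qed
    moreover have "\<Union>A \<union> X = \<Union>(insert X A)" by auto
    ultimately show ?thesis using cone by simp
  qed
  ultimately have R: "squarefree_resolution (\<Union>(insert X A)) (\<lambda>U. \<forall>e\<in>insert X A. \<not> e \<subseteq> U) ?B ?deg ?lab ?d ?a"
    and min: "\<forall>s t. ?d s t \<noteq> 0 \<longrightarrow> ?lab s \<noteq> ?lab t"
    and top': "\<exists>b\<in>?B. ?deg b = card (insert X A) \<and> ?lab b = \<Union>(insert X A)" by blast+
  obtain b where b: "b \<in> ?B" "?deg b = card (insert X A)" "?lab b = \<Union>(insert X A)" using top' by blast
  obtain b' where b': "decode3 b' = b" using bij_decode3 by (metis bij_pointE)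
  show ?case
  proof (intro exI conjI)
    show "squarefree_resolution (\<Union>(insert X A)) (\<lambda>U. \<forall>e\<in>insert X A. \<not> e \<subseteq> U) (decode3 -` ?B)
        (?deg \<circ> decode3) (?lab \<circ> decode3) (\<lambda>s t. ?d (decode3 s) (decode3 t)) (?a \<circ> decode3)"
      by (rule squarefree_resolution.reindex[OF R bij_decode3])
    show "\<forall>s t. ?d (decode3 s) (decode3 t) \<noteq> 0 \<longrightarrow> (?lab \<circ> decode3) s \<noteq> (?lab \<circ> decode3) t"
      using min unfolding o_def by blast
    show "\<exists>b\<in>decode3 -` ?B. (?deg \<circ> decode3) b = card (insert X A) \<and> (?lab \<circ> decode3) b = \<Union>(insert X A)"
      using b b' by (intro bexI[of _ b']) auto
  qed
qed

lemma edge_ideal_coordinate_resolution: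
  fixes d :: "'b \<Rightarrow> 'b \<Rightarrow> 'k::field"
  assumes G: "simple_graph V E"
    and F: "squarefree_resolution V (\<lambda>U. \<forall>e\<in>E. \<not> e \<subseteq> U) B deg lab d a"
    and minimal: "\<And>s t. d s t \<noteq> 0 \<Longrightarrow> lab s \<noteq> lab t"
  shows "\<exists>n sh D q. coordinate_resolution V (edge_ideal V E :: ('v, 'k) mpoly set) n sh D q \<and>
    (\<forall>i s t. lookup (D i s t) 0 = 0) \<and>
    (\<forall>i j. (\<exists>t<n i. sh i t = j) \<longleftrightarrow> (\<exists>b\<in>B. deg b = i \<and> int (card (lab b)) = j))"
proof -
  have E: "e \<subseteq> V \<and> card e = 2" if "e \<in> E" for e using that G by (simp add: simple_graph_def)
  have "\<forall>e\<in>E. \<not> e \<subseteq> {}" using E by fastforce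
  moreover have "(edge_ideal V E :: ('v, 'k) mpoly set) =
      {p \<in> carrier (polynomial_ring V). \<forall>m\<in>keys p. \<not> (\<forall>e\<in>E. \<not> e \<subseteq> keys m)}"
    by (subst edge_ideal_eq[OF E]) auto
  moreover have "finite V" using G by (simp add: simple_graph_def)
  ultimately show ?thesis
    using squarefree_resolution.coordinate_resolution_exists[OF F _ _ edge_ideal_eq(2)[OF E] _ minimal] by blast
qed

text \<open>The labels contained in \<open>W\<close>, the vertex set of a maximum family of pairwise 3-disjoint edges,
  resolve the edge ideal of the induced matching on \<open>W\<close>, whose top Betti number is nonzero.\<close>

lemma induced_matching_label:
  fixes d :: "'b \<Rightarrow> 'b \<Rightarrow> 'k::field"
  assumes G: "simple_graph V E"
    and F: "squarefree_resolution V (\<lambda>U. \<forall>e\<in>E. \<not> e \<subseteq> U) B deg lab d a"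
    and minimal: "\<And>s t. d s t \<noteq> 0 \<Longrightarrow> lab s \<noteq> lab t"
  shows "\<exists>b\<in>B. deg b = three_disjoint_number E \<and> card (lab b) = 2 * three_disjoint_number E"
proof -
  obtain A where A: "pairwise_three_disjoint E A" "card A = three_disjoint_number E"
    using three_disjoint_number_attained[OF simple_graph_finite[OF G]] by blast
  define W where "W = \<Union>A"
  have A_E: "A \<subseteq> E" using A(1) by (simp add: pairwise_three_disjoint_def)
  have W_V: "W \<subseteq> V" using A_E G by (auto simp: W_def simple_graph_def)
  have card2: "card e = 2" if "e \<in> E" for e using that G by (simp add: simple_graph_def)
  have A_disj: "e \<inter> f = {}" if "e \<in> A" "f \<in> A" "e \<noteq> f" for e f
    using A(1) that by (simp add: pairwise_three_disjoint_def three_disjoint_def)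
  have fin_A: "finite A" using A_E simple_graph_finite[OF G] finite_subset by blast
  \<comment> \<open>The ends of \<open>e\<close> lie in at most two members \<open>f\<close> and
    \<open>g\<close> of \<open>A\<close>, and 3-disjointness leaves no further edge inside
    \<open>f \<union> g\<close>.\<close>
  have in_A: "e \<in> A" if e: "e \<in> E" "e \<subseteq> W" for e
  proof -
    obtain u v where uv: "e = {u, v}" using card2[OF e(1)] by (metis card_2_iff)
    then obtain f g where fg: "f \<in> A" "u \<in> f" "g \<in> A" "v \<in> g" using e(2) by (auto simp: W_def)
    show ?thesis
    proof (cases "f = g")
      case True
      have "card f = 2" using card2 A_E fg by blast
      moreover have "finite f" using \<open>card f = 2\<close> card.infinite by fastforce
      moreover have "e \<subseteq> f" using uv fg True by blast
      ultimately have "e = f" using card2[OF e(1)] card_subset_eq by metis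
      then show ?thesis using fg by simp
    next
      case False
      then have "induced_edges E (f \<union> g) = {f, g}"
        using A(1) fg by (simp add: pairwise_three_disjoint_def three_disjoint_def)
      moreover have "e \<in> induced_edges E (f \<union> g)" using e uv fg by (auto simp: induced_edges_def)
      ultimately show ?thesis using fg by auto
    qed
  qed
  have GW: "simple_graph W A"
    using G A_E fin_A by (auto simp: simple_graph_def W_def intro: finite_subset[OF W_V, unfolded W_def])
  have card_W: "card W = 2 * card A"
  proof -
    have "card (\<Union>A) = (\<Sum>e\<in>A. card e)"
      using A_disj A_E card2 by (intro card_Union_disjoint) (auto simp: pairwise_def disjnt_def intro!: card_ge_0_finite)
    also have "\<dots> = (\<Sum>e\<in>A. 2)" using card2 A_E by (intro sum.cong) auto
    finally show ?thesis by (simp add: W_def)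
  qed
  have "\<forall>e\<in>A. e \<noteq> {}" using card2 A_E by fastforce
  then obtain B' :: "nat set" and deg' lab' and d' :: "nat \<Rightarrow> nat \<Rightarrow> 'k" and a' where
    M: "squarefree_resolution (\<Union>A) (\<lambda>U. \<forall>e\<in>A. \<not> e \<subseteq> U) B' deg' lab' d' a'"
      "\<And>s t. d' s t \<noteq> 0 \<Longrightarrow> lab' s \<noteq> lab' t"
      "\<exists>b\<in>B'. deg' b = card A \<and> lab' b = \<Union>A"
    using matching_resolution[OF fin_A, where 'k = 'k] A_disj by blast
  let ?B = "{b \<in> B. lab b \<subseteq> W}"
  have "squarefree_resolution W (\<lambda>U. \<forall>e\<in>E. \<not> e \<subseteq> U) ?B deg lab
      (\<lambda>s t. if lab t \<subseteq> W then d s t else 0) (\<lambda>s. if lab s \<subseteq> W then a s else 0)"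
    by (rule squarefree_resolution.restrict[OF F W_V])
  then have R: "squarefree_resolution W (\<lambda>U. \<forall>e\<in>A. \<not> e \<subseteq> U) ?B deg lab
      (\<lambda>s t. if lab t \<subseteq> W then d s t else 0) (\<lambda>s. if lab s \<subseteq> W then a s else 0)"
    by (rule squarefree_resolution.cong_predicate) (use A_E in_A in blast)
  have "lab s \<noteq> lab t" if "(if lab t \<subseteq> W then d s t else 0) \<noteq> 0" for s t
    using that minimal by (auto split: if_splits)
  from edge_ideal_coordinate_resolution[OF GW R this] obtain n sh D q where
    R': "coordinate_resolution W (edge_ideal W A :: ('a, 'k) mpoly set) n sh D q"
      "\<And>i j. (\<exists>t<n i. sh i t = j) \<longleftrightarrow> (\<exists>b\<in>?B. deg b = i \<and> int (card (lab b)) = j)" by blast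
  from edge_ideal_coordinate_resolution[OF GW M(1,2)[folded W_def]] obtain n' sh' D' q' where
    M': "coordinate_resolution W (edge_ideal W A :: ('a, 'k) mpoly set) n' sh' D' q'"
      "\<And>i s t. lookup (D' i s t) 0 = 0"
      "\<And>i j. (\<exists>t<n' i. sh' i t = j) \<longleftrightarrow> (\<exists>b\<in>B'. deg' b = i \<and> int (card (lab' b)) = j)" by blast
  have "\<exists>b\<in>B'. deg' b = card A \<and> int (card (lab' b)) = int (2 * card A)"
    using M(3) card_W by (auto simp: W_def)
  then obtain t where t: "t < n' (card A)" "sh' (card A) t = int (2 * card A)"
    unfolding M'(3)[symmetric] by blast
  \<comment> \<open>The Koszul complex \<open>M'\<close> is the minimal side of the comparison, so
    its top shift has to occur in \<open>R'\<close>.\<close>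
  have "\<exists>s<n (card A). sh (card A) s = int (2 * card A)"
    using minimal_shift_occurs[OF M'(1) R'(1) M'(2) t(1)] t(2) by simp
  then have "\<exists>b\<in>?B. deg b = card A \<and> int (card (lab b)) = int (2 * card A)" unfolding R'(2) .
  then show ?thesis using A(2) by auto
qed

theorem theorem2p4:
  fixes V :: "'v set" and E :: "'v set set"
    and I :: "('v, 'k::field) mpoly set"
  assumes "simple_graph V E"
    and "C5_free V E"
    and "vertex_decomposable V E"
    and "I = edge_ideal V E"
  shows "regularity V (quotient_module (polynomial_ring V) I) (quotient_grading V I)
           = int (three_disjoint_number E)"
proof -
  let ?c = "int (three_disjoint_number E)"
  let ?M = "quotient_module (polynomial_ring V) I" and ?gr = "quotient_grading V I"
  obtain B0 :: "nat set" and deg lab and d0 :: "nat \<Rightarrow> nat \<Rightarrow> 'k" and a0 where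
    "squarefree_resolution V (\<lambda>U. \<forall>e\<in>E. \<not> e \<subseteq> U) B0 deg lab d0 a0"
    and bound0: "\<And>b. b \<in> B0 \<Longrightarrow> int (card (lab b)) \<le> int (deg b) + ?c"
    using bounded_resolution_vertex_decomposable[OF assms(3,1,2), where 'k = 'k]
    unfolding bounded_resolution_def by blast
  from squarefree_minimize[OF this(1)] obtain B and d :: "nat \<Rightarrow> nat \<Rightarrow> 'k" and a where
    "B \<subseteq> B0" and res: "squarefree_resolution V (\<lambda>U. \<forall>e\<in>E. \<not> e \<subseteq> U) B deg lab d a"
    and minimal: "\<And>s t. d s t \<noteq> 0 \<Longrightarrow> lab s \<noteq> lab t" by blast
  obtain n sh D q where
    C: "coordinate_resolution V I n sh D q" "\<And>i s t. lookup (D i s t) 0 = 0"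
      "\<And>i j. (\<exists>t<n i. sh i t = j) \<longleftrightarrow> (\<exists>b\<in>B. deg b = i \<and> int (card (lab b)) = j)"
    using edge_ideal_coordinate_resolution[OF assms(1) res minimal] assms(4) by blast
  interpret graded_ideal V I using C(1) by (simp add: coordinate_resolution_def)
  \<comment> \<open>The resolution that \<open>graded_betti\<close> selects. The explicit one
    exhibited next guarantees that the choice is a minimal resolution.\<close>
  let ?F = "SOME F. minimal_graded_free_resolution V ?M ?gr F"
  have "minimal_graded_free_resolution V ?M ?gr
      \<lparr>rnk = n, shift = sh, diff = \<lambda>i. mat (n i) (n (Suc i)) (\<lambda>(s, t). D i s t), aug = \<lambda>t. coset (q t)\<rparr>"
    unfolding minimal_graded_free_resolution_def
    using graded_of_coordinate_resolution[OF C(1)] C(2) by simp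
  then have F: "minimal_graded_free_resolution V ?M ?gr ?F" by (rule someI)
  then obtain q' where
    F': "coordinate_resolution V I (rnk ?F) (shift ?F) (\<lambda>i. entry (rnk ?F i) (rnk ?F (Suc i)) (diff ?F i)) q'"
    using coordinate_resolution_of_graded unfolding minimal_graded_free_resolution_def by blast
  have F_minimal: "lookup (entry (rnk ?F i) (rnk ?F (Suc i)) (diff ?F i) s t) 0 = 0" for i s t
    using F unfolding minimal_graded_free_resolution_def entry_def by simp
  \<comment> \<open>Both resolutions are minimal, so the comparison applies in either
    direction.\<close>
  have shifts: "(\<exists>t<rnk ?F i. shift ?F i t = j) \<longleftrightarrow> (\<exists>b\<in>B. deg b = i \<and> int (card (lab b)) = j)" for i j
    unfolding C(3)[symmetric]
    using minimal_shift_occurs[OF F' C(1) F_minimal] minimal_shift_occurs[OF C(1) F' C(2)] by metis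
  have "graded_betti V ?M ?gr i j \<noteq> 0 \<longleftrightarrow> (\<exists>t<rnk ?F i. shift ?F i t = j)" for i j
    by (auto simp: graded_betti_def Let_def card_eq_0_iff)
  then have betti: "{j - int i | i j. graded_betti V ?M ?gr i j \<noteq> 0} =
      (\<lambda>b. int (card (lab b)) - int (deg b)) ` B"
    unfolding shifts by auto
  show ?thesis
    unfolding regularity_def betti
  proof (rule Max_eqI)
    show "finite ((\<lambda>b. int (card (lab b)) - int (deg b)) ` B)"
      using squarefree_resolution.finite_B[OF res] by simp
  next
    fix j assume "j \<in> (\<lambda>b. int (card (lab b)) - int (deg b)) ` B"
    then show "j \<le> ?c" using bound0 \<open>B \<subseteq> B0\<close> by fastforce
  next
    obtain b where "b \<in> B" "deg b = three_disjoint_number E" "card (lab b) = 2 * three_disjoint_number E"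
      using induced_matching_label[OF assms(1) res minimal] by blast
    then show "?c \<in> (\<lambda>b. int (card (lab b)) - int (deg b)) ` B"
      by (intro image_eqI[of _ _ b]) auto
  qed
qed

end
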